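(* Assume the Riemann hypothesis, and fix $\beta$ with $0\le\beta<1$. Then there exist positive constants $c$ and $c_1$ such that for all sufficiently large $T$, \[ \max_{T^{\beta}\le t\le T}|S(t)| \ge c\sqrt{\frac{\log T\,\log\log\log T}{\log\log T}} \] and \[ \max_{T^{\beta}\le t\le T} S_1(t) \ge c_1\sqrt{\frac{\log T\,\log\log\log T}{(\log\log T)^3}}. \]
   Context: $S(t):=\frac1\pi\operatorname{Im}\log\zeta(1/2+it)$, where, when $t$ is not the ordinate of a zero of $\zeta$, $\log\zeta(\sigma+it)$ is defined by continuous variation along the straight line segments joining $2$, $2+it$ and $\sigma+it$, starting from the real value $\log\zeta(2)$; if $t$ is the ordinate of a zero, $S(t):=\lim_{\varepsilon\to0}(S(t+\varepsilon)+S(t-\varepsilon))/2$. Further $S_1(t):=\int_0^t S(\tau)\,d\tau$. *)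

theory Defs
  imports "HOL-Complex_Analysis.Complex_Analysis"
begin

text \<open>The Riemann zeta function: the (unique) holomorphic function on the complex
plane minus the pole 1 that agrees with the Dirichlet series for Re s > 1
(uniqueness by the identity theorem; existence is the classical analytic continuation).\<close>
definition riemann_zeta :: "complex \<Rightarrow> complex" where
  "riemann_zeta = (SOME f. f holomorphic_on (- {1}) \<and>
      (\<forall>s. 1 < Re s \<longrightarrow> f s = (\<Sum>n. 1 / (of_nat (Suc n)) powr s)))"

definition RH :: bool where
  "RH \<longleftrightarrow> (\<forall>s. riemann_zeta s = 0 \<and> 0 < Re s \<and> Re s < 1 \<longrightarrow> Re s = 1/2)"

definition zero_ordinate :: "real \<Rightarrow> bool" where
  "zero_ordinate t \<longleftrightarrow> (\<exists>s. s \<noteq> 1 \<and> riemann_zeta s = 0 \<and> Im s = t)"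

definition S_path :: "real \<Rightarrow> real \<Rightarrow> complex" where
  "S_path t = linepath 2 (2 + \<i> * of_real t) +++ linepath (2 + \<i> * of_real t) (1/2 + \<i> * of_real t)"

definition log_zeta_half :: "real \<Rightarrow> complex" where
  "log_zeta_half t = (SOME g. continuous_on {0..1} g \<and>
       (\<forall>u\<in>{0..1}. exp (g u) = riemann_zeta (S_path t u)) \<and>
       g 0 = Ln (riemann_zeta 2)) 1"

definition S0 :: "real \<Rightarrow> real" where
  "S0 t = Im (log_zeta_half t) / pi"

definition S :: "real \<Rightarrow> real" where
  "S t = (if zero_ordinate t then Lim (at_right 0) (\<lambda>e. (S0 (t + e) + S0 (t - e)) / 2)
          else S0 t)"

definition S1 :: "real \<Rightarrow> real" where
  "S1 t = integral {0..t} S"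

end

theory Submission
  imports Defs "HOL-Number_Theory.Prime_Powers" "HOL-Probability.Probability" "HOL-Real_Asymp.Real_Asymp"
begin

text \<open>Under the Riemann hypothesis \<open>\<zeta>(s) (1 - s\<^sup>-\<^sup>2)\<close> has a holomorphic logarithm on \<open>Re s > 1/2\<close>. Up to a bounded
  error, \<open>\<pi> S\<^sub>1(t)\<close> is minus the real part of its primitive just to the right of \<open>1/2 + it\<close>. Convolving with a Gaussian of
  width \<open>1 / log log T\<close> and moving the line of integration to the half-plane of absolute convergence turns this function into
  the series \<open>\<Sum> \<Lambda>(n) / log\<^sup>2 n \<cdot> n\<^sup>-\<^sup>\<sigma> cos (t log n)\<close> with a Gaussian cutoff, whose coefficients are nonnegative.
  If it were bounded above by \<open>B\<close> for \<open>T\<^sup>\<beta> \<le> t \<le> T\<close>, so would be its mean against the square of any resonator; a resonator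
  supported on squarefree numbers with a prescribed number of prime factors in each of the dyadic blocks of primes forces
  \<open>B\<close> to be large. For \<open>S\<close> the same argument applies to the second difference
  \<open>2 S\<^sub>1(t) - S\<^sub>1(t + \<delta>) - S\<^sub>1(t - \<delta>)\<close> with \<open>\<delta> = 1 / log log T\<close>, which is at most \<open>2 \<delta> sup \<bar>S\<bar>\<close> and multiplies the
  coefficients by \<open>2 (1 - cos (\<delta> log n))\<close>; this factor is bounded below on the relevant primes.\<close>

section \<open>The zeta function in the right half-plane\<close>

text \<open>Two opposing demands fix the Gaussian width \<delta> = 1 / log log T. Moving the line of
  integration by at most 3/2 costs a factor \<open>exp (9 / (8 * \<delta>\<^sup>2))\<close>, that is
  \<open>exp (9/8 * (ln (ln T))\<^sup>2)\<close>, which is smaller than every power of T; errors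
  decaying like 1/t are therefore harmless from \<open>T powr \<beta>'\<close> on, where \<beta>' >
  0 even if \<beta> = 0. On the other hand the cutoff must spare the primes of the resonator: they
  satisfy log p \<le> 2 log log T, so there it is at least exp (-2). Up to the critical line log
  |zeta| has a uniform upper bound but no lower one, because of the zeros. Hence the argument is
  one-sided: integrated from the right, the upper bound controls minus the real part of the
  primitive, which is the sign in which S_1 appears, and averaging against nonnegative weights
  preserves it. The resonator has at most \<open>T powr \<kappa>\<close> members with \<kappa> +
  \<beta>' < 1, so that the range of |t| below \<open>T powr \<beta>'\<close>, about which nothing
  is assumed, carries negligible mass.\<close>

lemma holomorphic_suminf_local:
  fixes f :: "nat \<Rightarrow> complex \<Rightarrow> complex"
  assumes U: "open U" and f: "\<And>n. f n holomorphic_on U"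
    and bd: "\<And>x. x \<in> U \<Longrightarrow> \<exists>d h. 0 < d \<and> summable h \<and> (\<forall>n. \<forall>y\<in>ball x d \<inter> U. norm (f n y) \<le> h n)"
  shows "(\<lambda>x. \<Sum>n. f n x) holomorphic_on U"
proof -
  have *: "\<exists>d h. 0 < d \<and> summable h \<and> range h \<subseteq> \<real>\<^sub>\<ge>\<^sub>0 \<and>
      (\<forall>\<^sub>F n in sequentially. \<forall>y\<in>ball x d \<inter> U. cmod(f n y) \<le> cmod (h n))" if xU: "x \<in> U" for x
  proof -
    obtain d h where h: "0 < d" "summable h" "\<And>n y. y\<in>ball x d \<inter> U \<Longrightarrow> norm (f n y) \<le> h n"
      using bd[OF xU] by blast
    have "h n \<ge> 0" for n using h(3)[of x n] h(1) xU norm_ge_zero[of "f n x"] by (meson IntI centre_in_ball order_trans)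
    with h show ?thesis
      by (intro exI[of _ d] exI[of _ "\<lambda>n. complex_of_real (h n)"]) (auto intro: summable_of_real)
  qed
  obtain g where g: "\<forall>x \<in> U. ((\<lambda>n. f n x) sums g x) \<and> g field_differentiable (at x)"
    by (rule series_differentiable_comparison_complex[OF U _ *])
       (use f U holomorphic_on_imp_differentiable_at in blast)+
  have "g holomorphic_on U" using g
    by (meson field_differentiable_at_within holomorphic_on_def)
  then show ?thesis
    by (rule holomorphic_transform) (use g in \<open>auto simp: sums_iff\<close>)
qed

section \<open>Analytic continuation by repeated integration by parts\<close>

text \<open>\<open>frac_sum P s\<close> is the integral of P({x}) x^(-s) over [1, \<infinity>), cut
  at the integers; the n-th term belongs to [n+1, n+2]. The continuation of zeta is built from such
  integrals.\<close>

definition frac_term :: "(real \<Rightarrow> real) \<Rightarrow> nat \<Rightarrow> complex \<Rightarrow> complex" where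
  "frac_term P n s = integral {0..1} (\<lambda>w. of_real (P w) * of_real (real (Suc n) + w) powr (-s))"

definition frac_sum :: "(real \<Rightarrow> real) \<Rightarrow> complex \<Rightarrow> complex" where
  "frac_sum P s = (\<Sum>n. frac_term P n s)"

lemma frac_integrand_continuous:
  assumes "continuous_on {0..1} P"
  shows "continuous_on {0..1} (\<lambda>w. complex_of_real (P w) * of_real (real (Suc n) + w) powr (-s))"
proof -
  have "continuous_on {0..1} (\<lambda>w. complex_of_real (P w) * exp (- s * Ln (of_real (real (Suc n) + w))))"
    by (intro continuous_intros assms) (auto simp: complex_nonpos_Reals_iff)
  then show ?thesis
    by (rule continuous_on_eq) (auto simp: powr_def complex_eq_iff)
qed

lemma frac_term_holomorphic:
  assumes "continuous_on {0..1} P"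
  shows "frac_term P n holomorphic_on UNIV"
proof -
  have nz: "complex_of_real (real (Suc n) + t) \<noteq> 0" "complex_of_real (real (Suc n) + t) \<notin> \<real>\<^sub>\<le>\<^sub>0" if "t \<in> {0..1}" for t
    using that by (auto simp: complex_nonpos_Reals_iff simp del: of_real_add)
  have "(\<lambda>s. integral (cbox 0 1) (\<lambda>w. of_real (P w) * of_real (real (Suc n) + w) powr (-s))) holomorphic_on UNIV"
  proof (rule leibniz_rule_holomorphic[where fx = "\<lambda>s w. of_real (P w) * (- Ln (of_real (real (Suc n) + w)) * of_real (real (Suc n) + w) powr (-s))"])
    fix x :: complex and t :: real assume "t \<in> cbox 0 1"
    then show "((\<lambda>x. complex_of_real (P t) * complex_of_real (real (Suc n) + t) powr - x) has_field_derivative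
          complex_of_real (P t) * (- Ln (complex_of_real (real (Suc n) + t)) * complex_of_real (real (Suc n) + t) powr - x)) (at x)"
      using nz[of t] by (auto intro!: derivative_eq_intros simp: powr_def simp del: of_real_add)
  next
    fix x :: complex
    show "(\<lambda>w. complex_of_real (P w) * of_real (real (Suc n) + w) powr (-x)) integrable_on cbox 0 1"
      using integrable_continuous_interval[OF frac_integrand_continuous[OF assms]] by simp
  next
    have c: "continuous_on (UNIV \<times> cbox 0 1) (\<lambda>x::complex \<times> real. P (snd x))"
      by (rule continuous_on_compose2[OF assms]) (auto intro!: continuous_intros)
    have "continuous_on (UNIV \<times> cbox 0 1) (\<lambda>x::complex \<times> real. of_real (P (snd x)) * (- Ln (of_real (real (Suc n) + snd x)) * exp (- fst x * Ln (of_real (real (Suc n) + snd x)))))"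
      by (intro continuous_intros c) (auto simp: complex_nonpos_Reals_iff)
    then show "continuous_on (UNIV \<times> cbox 0 1) (\<lambda>(s, w). complex_of_real (P w) * (- Ln (of_real (real (Suc n) + w)) * of_real (real (Suc n) + w) powr (-s)))"
      by (rule continuous_on_eq) (use nz in \<open>auto simp: powr_def simp del: of_real_add\<close>)
  qed auto
  then show ?thesis by (simp add: frac_term_def[abs_def])
qed

lemma frac_term_bound:
  assumes "continuous_on {0..1} P" and B: "\<And>w. w \<in> {0..1} \<Longrightarrow> \<bar>P w\<bar> \<le> B" and s: "Re s \<ge> 0"
  shows "norm (frac_term P n s) \<le> B * real (Suc n) powr (- Re s)"
proof -
  have "norm (integral {0..1::real} (\<lambda>w. of_real (P w) * of_real (real (Suc n) + w) powr (-s))) \<le> (B * real (Suc n) powr (- Re s)) * (1 - 0)"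
  proof (rule integral_bound)
    fix w :: real assume w: "w \<in> {0..1}"
    have "norm (of_real (P w) * of_real (real (Suc n) + w) powr (-s)) = \<bar>P w\<bar> * (real (Suc n) + w) powr (- Re s)"
      using w by (simp add: norm_mult norm_powr_real_powr del: of_real_add of_nat_Suc)
    also have "\<dots> \<le> B * real (Suc n) powr (- Re s)"
      using w s B[OF w] by (intro mult_mono powr_mono2') auto
    finally show "norm (of_real (P w) * of_real (real (Suc n) + w) powr (-s)) \<le> B * real (Suc n) powr (- Re s)" .
  qed (simp, rule frac_integrand_continuous[OF assms(1)])
  then show ?thesis by (simp add: frac_term_def)
qed

lemma summable_Suc_powr: "a > 1 \<Longrightarrow> summable (\<lambda>n. real (Suc n) powr (- a))"
  using summable_real_powr_iff[of "-a"] by (subst summable_Suc_iff) auto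

lemma bounded_continuous_unit_interval:
  fixes P :: "real \<Rightarrow> real"
  assumes "continuous_on {0..1} P"
  obtains B where "B > 0" "\<And>w. w \<in> {0..1} \<Longrightarrow> \<bar>P w\<bar> \<le> B"
  using compact_imp_bounded[OF compact_continuous_image[OF assms compact_Icc]]
  by (auto simp: bounded_pos intro: that)

lemma frac_term_summable:
  assumes P: "continuous_on {0..1} P" and s: "Re s > 1"
  shows "summable (\<lambda>n. frac_term P n s)"
proof -
  obtain B where B: "B > 0" "\<And>w. w \<in> {0..1} \<Longrightarrow> \<bar>P w\<bar> \<le> B"
    using bounded_continuous_unit_interval[OF P] by blast
  show ?thesis
    by (rule summable_comparison_test'[where N=0, OF summable_mult[of _ B, OF summable_Suc_powr[OF s]]])
       (use frac_term_bound[OF P B(2), of s] s in auto)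
qed

lemma frac_sum_bound:
  assumes P: "continuous_on {0..1} P" and B: "\<And>w. w \<in> {0..1} \<Longrightarrow> \<bar>P w\<bar> \<le> B" and a: "a > 1" and s: "Re s \<ge> a"
  shows "norm (frac_sum P s) \<le> B * (\<Sum>n. real (Suc n) powr (- a))"
proof -
  have B0: "B \<ge> 0" using B[of 0] by auto
  have le: "norm (frac_term P n s) \<le> B * real (Suc n) powr (- a)" for n
  proof -
    have "B * real (Suc n) powr (- Re s) \<le> B * real (Suc n) powr (- a)"
      by (intro mult_left_mono powr_mono) (use B0 s in auto)
    then show ?thesis using frac_term_bound[OF P B, of s n] s a by linarith
  qed
  have sm: "summable (\<lambda>n. B * real (Suc n) powr (- a))"
    by (intro summable_mult summable_Suc_powr a)
  have "norm (frac_sum P s) \<le> (\<Sum>n. norm (frac_term P n s))"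
    unfolding frac_sum_def by (rule summable_norm) (rule summable_comparison_test'[OF sm], use le in auto)
  also have "\<dots> \<le> (\<Sum>n. B * real (Suc n) powr (- a))"
    by (rule suminf_le[OF le _ sm]) (rule summable_comparison_test'[OF sm], use le in auto)
  also have "\<dots> = B * (\<Sum>n. real (Suc n) powr (- a))"
    by (rule suminf_mult) (rule summable_Suc_powr[OF a])
  finally show ?thesis .
qed

lemma frac_sum_holomorphic:
  assumes P: "continuous_on {0..1} P"
  shows "frac_sum P holomorphic_on {s. 1 < Re s}"
proof -
  obtain B where B: "B > 0" "\<And>w. w \<in> {0..1} \<Longrightarrow> \<bar>P w\<bar> \<le> B"
    using bounded_continuous_unit_interval[OF P] by blast
  show ?thesis unfolding frac_sum_def[abs_def]
  proof (rule holomorphic_suminf_local)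
    fix x :: complex assume x: "x \<in> {s. 1 < Re s}"
    define a where "a = (1 + Re x) / 2"
    have a: "a > 1" "a < Re x" using x by (auto simp: a_def)
    show "\<exists>d h. 0 < d \<and> summable h \<and> (\<forall>n. \<forall>y\<in>ball x d \<inter> {s. 1 < Re s}. cmod (frac_term P n y) \<le> h n)"
    proof (intro exI[of _ "Re x - a"] exI[of _ "\<lambda>n. B * real (Suc n) powr (-a)"] conjI allI ballI)
      fix n y assume y: "y \<in> ball x (Re x - a) \<inter> {s. 1 < Re s}"
      have "Re y \<ge> a" using y abs_Re_le_cmod[of "x - y"] by (auto simp: dist_norm)
      then have "B * real (Suc n) powr (- Re y) \<le> B * real (Suc n) powr (- a)"
        by (intro mult_left_mono powr_mono) (use B in auto)
      then show "cmod (frac_term P n y) \<le> B * real (Suc n) powr (- a)"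
        using frac_term_bound[OF P B(2), of y n] a y by auto
    qed (use a in \<open>auto intro!: summable_mult summable_Suc_powr simp del: of_nat_Suc\<close>)
  qed (auto intro: open_halfspace_Re_gt holomorphic_on_subset[OF frac_term_holomorphic[OF P]])
qed

lemma powr_shift_deriv:
  assumes "w \<ge> 0"
  shows "((\<lambda>w. complex_of_real (real (Suc n) + w) powr z) has_vector_derivative
     z * of_real (real (Suc n) + w) powr (z - 1)) (at w within A)"
proof -
  have "((\<lambda>w. w powr z) has_field_derivative z * of_real (real (Suc n) + w) powr (z - 1)) (at (of_real (real (Suc n) + w)))"
    using assms by (intro has_field_derivative_powr) (auto simp: complex_nonpos_Reals_iff)
  moreover have "((\<lambda>w. complex_of_real (real (Suc n) + w)) has_vector_derivative 1) (at w within A)"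
    by (auto intro!: derivative_eq_intros)
  ultimately show ?thesis
    using field_vector_diff_chain_within[of "\<lambda>w. complex_of_real (real (Suc n) + w)" 1 w A "\<lambda>w. w powr z"]
    by (auto simp: o_def intro: has_field_derivative_at_within)
qed

lemma frac_term_one:
  assumes "s \<noteq> 1"
  shows "frac_term (\<lambda>_. 1) n s = (of_nat (Suc n) powr (1 - s) - of_nat (Suc (Suc n)) powr (1 - s)) / (s - 1)"
proof -
  have "((\<lambda>w. of_real (real (Suc n) + w) powr (-s)) has_integral
      (of_real (real (Suc n) + 1) powr (1 - s) / (1 - s) - of_real (real (Suc n) + 0) powr (1 - s) / (1 - s))) {0..1}"
  proof (rule fundamental_theorem_of_calculus)
    fix w :: real assume "w \<in> {0..1}"
    then have "((\<lambda>w. complex_of_real (real (Suc n) + w) powr (1-s)) has_vector_derivative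
       (1-s) * of_real (real (Suc n) + w) powr (1 - s - 1)) (at w within {0..1})"
      by (intro powr_shift_deriv) auto
    from has_vector_derivative_divide[OF this, of "1-s"]
    show "((\<lambda>w. complex_of_real (real (Suc n) + w) powr (1-s) / (1 - s)) has_vector_derivative
        of_real (real (Suc n) + w) powr (-s)) (at w within {0..1})" using assms by simp
  qed auto
  then have "frac_term (\<lambda>_. 1) n s = of_real (real (Suc n) + 1) powr (1 - s) / (1 - s) - of_real (real (Suc n) + 0) powr (1 - s) / (1 - s)"
    by (simp add: frac_term_def integral_unique)
  moreover have "b / (1 - s) - a / (1 - s) = (a - b) / (s - 1)" for a b
    by (metis minus_diff_eq minus_divide_divide diff_divide_distrib)
  ultimately show ?thesis by (simp add: add.commute)
qed

lemma Suc_powr_telescope: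
  assumes "Re s > 1"
  shows "(\<lambda>n. of_nat (Suc n) powr (1 - s) - of_nat (Suc (Suc n)) powr (1 - s)) sums (1::complex)"
proof -
  have "(\<lambda>n. norm (of_nat (Suc n) powr (1 - s) :: complex)) \<longlonglongrightarrow> 0"
  proof -
    have "(\<lambda>n. real (Suc n) powr (1 - Re s)) \<longlonglongrightarrow> 0"
      by (rule tendsto_neg_powr[OF _ filterlim_compose[OF filterlim_real_sequentially filterlim_Suc]]) (use assms in auto)
    moreover have "norm (of_nat (Suc n) powr (1 - s) :: complex) = real (Suc n) powr (1 - Re s)" for n
      using norm_powr_real_powr[of "of_nat (Suc n)" "1 - s"] by simp
    ultimately show ?thesis by simp
  qed
  then have "(\<lambda>n. of_nat (Suc n) powr (1 - s) :: complex) \<longlonglongrightarrow> 0" by (rule tendsto_norm_zero_cancel)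
  from telescope_sums'[OF this] show ?thesis by simp
qed

lemma frac_sum_one:
  assumes "Re s > 1"
  shows "(s - 1) * frac_sum (\<lambda>_. 1) s = 1"
proof -
  have s: "s \<noteq> 1" using assms by auto
  have "(\<lambda>n. frac_term (\<lambda>_. 1) n s) sums (1 / (s - 1))"
    unfolding frac_term_one[OF s] using sums_divide[OF Suc_powr_telescope[OF assms], of "s - 1"] by simp
  then show ?thesis using s by (simp add: frac_sum_def sums_iff)
qed

text \<open>Integration by parts against the primitive of \<open>P\<close> minus its mean, which vanishes at both ends of the unit interval.\<close>
lemma frac_sum_by_parts:
  fixes P :: "real \<Rightarrow> real"
  assumes P: "continuous_on {0..1} P"
  defines "m \<equiv> integral {0..1} P"
  obtains Q where "continuous_on {0..1} Q"
    "\<And>s. Re s > 1 \<Longrightarrow> (s - 1) * frac_sum P s = of_real m + (s - 1) * (s * frac_sum Q (s + 1))"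
proof
  define Q where "Q = (\<lambda>w. integral {0..w} (\<lambda>x. P x - m))"
  have Pm: "continuous_on {0..1} (\<lambda>x. P x - m)" by (intro continuous_intros P)
  have dQ: "(Q has_real_derivative P w - m) (at w within {0..1})" if "w \<in> {0..1}" for w
    unfolding Q_def has_real_derivative_iff_has_vector_derivative using integral_has_vector_derivative[OF Pm that] .
  show cQ: "continuous_on {0..1} Q"
    using dQ by (meson DERIV_continuous continuous_on_eq_continuous_within)
  have Q0: "Q 0 = 0" by (simp add: Q_def)
  have Q1: "Q 1 = 0"
    using integral_diff[OF integrable_continuous_interval[OF P] integrable_const_ivl[of m 0 1]]
    by (simp add: Q_def m_def)
  fix s :: complex assume s: "Re s > 1"
  have tm: "frac_term P n s = of_real m * frac_term (\<lambda>_. 1) n s + s * frac_term Q n (s + 1)" for n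
  proof -
    have "((\<lambda>w. of_real (Q w) * (- s * of_real (real (Suc n) + w) powr (-s-1)) + of_real (P w - m) * of_real (real (Suc n) + w) powr (-s)) has_integral
      of_real (Q 1) * of_real (real (Suc n) + 1) powr (-s) - of_real (Q 0) * of_real (real (Suc n) + 0) powr (-s)) {0..1}"
    proof (rule fundamental_theorem_of_calculus)
      fix w :: real assume w: "w \<in> {0..1}"
      show "((\<lambda>w. complex_of_real (Q w) * of_real (real (Suc n) + w) powr (-s)) has_vector_derivative
         of_real (Q w) * (- s * of_real (real (Suc n) + w) powr (-s-1)) + of_real (P w - m) * of_real (real (Suc n) + w) powr (-s)) (at w within {0..1})"
        by (intro has_vector_derivative_mult powr_shift_deriv has_vector_derivative_of_real dQ) (use w in auto)
    qed auto
    then have h: "((\<lambda>w. of_real (Q w) * (- s * of_real (real (Suc n) + w) powr (-s-1)) + of_real (P w - m) * of_real (real (Suc n) + w) powr (-s)) has_integral 0) {0..1}"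
      by (simp add: Q0 Q1)
    have i1: "((\<lambda>w. of_real (P w) * of_real (real (Suc n) + w) powr (-s)) has_integral frac_term P n s) {0..1}"
      unfolding frac_term_def by (intro integrable_integral integrable_continuous_interval frac_integrand_continuous P)
    have i2: "((\<lambda>w. of_real 1 * of_real (real (Suc n) + w) powr (-s)) has_integral frac_term (\<lambda>_. 1) n s) {0..1}"
      unfolding frac_term_def by (intro integrable_integral integrable_continuous_interval frac_integrand_continuous continuous_intros)
    have i3: "((\<lambda>w. of_real (Q w) * of_real (real (Suc n) + w) powr (-(s+1))) has_integral frac_term Q n (s+1)) {0..1}"
      unfolding frac_term_def by (intro integrable_integral integrable_continuous_interval frac_integrand_continuous cQ)
    have "((\<lambda>w. of_real (P w) * of_real (real (Suc n) + w) powr (-s) - of_real m * (of_real 1 * of_real (real (Suc n) + w) powr (-s))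
        - s * (of_real (Q w) * of_real (real (Suc n) + w) powr (-(s+1)))) has_integral
        frac_term P n s - of_real m * frac_term (\<lambda>_. 1) n s - s * frac_term Q n (s+1)) {0..1}"
      by (intro has_integral_diff has_integral_mult_right i1 i2 i3)
    moreover have "((\<lambda>w. of_real (P w) * of_real (real (Suc n) + w) powr (-s) - of_real m * (of_real 1 * of_real (real (Suc n) + w) powr (-s))
        - s * (of_real (Q w) * of_real (real (Suc n) + w) powr (-(s+1)))) has_integral 0) {0..1}"
      by (rule has_integral_eq[OF _ h]) (simp add: algebra_simps minus_diff_commute del: of_real_add)
    ultimately have "frac_term P n s - of_real m * frac_term (\<lambda>_. 1) n s - s * frac_term Q n (s+1) = 0"
      by (rule has_integral_unique)
    then show ?thesis by (simp add: algebra_simps)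
  qed
  have "frac_sum P s = of_real m * frac_sum (\<lambda>_. 1) s + s * frac_sum Q (s + 1)"
    unfolding frac_sum_def tm using s
    by (simp add: suminf_add[symmetric] suminf_mult summable_mult frac_term_summable cQ)
  then show "(s - 1) * frac_sum P s = of_real m + (s - 1) * (s * frac_sum Q (s + 1))"
    using frac_sum_one[OF s] by (simp add: algebra_simps)
qed

text \<open>One integration by parts replaces the exponent s by s + 1, so evaluating E at s + 1
  extends the domain by one unit to the left. The factor s - 1 clears the pole produced by the mean
  of \<open>P\<close>. The induction keeps \<open>P\<close> arbitrary since each step replaces it by
  another function.\<close>

lemma frac_sum_continuation:
  "continuous_on {0..1} P \<Longrightarrow>
    \<exists>E. E holomorphic_on {s. 1 - real j < Re s} \<and> (\<forall>s. 1 < Re s \<longrightarrow> E s = (s - 1) * frac_sum P s)"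
proof (induction j arbitrary: P)
  case 0
  then show ?case
    by (intro exI[of _ "\<lambda>s. (s - 1) * frac_sum P s"]) (auto intro!: holomorphic_intros frac_sum_holomorphic)
next
  case (Suc j)
  obtain Q where Q: "continuous_on {0..1} Q"
    "\<And>s. Re s > 1 \<Longrightarrow> (s - 1) * frac_sum P s = of_real (integral {0..1} P) + (s - 1) * (s * frac_sum Q (s + 1))"
    using frac_sum_by_parts[OF Suc.prems] by blast
  obtain E where E: "E holomorphic_on {s. 1 - real j < Re s}" "\<And>s. 1 < Re s \<Longrightarrow> E s = (s - 1) * frac_sum Q s"
    using Suc.IH[OF Q(1)] by blast
  have "(E \<circ> (\<lambda>s. s + 1)) holomorphic_on {s. 1 - real (Suc j) < Re s}"
    by (rule holomorphic_on_compose_gen[OF _ E(1)]) (auto intro!: holomorphic_intros)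
  then have "(\<lambda>s. of_real (integral {0..1} P) + (s - 1) * E (s + 1)) holomorphic_on {s. 1 - real (Suc j) < Re s}"
    by (intro holomorphic_intros) (simp add: o_def)
  then show ?case
    by (intro exI[of _ "\<lambda>s. of_real (integral {0..1} P) + (s - 1) * E (s + 1)"]) (auto simp: Q(2) E(2))
qed

text \<open>Euler-Maclaurin summation of first order: the derivative of (w - 1) (n + 1 + w)^(-s)
  integrates to (n + 1)^(-s) over the unit interval, which produces the weight 1 - w.\<close>

lemma dirichlet_series_eq_frac_sum:
  assumes "Re s > 1"
  shows "(\<lambda>n. 1 / (of_nat (Suc n)) powr s) sums (frac_sum (\<lambda>_. 1) s + s * frac_sum (\<lambda>w. 1 - w) (s + 1))"
proof -
  have cQ: "continuous_on {0..1} (\<lambda>w::real. 1 - w)" by (intro continuous_intros)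
  have tm: "1 / (of_nat (Suc n)) powr s = frac_term (\<lambda>_. 1) n s + s * frac_term (\<lambda>w. 1 - w) n (s + 1)" for n
  proof -
    have "((\<lambda>w. of_real (w - 1) * (- s * of_real (real (Suc n) + w) powr (-s-1)) + of_real 1 * of_real (real (Suc n) + w) powr (-s)) has_integral
      of_real (1 - 1) * of_real (real (Suc n) + 1) powr (-s) - of_real (0 - 1) * of_real (real (Suc n) + 0) powr (-s)) {0..1}"
    proof (rule fundamental_theorem_of_calculus)
      fix w :: real assume w: "w \<in> {0..1}"
      show "((\<lambda>w. complex_of_real (w - 1) * of_real (real (Suc n) + w) powr (-s)) has_vector_derivative
         of_real (w - 1) * (- s * of_real (real (Suc n) + w) powr (-s-1)) + of_real 1 * of_real (real (Suc n) + w) powr (-s)) (at w within {0..1})"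
        by (intro has_vector_derivative_mult powr_shift_deriv has_vector_derivative_of_real) (use w in \<open>auto intro!: derivative_eq_intros\<close>)
    qed auto
    then have h: "((\<lambda>w. of_real (w - 1) * (- s * of_real (real (Suc n) + w) powr (-s-1)) + of_real 1 * of_real (real (Suc n) + w) powr (-s)) has_integral
       of_nat (Suc n) powr (-s)) {0..1}" by simp
    have i2: "((\<lambda>w. of_real 1 * of_real (real (Suc n) + w) powr (-s)) has_integral frac_term (\<lambda>_. 1) n s) {0..1}"
      unfolding frac_term_def by (intro integrable_integral integrable_continuous_interval frac_integrand_continuous continuous_intros)
    have i3: "((\<lambda>w. of_real (1 - w) * of_real (real (Suc n) + w) powr (-(s+1))) has_integral frac_term (\<lambda>w. 1 - w) n (s+1)) {0..1}"
      unfolding frac_term_def by (intro integrable_integral integrable_continuous_interval frac_integrand_continuous cQ)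
    have "((\<lambda>w. of_real 1 * of_real (real (Suc n) + w) powr (-s) + s * (of_real (1 - w) * of_real (real (Suc n) + w) powr (-(s+1)))) has_integral
        frac_term (\<lambda>_. 1) n s + s * frac_term (\<lambda>w. 1 - w) n (s+1)) {0..1}"
      by (intro has_integral_add has_integral_mult_right i2 i3)
    moreover have "((\<lambda>w. of_real 1 * of_real (real (Suc n) + w) powr (-s) + s * (of_real (1 - w) * of_real (real (Suc n) + w) powr (-(s+1)))) has_integral
        of_nat (Suc n) powr (-s)) {0..1}"
      by (rule has_integral_eq[OF _ h]) (simp add: algebra_simps minus_diff_commute del: of_real_add)
    ultimately have "frac_term (\<lambda>_. 1) n s + s * frac_term (\<lambda>w. 1 - w) n (s+1) = of_nat (Suc n) powr (-s)"
      by (rule has_integral_unique)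
    then show ?thesis by (simp add: powr_minus field_simps)
  qed
  show ?thesis unfolding tm frac_sum_def using assms
    by (intro sums_add sums_mult summable_sums frac_term_summable cQ) auto
qed

lemma dirichlet_series_reg:
  assumes "Re s > 1"
  shows "(s - 1) * (\<Sum>n. 1 / (of_nat (Suc n)) powr s) = 1 + (s - 1) * (s * frac_sum (\<lambda>w. 1 - w) (s + 1))"
  using sums_unique[OF dirichlet_series_eq_frac_sum[OF assms], symmetric] frac_sum_one[OF assms]
  by (simp add: distrib_left del: of_nat_Suc)

text \<open>The extensions need not be chosen coherently: any two agree on the smaller half-plane by
  the identity theorem, so they glue.\<close>

lemma entire_extension_of_half_planes:
  fixes f :: "complex \<Rightarrow> complex"
  assumes "\<And>j. \<exists>E. E holomorphic_on {s. - real j < Re s} \<and> (\<forall>s. 1 < Re s \<longrightarrow> E s = f s)"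
  shows "\<exists>E. E holomorphic_on UNIV \<and> (\<forall>s. 1 < Re s \<longrightarrow> E s = f s)"
proof -
  obtain E where E: "\<And>j. E j holomorphic_on {s. - real j < Re s}" "\<And>j s. 1 < Re s \<Longrightarrow> E j s = f s"
    using assms by metis
  have agree: "E i s = E j s" if "- real i < Re s" "i \<le> j" for i j s
  proof (rule analytic_continuation_open[of "{s. 1 < Re s}" "{s. - real i < Re s}" "E i" "E j"])
    show "{s. 1 < Re s} \<noteq> {}" by (auto intro!: exI[of _ 2])
    show "E j holomorphic_on {s. - real i < Re s}"
      by (rule holomorphic_on_subset[OF E(1)]) (use that in auto)
  qed (use that E in \<open>auto intro: open_halfspace_Re_gt convex_connected convex_halfspace_Re_gt\<close>)
  define G where "G s = E (nat \<lceil>\<bar>Re s\<bar>\<rceil> + 1) s" for s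
  have GE: "G s = E j s" if "- real j < Re s" for s j
  proof -
    have "- real (nat \<lceil>\<bar>Re s\<bar>\<rceil> + 1) < Re s" by linarith
    then show ?thesis unfolding G_def using agree that by (metis le_cases)
  qed
  have "G holomorphic_on UNIV"
  proof (rule holomorphic_onI)
    fix s :: complex
    define j where "j = nat \<lceil>\<bar>Re s\<bar>\<rceil> + 1"
    have s: "- real j < Re s" unfolding j_def by linarith
    have "G holomorphic_on {s. - real j < Re s}"
      by (rule holomorphic_transform[OF E(1)[of j]]) (use GE in auto)
    then show "G field_differentiable at s within UNIV"
      using s open_halfspace_Re_gt by (metis holomorphic_on_imp_differentiable_at mem_Collect_eq)
  qed
  moreover have "G s = f s" if "1 < Re s" for s using GE[of 0 s] E(2) that by auto
  ultimately show ?thesis by blast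
qed

text \<open>Existence justifies the \<open>SOME\<close> in the definition; every later fact about
  \<open>riemann_zeta\<close> rests on these two properties.\<close>

lemma riemann_zeta_spec:
  "riemann_zeta holomorphic_on (- {1}) \<and>
      (\<forall>s. 1 < Re s \<longrightarrow> riemann_zeta s = (\<Sum>n. 1 / (of_nat (Suc n)) powr s))"
proof -
  have cQ: "continuous_on {0..1} (\<lambda>w::real. 1 - w)" by (intro continuous_intros)
  have "\<exists>E. E holomorphic_on UNIV \<and> (\<forall>s. 1 < Re s \<longrightarrow> E s = (s - 1) * (\<Sum>n. 1 / (of_nat (Suc n)) powr s))"
  proof (rule entire_extension_of_half_planes)
    fix j
    obtain E where E: "E holomorphic_on {s. 1 - real j < Re s}" "\<And>s. 1 < Re s \<Longrightarrow> E s = (s - 1) * frac_sum (\<lambda>w. 1 - w) s"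
      using frac_sum_continuation[OF cQ, of j] by blast
    have "(E \<circ> (\<lambda>s. s + 1)) holomorphic_on {s. - real j < Re s}"
      by (rule holomorphic_on_compose_gen[OF _ E(1)]) (auto intro!: holomorphic_intros)
    then have "(\<lambda>s. 1 + (s - 1) * E (s + 1)) holomorphic_on {s. - real j < Re s}"
      by (intro holomorphic_intros) (simp add: o_def)
    moreover have "1 + (s - 1) * E (s + 1) = (s - 1) * (\<Sum>n. 1 / (of_nat (Suc n)) powr s)" if "1 < Re s" for s
      using that dirichlet_series_reg[OF that] by (simp add: E(2) del: of_nat_Suc)
    ultimately show "\<exists>E. E holomorphic_on {s. - real j < Re s} \<and> (\<forall>s. 1 < Re s \<longrightarrow> E s = (s - 1) * (\<Sum>n. 1 / (of_nat (Suc n)) powr s))"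
      by blast
  qed
  then obtain E where E: "E holomorphic_on UNIV" "\<And>s. 1 < Re s \<Longrightarrow> E s = (s - 1) * (\<Sum>n. 1 / (of_nat (Suc n)) powr s)"
    by blast
  have "(\<lambda>s. E s / (s - 1)) holomorphic_on (- {1})"
    by (intro holomorphic_intros holomorphic_on_subset[OF E(1)]) auto
  moreover have "E s / (s - 1) = (\<Sum>n. 1 / (of_nat (Suc n)) powr s)" if "1 < Re s" for s
    proof -
    have "s - 1 \<noteq> 0" using that by auto
    then show ?thesis unfolding E(2)[OF that] by simp
  qed
  ultimately have "\<exists>f. f holomorphic_on (- {1}) \<and> (\<forall>s. 1 < Re s \<longrightarrow> f s = (\<Sum>n. 1 / (of_nat (Suc n)) powr s))"
    by (intro exI[of _ "\<lambda>s. E s / (s - 1)"]) auto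
  then show ?thesis unfolding riemann_zeta_def by (rule someI_ex)
qed

section \<open>The function (s - 1) zeta(s) to the right of 0\<close>

text \<open>This is (s - 1) zeta(s) with the singularity at 1 filled in. The explicit formula makes
  holomorphy at 1 and polynomial growth evident.\<close>

definition zeta_reg :: "complex \<Rightarrow> complex" where
  "zeta_reg s = 1 + (s - 1) * (s * frac_sum (\<lambda>w. 1 - w) (s + 1))"

lemma zeta_reg_holomorphic: "zeta_reg holomorphic_on {s. 0 < Re s}"
proof -
  have "(frac_sum (\<lambda>w. 1 - w) \<circ> (\<lambda>s. s + 1)) holomorphic_on {s. 0 < Re s}"
    by (rule holomorphic_on_compose_gen[OF _ frac_sum_holomorphic]) (auto intro!: holomorphic_intros continuous_intros)
  then show ?thesis unfolding zeta_reg_def[abs_def]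
    by (intro holomorphic_intros) (auto simp: o_def)
qed

lemma zeta_reg_eq:
  assumes "0 < Re s"
  shows "zeta_reg s = (if s = 1 then 1 else (s - 1) * riemann_zeta s)"
proof (cases "s = 1")
  case False
  have op: "open ({s. 0 < Re s} - {1})" by (intro open_Diff open_halfspace_Re_gt) auto
  have "zeta_reg s = (s - 1) * riemann_zeta s"
  proof (rule analytic_continuation_open[of "{s. 1 < Re s}" "{s. 0 < Re s} - {1}" zeta_reg "\<lambda>s. (s - 1) * riemann_zeta s"])
    show "{s. 1 < Re s} \<noteq> {}" by (auto intro!: exI[of _ 2])
    show "connected ({s. 0 < Re s} - {1})"
      by (rule connected_open_delete)
         (auto intro: open_halfspace_Re_gt convex_connected convex_halfspace_Re_gt)
    show "(\<lambda>s. (s - 1) * riemann_zeta s) holomorphic_on {s. 0 < Re s} - {1}"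
      by (intro holomorphic_intros holomorphic_on_subset[OF conjunct1[OF riemann_zeta_spec]]) auto
    show "zeta_reg z = (z - 1) * riemann_zeta z" if "z \<in> {s. 1 < Re s}" for z
      using that riemann_zeta_spec dirichlet_series_reg[of z] by (simp add: zeta_reg_def del: of_nat_Suc)
  qed (use assms False op in \<open>auto intro: open_halfspace_Re_gt holomorphic_on_subset[OF zeta_reg_holomorphic]\<close>)
  then show ?thesis using False by simp
qed (simp add: zeta_reg_def)

text \<open>For Re s \<ge> 1/2 the integral is taken at s + 1, with real part at least 3/2, where it
  is bounded; only the two polynomial factors grow.\<close>

lemma zeta_reg_growth:
  obtains C where "C > 0" "\<And>s. 1/2 \<le> Re s \<Longrightarrow> norm (zeta_reg s) \<le> C * (1 + norm s) ^ 2"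
proof -
  define A where "A = (\<Sum>n. real (Suc n) powr (- (3/2)))"
  have A: "A \<ge> 0" unfolding A_def by (intro suminf_nonneg summable_Suc_powr) auto
  show ?thesis
  proof (rule that[of "1 + A"])
    fix s :: complex assume s: "1/2 \<le> Re s"
    have "norm (frac_sum (\<lambda>w. 1 - w) (s + 1)) \<le> 1 * A"
      unfolding A_def by (rule frac_sum_bound) (use s in \<open>auto intro!: continuous_intros\<close>)
    then have "norm ((s - 1) * (s * frac_sum (\<lambda>w. 1 - w) (s + 1))) \<le> (1 + norm s) * ((1 + norm s) * A)"
      unfolding norm_mult using norm_triangle_ineq4[of s 1] A
      by (intro mult_mono) auto
    then have "norm (zeta_reg s) \<le> 1 + (1 + norm s) ^ 2 * A"
      unfolding zeta_reg_def by (intro norm_triangle_le) (auto simp: power2_eq_square algebra_simps)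
    also have "\<dots> \<le> (1 + A) * (1 + norm s) ^ 2"
      using power_mono[of 1 "1 + norm s" 2] by (simp add: algebra_simps)
    finally show "norm (zeta_reg s) \<le> (1 + A) * (1 + norm s) ^ 2" .
  qed (use A in auto)
qed

section \<open>Dirichlet series and nonvanishing on the 1-line\<close>

text \<open>The term at \<open>n = 0\<close> vanishes, because \<open>0 powr z = 0\<close>.\<close>

definition dser :: "(nat \<Rightarrow> real) \<Rightarrow> complex \<Rightarrow> complex" where
  "dser a s = (\<Sum>n. of_real (a n) * of_nat n powr (-s))"

lemma norm_nat_powr: "norm (of_nat n powr (-s) :: complex) = real n powr (- Re s)"
  using norm_powr_real_powr[of "of_nat n" "-s"] by simp

lemma dser_summable:
  assumes "\<And>n. \<bar>a n\<bar> \<le> B" and "Re s > 1"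
  shows "summable (\<lambda>n. norm (of_real (a n) * of_nat n powr (-s) :: complex))"
proof (rule summable_comparison_test'[where N=0])
  show "summable (\<lambda>n. B * real n powr (- Re s))"
    using summable_real_powr_iff[of "- Re s"] assms(2) by (intro summable_mult) auto
  show "norm (norm (of_real (a n) * of_nat n powr (-s) :: complex)) \<le> B * real n powr (- Re s)" for n
    using assms(1)[of n] by (simp add: norm_mult norm_nat_powr mult_right_mono)
qed

lemma dser_sums:
  assumes "\<And>n. \<bar>a n\<bar> \<le> B" and "Re s > 1"
  shows "(\<lambda>n. of_real (a n) * of_nat n powr (-s)) sums dser a s"
  unfolding dser_def using summable_norm_cancel[OF dser_summable[OF assms]] by (rule summable_sums)

lemma dser_has_field_derivative:
  assumes B: "\<And>n. \<bar>a n\<bar> \<le> B" and B': "\<And>n. \<bar>a n * ln (real n)\<bar> \<le> B'" and s: "Re s > 1"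
  shows "(dser a has_field_derivative - dser (\<lambda>n. a n * ln (real n)) s) (at s)"
proof -
  let ?f = "\<lambda>n s. of_real (a n) * of_nat n powr (-s) :: complex"
  let ?f' = "\<lambda>n s. - (of_real (a n * ln (real n)) * of_nat n powr (-s)) :: complex"
  have op: "open {s. 1 < Re s}" by (rule open_halfspace_Re_gt)
  have "\<exists>g g'. \<forall>x \<in> {s. 1 < Re s}. ((\<lambda>n. ?f n x) sums g x) \<and> ((\<lambda>n. ?f' n x) sums g' x) \<and> (g has_field_derivative g' x) (at x)"
  proof (rule series_and_derivative_comparison_complex[OF op])
    fix n and x :: complex
    show "(?f n has_field_derivative ?f' n x) (at x)"
    proof (cases "n = 0")
      case False
      then show ?thesis by (auto intro!: derivative_eq_intros simp: powr_def Ln_of_nat)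
    qed simp
  next
    fix x :: complex assume x: "x \<in> {s. 1 < Re s}"
    define b where "b = (1 + Re x) / 2"
    have b: "b > 1" "b < Re x" using x by (auto simp: b_def)
    have B0: "B \<ge> 0" using B[of 0] by linarith
    show "\<exists>d h. 0 < d \<and> summable h \<and> range h \<subseteq> \<real>\<^sub>\<ge>\<^sub>0 \<and> (\<forall>\<^sub>F n in sequentially. \<forall>y\<in>ball x d \<inter> {s. 1 < Re s}. cmod (?f n y) \<le> cmod (h n))"
    proof (intro exI[of _ "Re x - b"] exI[of _ "\<lambda>n. complex_of_real (B * real n powr (-b))"] conjI always_eventually allI ballI)
      show "summable (\<lambda>n. complex_of_real (B * real n powr (-b)))"
        using summable_real_powr_iff[of "-b"] b by (intro summable_of_real summable_mult) auto
      show "range (\<lambda>n. complex_of_real (B * real n powr - b)) \<subseteq> \<real>\<^sub>\<ge>\<^sub>0" using B0 by auto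
      fix n y assume y: "y \<in> ball x (Re x - b) \<inter> {s. 1 < Re s}"
      have yb: "Re y \<ge> b" using y abs_Re_le_cmod[of "x - y"] by (auto simp: dist_norm)
      have "\<bar>a n\<bar> * real n powr (- Re y) \<le> B * real n powr (- b)"
      proof (cases "n = 0")
        case False
        then show ?thesis using B[of n] yb B0 by (intro mult_mono powr_mono) auto
      qed auto
      then show "cmod (?f n y) \<le> cmod (complex_of_real (B * real n powr - b))"
        using B0 by (simp add: norm_mult norm_nat_powr)
    qed (use b in auto)
  qed
  then obtain g g' where g: "\<And>x. Re x > 1 \<Longrightarrow> (\<lambda>n. ?f n x) sums g x" "\<And>x. Re x > 1 \<Longrightarrow> (\<lambda>n. ?f' n x) sums g' x"
      "\<And>x. Re x > 1 \<Longrightarrow> (g has_field_derivative g' x) (at x)" by auto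
  have gd: "g x = dser a x" if "Re x > 1" for x using g(1)[OF that] by (simp add: dser_def sums_iff)
  have "g' s = - dser (\<lambda>n. a n * ln (real n)) s"
    using sums_unique2[OF g(2)[OF s] sums_minus[OF dser_sums[OF B' s]]] .
  then show ?thesis
    using has_field_derivative_transform_within_open[OF g(3)[OF s] op, of "dser a"] s gd by auto
qed

lemma dser_holomorphic:
  assumes B: "\<And>n. \<bar>a n\<bar> \<le> B" and B': "\<And>n. \<bar>a n * ln (real n)\<bar> \<le> B'"
  shows "dser a holomorphic_on {s. 1 < Re s}"
  using dser_has_field_derivative[OF B B'] holomorphic_on_open[OF open_halfspace_Re_gt[of 1]] by blast

text \<open>The coefficients of log zeta: 1/k at the k-th power of a prime and 0 elsewhere,
  including 0 and 1, where the quotient is 0 / 0 = 0.\<close>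

definition vm :: "nat \<Rightarrow> real" where
  "vm n = mangoldt n / ln (real n)"

lemma vm_nonneg: "vm n \<ge> 0"
  by (cases "n = 0") (auto simp: vm_def mangoldt_nonneg)

lemma vm_le_1: "vm n \<le> 1"
proof (cases "n \<le> 1")
  case True
  then have "n = 0 \<or> n = Suc 0" by auto
  then show ?thesis by (auto simp: vm_def)
next
  case False
  then show ?thesis using mangoldt_le[of n] by (simp add: vm_def)
qed

lemma vm_abs_le: "\<bar>vm n\<bar> \<le> 1" using vm_nonneg[of n] vm_le_1[of n] by simp

lemma vm_prime: "prime p \<Longrightarrow> vm p = 1"
  using prime_gt_1_nat[of p] by (simp add: vm_def)

lemma vm_prime_power:
  assumes "prime p" shows "vm (p ^ Suc k) = 1 / real (Suc k)"
proof -
  have "ln (real p) > 0" using prime_gt_1_nat[OF assms] by simp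
  then show ?thesis unfolding vm_def mangoldt_primepow'[OF assms zero_less_Suc]
    by (simp add: ln_realpow prime_gt_0_nat assms del: power_Suc of_nat_Suc)
qed

text \<open>The absolutely convergent series is regrouped by primes: \<open>vm\<close> lives on
  prime powers, pairs (p, k) parametrise these, and summing 1/k times the k-th power of p^(-s) over
  k gives the logarithm of one Euler factor.\<close>

lemma dser_vm_has_sum_primes:
  assumes s: "Re s > 1"
  shows "((\<lambda>p. - Ln (1 - of_nat p powr (-s))) has_sum dser vm s) {p. prime p}"
proof -
  let ?f = "\<lambda>n. of_real (vm n) * of_nat n powr (-s) :: complex"
  have "(?f has_sum dser vm s) UNIV"
    by (rule norm_summable_imp_has_sum[OF dser_summable dser_sums]) (use s vm_abs_le in auto)
  then have "(?f has_sum dser vm s) {n. primepow n}"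
    by (rule has_sum_cong_neutral[THEN iffD1, rotated 3]) (auto simp: vm_def mangoldt_def)
  also have "{n. primepow n} = (\<lambda>(p,k). p ^ Suc k) ` ({p::nat. prime p} \<times> UNIV)"
    using bij_betw_primepows by (auto simp: bij_betw_def)
  finally have "((?f \<circ> (\<lambda>(p,k). p ^ Suc k)) has_sum dser vm s) ({p. prime p} \<times> UNIV)"
    by (subst (asm) has_sum_reindex) (use bij_betw_primepows in \<open>auto simp: bij_betw_def\<close>)
  then show ?thesis
  proof (rule has_sum_SigmaD)
    fix p :: nat assume "p \<in> {p. prime p}"
    then have p: "prime p" by simp
    define z where "z = (of_nat p powr (-s) :: complex)"
    have z: "norm z < 1" using prime_gt_1_nat[OF p] s by (simp add: z_def norm_nat_powr powr_less_one)
    have "(\<lambda>k. - (z ^ k) / of_nat k) sums Ln (1 - z)"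
      using Ln_series'[of "-z"] z by simp
    then have "(\<lambda>k. - (z ^ Suc k) / of_nat (Suc k)) sums Ln (1 - z)"
      by (subst sums_Suc_iff) simp
    then have sm: "(\<lambda>k. z ^ Suc k / of_nat (Suc k)) sums - Ln (1 - z)"
      using sums_minus by fastforce
    have "summable (\<lambda>k. norm (z ^ Suc k / of_nat (Suc k)))"
    proof (rule summable_comparison_test'[where N=0])
      show "summable (\<lambda>k. norm z ^ Suc k)" using z by (simp add: summable_geometric summable_mult)
      show "norm (norm (z ^ Suc k / of_nat (Suc k))) \<le> norm z ^ Suc k" for k
        using mult_left_le[of "1 / real (Suc k)" "norm z ^ Suc k"]
        by (simp add: norm_divide norm_power norm_mult field_simps del: of_nat_Suc power_Suc)
    qed
    then have "((\<lambda>k. z ^ Suc k / of_nat (Suc k)) has_sum - Ln (1 - z)) UNIV"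
      by (rule norm_summable_imp_has_sum[OF _ sm])
    moreover have "(?f \<circ> (\<lambda>(p,k). p ^ Suc k)) (p, k) = z ^ Suc k / of_nat (Suc k)" for k
    proof -
      have "of_nat (p ^ Suc k) powr (-s) = z ^ Suc k"
      proof -
        have p0: "p > 0" using prime_gt_0_nat[OF p] .
        have "ln (real (p ^ Suc k)) = real (Suc k) * ln (real p)"
          by (simp add: ln_realpow p0 del: power_Suc of_nat_Suc)
        then have l: "Ln (of_nat (p ^ Suc k)) = of_nat (Suc k) * Ln (of_nat p)"
          using Ln_of_nat[of "p ^ Suc k"] Ln_of_nat[of p] p0 by (simp del: power_Suc of_nat_Suc of_nat_power)
        have "of_nat (p ^ Suc k) powr (-s) = exp (of_nat (Suc k) * (- s * Ln (of_nat p)))"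
          using p0 unfolding powr_def l by (simp add: mult_ac del: power_Suc of_nat_Suc)
        then show ?thesis using p0 by (simp only: exp_of_nat_mult z_def) (simp add: powr_def)
      qed
      then show ?thesis unfolding o_def split vm_prime_power[OF p] by (simp del: of_nat_Suc power_Suc)
    qed
    ultimately show "((\<lambda>k. (?f \<circ> (\<lambda>(p,k). p ^ Suc k)) (p, k)) has_sum - Ln (1 - of_nat p powr (-s))) UNIV"
      by (simp add: z_def)
  qed
qed

text \<open>Euler's sieve: multiplying by the Euler factor of \<open>p\<close> removes the multiples of \<open>p\<close>.\<close>
lemma dirichlet_sieve:
  fixes s :: complex
  assumes s: "Re s > 1"
  shows "(\<Sum>\<^sub>\<infinity>n\<in>{n. n > 0 \<and> (\<forall>p<N. prime p \<longrightarrow> \<not> p dvd n)}. of_nat n powr (-s)) =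
    (\<Sum>\<^sub>\<infinity>n\<in>{n. n > 0}. of_nat n powr (-s)) * (\<Prod>p<N. if prime p then 1 - of_nat p powr (-s) else 1)"
proof (induction N)
  case (Suc N)
  let ?a = "\<lambda>n. of_nat n powr (-s) :: complex"
  let ?A = "\<lambda>N. {n::nat. n > 0 \<and> (\<forall>p<N. prime p \<longrightarrow> \<not> p dvd n)}"
  have sm: "?a summable_on X" for X
  proof (rule summable_on_subset_banach)
    show "?a summable_on UNIV"
      using dser_summable[of "\<lambda>_. 1" 1 s] s by (intro norm_summable_imp_summable_on) auto
  qed auto
  show ?case
  proof (cases "prime N")
    case False
    then have "?A (Suc N) = ?A N" by (auto simp: less_Suc_eq)
    then show ?thesis using Suc.IH False by simp
  next
    case True
    have N0: "N > 0" using prime_gt_0_nat[OF True] .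
    \<comment> \<open>Multiplying by the prime N introduces no smaller prime divisor, so the
      multiples of N that survived so far are exactly N times the surviving numbers.\<close>
    have img: "(\<lambda>n. N * n) ` ?A N = {n \<in> ?A N. N dvd n}"
    proof (intro equalityI subsetI)
      fix x assume "x \<in> (\<lambda>n. N * n) ` ?A N"
      then show "x \<in> {n \<in> ?A N. N dvd n}"
        using N0 True by (auto simp: prime_dvd_mult_iff dest: primes_dvd_imp_eq)
    next
      fix x assume "x \<in> {n \<in> ?A N. N dvd n}"
      then obtain k where "x = N * k" "x \<in> ?A N" by auto
      then show "x \<in> (\<lambda>n. N * n) ` ?A N" by (auto intro!: image_eqI[of _ _ k])
    qed
    have "infsum ?a (?A N) = infsum ?a (?A (Suc N) \<union> (\<lambda>n. N * n) ` ?A N)"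
      unfolding img using True by (intro arg_cong[of _ _ "infsum ?a"]) (auto simp: less_Suc_eq)
    also have "\<dots> = infsum ?a (?A (Suc N)) + infsum ?a ((\<lambda>n. N * n) ` ?A N)"
      unfolding img using True by (intro infsum_Un_disjoint sm) (auto simp: less_Suc_eq)
    also have "infsum ?a ((\<lambda>n. N * n) ` ?A N) = infsum (?a \<circ> (\<lambda>n. N * n)) (?A N)"
      by (rule infsum_reindex) (use N0 in \<open>auto simp: inj_on_def\<close>)
    also have "\<dots> = infsum (\<lambda>n. of_nat N powr (-s) * ?a n) (?A N)"
    proof (rule infsum_cong)
      fix x assume "x \<in> ?A N"
      then have x: "x > 0" by simp
      have "Ln (of_nat (N * x)) = of_real (ln (real (N * x)))" by (rule Ln_of_nat) (use N0 x in simp)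
      also have "\<dots> = Ln (of_nat N) + Ln (of_nat x)" using N0 x by (simp add: Ln_of_nat ln_mult)
      finally show "(?a \<circ> (\<lambda>n. N * n)) x = of_nat N powr (-s) * ?a x"
        using N0 x by (simp add: powr_def exp_add[symmetric] algebra_simps)
    qed
    also have "\<dots> = of_nat N powr (-s) * infsum ?a (?A N)" by (rule infsum_cmult_right')
    finally have "infsum ?a (?A (Suc N)) = infsum ?a (?A N) * (1 - of_nat N powr (-s))" by (simp add: algebra_simps)
    then show ?thesis using Suc.IH True by simp
  qed
qed simp

lemma zeta_infsum:
  assumes s: "Re s > 1"
  shows "riemann_zeta s = (\<Sum>\<^sub>\<infinity>n\<in>{n. n > 0}. of_nat n powr (-s))"
proof -
  let ?a = "\<lambda>n. of_nat n powr (-s) :: complex"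
  have n: "summable (\<lambda>n. norm (?a n))" using dser_summable[of "\<lambda>_. 1" 1 s] s by auto
  have "(?a has_sum suminf ?a) UNIV"
    by (rule norm_summable_imp_has_sum[OF n summable_sums[OF summable_norm_cancel[OF n]]])
  then have "(?a has_sum suminf ?a) {n. n > 0}"
    by (rule has_sum_cong_neutral[THEN iffD1, rotated 3]) auto
  moreover have "suminf ?a = riemann_zeta s"
    using riemann_zeta_spec s suminf_split_head[OF summable_norm_cancel[OF n]]
    by (simp add: powr_minus field_simps del: of_nat_Suc)
  ultimately show ?thesis by (metis infsumI)
qed

text \<open>An integer n with 1 < n < N has a prime factor below N and is sifted out. What remains
  besides 1 lies in the tail of an absolutely convergent series.\<close>

lemma coprime_sum_tendsto_1:
  fixes s :: complex
  assumes s: "Re s > 1"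
  shows "(\<lambda>N. \<Sum>\<^sub>\<infinity>n\<in>{n. n > 0 \<and> (\<forall>p<N. prime p \<longrightarrow> \<not> p dvd n)}. of_nat n powr (-s) :: complex) \<longlonglongrightarrow> 1"
proof -
  let ?a = "\<lambda>n. of_nat n powr (-s) :: complex"
  let ?A = "\<lambda>N. {n::nat. n > 0 \<and> (\<forall>p<N. prime p \<longrightarrow> \<not> p dvd n)}"
  have n: "summable (\<lambda>n. norm (?a n))" using dser_summable[of "\<lambda>_. 1" 1 s] s by auto
  have sma: "?a summable_on X" for X
    by (rule summable_on_subset_banach[OF norm_summable_imp_summable_on[OF n]]) auto
  have smn: "(\<lambda>n. norm (?a n)) summable_on X" for X
    by (rule summable_on_subset_banach[OF norm_summable_imp_summable_on]) (use n in auto)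
  have tot: "infsum (\<lambda>n. norm (?a n)) UNIV = (\<Sum>n. norm (?a n))"
    by (intro infsumI norm_summable_imp_has_sum summable_sums) (use n in auto)
  have le: "norm (infsum ?a (?A N) - 1) \<le> (\<Sum>n. norm (?a n)) - (\<Sum>n<N. norm (?a n))" if N: "N \<ge> 2" for N
  proof -
    have one: "1 \<in> ?A N" by auto
    have "infsum ?a (?A N) = infsum ?a ({1} \<union> (?A N - {1}))"
      using one by (intro arg_cong[of _ _ "infsum ?a"]) auto
    also have "\<dots> = 1 + infsum ?a (?A N - {1})"
      by (subst infsum_Un_disjoint) (auto intro: sma)
    finally have "norm (infsum ?a (?A N) - 1) = norm (infsum ?a (?A N - {1}))" by simp
    also have "\<dots> \<le> infsum (\<lambda>n. norm (?a n)) (?A N - {1})" by (rule norm_infsum_bound) (rule smn)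
    also have "\<dots> \<le> infsum (\<lambda>n. norm (?a n)) {N..}"
    proof (rule infsum_mono_neutral[OF smn smn])
      fix x assume x: "x \<in> ?A N - {1} - {N..}"
      then obtain p where p: "prime p" "p dvd x" using prime_factor_nat[of x] by auto
      have "p \<le> x" using p x by (intro dvd_imp_le) auto
      then show "norm (?a x) \<le> 0" using x p by auto
    qed auto
    also have "\<dots> = (\<Sum>n. norm (?a n)) - (\<Sum>n<N. norm (?a n))"
    proof -
      have "infsum (\<lambda>n. norm (?a n)) UNIV = infsum (\<lambda>n. norm (?a n)) ({..<N} \<union> {N..})"
        by (intro arg_cong[of _ _ "infsum _"]) auto
      also have "\<dots> = (\<Sum>n<N. norm (?a n)) + infsum (\<lambda>n. norm (?a n)) {N..}"
        by (subst infsum_Un_disjoint) (auto intro: smn)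
      finally show ?thesis using tot by simp
    qed
    finally show ?thesis .
  qed
  have "(\<lambda>N. (\<Sum>n. norm (?a n)) - (\<Sum>n<N. norm (?a n))) \<longlonglongrightarrow> (\<Sum>n. norm (?a n)) - (\<Sum>n. norm (?a n))"
    by (intro tendsto_intros summable_LIMSEQ n)
  then have "(\<lambda>N. (\<Sum>n. norm (?a n)) - (\<Sum>n<N. norm (?a n))) \<longlonglongrightarrow> 0" by simp
  then have "(\<lambda>N. infsum ?a (?A N) - 1) \<longlonglongrightarrow> 0"
    by (rule Lim_null_comparison[rotated]) (use le in \<open>auto simp: eventually_sequentially\<close>)
  then show ?thesis by (simp add: LIM_zero_iff)
qed

text \<open>Zeta times the inverse of the partial Euler product has two limits: by the sieve it
  tends to 1, and by continuity of exp it tends to zeta times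
  \<open>exp (- dser vm s)\<close>.\<close>

lemma zeta_eq_exp_dser:
  assumes s: "Re s > 1"
  shows "riemann_zeta s = exp (dser vm s)"
proof -
  let ?g = "\<lambda>p. if prime p then - Ln (1 - of_nat p powr (-s)) else 0"
  have "(?g has_sum dser vm s) UNIV"
    using dser_vm_has_sum_primes[OF s] by (rule has_sum_cong_neutral[THEN iffD1, rotated 3]) auto
  then have "?g sums dser vm s" by (rule has_sum_imp_sums)
  then have "(\<lambda>N. exp (- (\<Sum>p<N. ?g p))) \<longlonglongrightarrow> exp (- dser vm s)"
    unfolding sums_def by (intro tendsto_intros)
  moreover have "exp (- (\<Sum>p<N. ?g p)) = (\<Prod>p<N. if prime p then 1 - of_nat p powr (-s) else 1)" for N
  proof -
    have nz: "1 - of_nat p powr (-s) \<noteq> 0" if "prime p" for p :: nat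
    proof
      assume "1 - of_nat p powr (-s) = 0"
      then have "norm (of_nat p powr (-s) :: complex) = 1" by simp
      then show False using prime_gt_1_nat[OF that] s by (simp add: norm_nat_powr powr_less_one order_less_imp_not_eq)
    qed
    have "exp (- (\<Sum>p<N. ?g p)) = (\<Prod>p<N. exp (- ?g p))" by (simp add: exp_sum sum_negf[symmetric])
    also have "\<dots> = (\<Prod>p<N. if prime p then 1 - of_nat p powr (-s) else 1)"
    proof (intro prod.cong refl)
      fix p show "exp (- ?g p) = (if prime p then 1 - of_nat p powr (-s) else 1)"
        using exp_Ln[OF nz[of p]] by simp
    qed
    finally show ?thesis .
  qed
  ultimately have "(\<lambda>N. riemann_zeta s * (\<Prod>p<N. if prime p then 1 - of_nat p powr (-s) else 1)) \<longlonglongrightarrow> riemann_zeta s * exp (- dser vm s)"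
    by (intro tendsto_mult_left) auto
  then have "riemann_zeta s * exp (- dser vm s) = 1"
    using coprime_sum_tendsto_1[OF s] unfolding dirichlet_sieve[OF s] zeta_infsum[OF s, symmetric]
    by (rule LIMSEQ_unique)
  then show ?thesis by (simp add: exp_minus field_simps)
qed

lemma Re_dser:
  assumes "\<And>n. \<bar>a n\<bar> \<le> B" and "x > 1"
  shows "(\<lambda>n. a n * real n powr (-x) * cos (t * ln (real n))) sums Re (dser a (Complex x t))"
proof -
  have e: "Re (of_real (a n) * of_nat n powr (- Complex x t)) = a n * real n powr (-x) * cos (t * ln (real n))" for n
    by (cases "n = 0") (auto simp: powr_def Ln_of_nat Re_exp)
  have "(\<lambda>n. Re (of_real (a n) * of_nat n powr (- Complex x t))) sums Re (dser a (Complex x t))"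
    using assms by (intro sums_Re dser_sums[of a B]) auto
  then show ?thesis unfolding e .
qed

section \<open>Nonvanishing on the line Re s = 1\<close>

text \<open>3 + 4 cos x + cos 2x = 2 (1 + cos x)^2 is nonnegative, and so are the coefficients of
  log zeta.\<close>

lemma zeta_341:
  assumes x: "x > 1"
  shows "norm (riemann_zeta (of_real x)) ^ 3 * norm (riemann_zeta (Complex x t)) ^ 4 * norm (riemann_zeta (Complex x (2 * t))) \<ge> 1"
proof -
  have r0: "complex_of_real x = Complex x 0" by (simp add: complex_eq_iff)
  have "(\<lambda>n. 3 * (vm n * real n powr (-x) * cos (0 * ln (real n))) + 4 * (vm n * real n powr (-x) * cos (t * ln (real n))) + vm n * real n powr (-x) * cos ((2 * t) * ln (real n)))
     sums (3 * Re (dser vm (Complex x 0)) + 4 * Re (dser vm (Complex x t)) + Re (dser vm (Complex x (2 * t))))"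
    by (intro sums_add sums_mult Re_dser[OF vm_abs_le x])
  note sm = this
  have "3 * (vm n * real n powr (-x) * cos (0 * ln (real n))) + 4 * (vm n * real n powr (-x) * cos (t * ln (real n))) + vm n * real n powr (-x) * cos ((2 * t) * ln (real n)) \<ge> 0" for n
  proof -
    have e: "cos ((2 * t) * ln (real n)) = 2 * cos (t * ln (real n)) ^ 2 - 1"
      using cos_double_cos[of "t * ln (real n)"] by (simp add: mult.assoc)
    have "3 * (vm n * real n powr (-x) * cos (0 * ln (real n))) + 4 * (vm n * real n powr (-x) * cos (t * ln (real n))) + vm n * real n powr (-x) * cos ((2 * t) * ln (real n))
       = 2 * vm n * real n powr (-x) * (1 + cos (t * ln (real n))) ^ 2"
      unfolding e by (simp add: power2_eq_square algebra_simps)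
    also have "\<dots> \<ge> 0" using vm_nonneg[of n] by simp
    finally show ?thesis .
  qed
  then have "3 * Re (dser vm (Complex x 0)) + 4 * Re (dser vm (Complex x t)) + Re (dser vm (Complex x (2 * t))) \<ge> 0"
    using sums_le[OF _ sums_zero sm] by simp
  then have "exp (3 * Re (dser vm (Complex x 0)) + 4 * Re (dser vm (Complex x t)) + Re (dser vm (Complex x (2 * t)))) \<ge> 1" by simp
  also have "exp (3 * Re (dser vm (Complex x 0)) + 4 * Re (dser vm (Complex x t)) + Re (dser vm (Complex x (2 * t))))
     = norm (riemann_zeta (of_real x)) ^ 3 * norm (riemann_zeta (Complex x t)) ^ 4 * norm (riemann_zeta (Complex x (2 * t)))"
    using x unfolding r0 by (simp add: zeta_eq_exp_dser exp_add exp_of_nat_mult[symmetric])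
  finally show ?thesis .
qed

text \<open>A zero at 1 + it would enter \<open>zeta_341\<close> to the fourth power, the pole at 1
  only to the third, while zeta is finite at 1 + 2it; the product would tend to 0 as the abscissa
  decreases to 1.\<close>

lemma zeta_nonzero_1_line:
  assumes t: "t \<noteq> 0"
  shows "riemann_zeta (Complex 1 t) \<noteq> 0"
proof
  assume z: "riemann_zeta (Complex 1 t) = 0"
  have hol: "riemann_zeta holomorphic_on (- {1})" using riemann_zeta_spec by simp
  have op: "open (- {1::complex})" by auto
  have fd: "riemann_zeta field_differentiable at (Complex 1 u)" if "u \<noteq> 0" for u
    by (rule holomorphic_on_imp_differentiable_at[OF hol op]) (use that in \<open>auto simp: complex_eq_iff\<close>)
  obtain D where D: "(riemann_zeta has_field_derivative D) (at (Complex 1 t))"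
    using fd[OF t] by (auto simp: field_differentiable_def)
  have sh: "((\<lambda>e. Complex (1 + e) u) \<longlongrightarrow> Complex 1 u) (at_right 0)" for u :: real
    by (auto intro!: tendsto_eq_intros simp: tendsto_complex_iff)
  have "((\<lambda>w. (riemann_zeta w - riemann_zeta (Complex 1 t)) / (w - Complex 1 t)) \<longlongrightarrow> D) (at (Complex 1 t))"
    using D by (simp add: has_field_derivative_iff)
  moreover have "filterlim (\<lambda>e. Complex (1 + e) t) (at (Complex 1 t)) (at_right 0)"
    by (rule filterlim_atI[OF sh]) (auto simp: eventually_at_filter complex_eq_iff)
  ultimately have "((\<lambda>e. (riemann_zeta (Complex (1 + e) t) - riemann_zeta (Complex 1 t)) / (Complex (1 + e) t - Complex 1 t)) \<longlongrightarrow> D) (at_right 0)"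
    by (rule filterlim_compose)
  moreover have "Complex (1 + e) t - Complex 1 t = of_real e" for e by (simp add: complex_eq_iff)
  ultimately have L1: "((\<lambda>e. riemann_zeta (Complex (1 + e) t) / of_real e) \<longlongrightarrow> D) (at_right 0)"
    using z by simp
  have L2: "((\<lambda>e. riemann_zeta (Complex (1 + e) (2 * t))) \<longlongrightarrow> riemann_zeta (Complex 1 (2 * t))) (at_right 0)"
    using fd[of "2 * t"] t by (intro isCont_tendsto_compose[OF field_differentiable_imp_continuous_at sh]) auto
  have L3: "((\<lambda>e. zeta_reg (of_real (1 + e))) \<longlongrightarrow> zeta_reg 1) (at_right 0)"
  proof (rule isCont_tendsto_compose[where g = zeta_reg])
    show "isCont zeta_reg 1"
      using zeta_reg_holomorphic by (intro field_differentiable_imp_continuous_at holomorphic_on_imp_differentiable_at[of _ "{s. 0 < Re s}"])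
         (auto intro: open_halfspace_Re_gt)
    show "((\<lambda>e. complex_of_real (1 + e)) \<longlongrightarrow> 1) (at_right 0)" by (auto intro!: tendsto_eq_intros)
  qed
  \<comment> \<open>The powers of e balance: e^3 from \<open>zeta_reg\<close>, e^(-4) from the
    difference quotient and the last factor e leave the product of \<open>zeta_341\<close>
    unchanged, yet the limit contains the factor 0.\<close>
  have "((\<lambda>e. norm (zeta_reg (of_real (1 + e))) ^ 3 * norm (riemann_zeta (Complex (1 + e) t) / of_real e) ^ 4
      * norm (riemann_zeta (Complex (1 + e) (2 * t))) * e) \<longlongrightarrow> norm (zeta_reg 1) ^ 3 * norm D ^ 4 * norm (riemann_zeta (Complex 1 (2 * t))) * 0) (at_right 0)"
    by (intro tendsto_intros L1 L2 L3)
  then have "\<forall>\<^sub>F e in at_right 0. norm (zeta_reg (of_real (1 + e))) ^ 3 * norm (riemann_zeta (Complex (1 + e) t) / of_real e) ^ 4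
      * norm (riemann_zeta (Complex (1 + e) (2 * t))) * e < 1"
    by (rule order_tendstoD) simp
  moreover have "\<forall>\<^sub>F e in at_right 0. norm (zeta_reg (of_real (1 + e))) ^ 3 * norm (riemann_zeta (Complex (1 + e) t) / of_real e) ^ 4
      * norm (riemann_zeta (Complex (1 + e) (2 * t))) * e \<ge> 1"
    unfolding eventually_at_filter
  proof (rule always_eventually, intro allI impI)
    fix e :: real assume e: "e \<noteq> 0" "e \<in> {0<..}"
    have "zeta_reg (of_real (1 + e)) = of_real e * riemann_zeta (of_real (1 + e))"
      using zeta_reg_eq[of "of_real (1 + e)"] e by auto
    then have "norm (zeta_reg (of_real (1 + e))) ^ 3 * norm (riemann_zeta (Complex (1 + e) t) / of_real e) ^ 4
      * norm (riemann_zeta (Complex (1 + e) (2 * t))) * e = norm (riemann_zeta (of_real (1 + e))) ^ 3 * norm (riemann_zeta (Complex (1 + e) t)) ^ 4 * norm (riemann_zeta (Complex (1 + e) (2 * t)))"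
      using e by (simp add: norm_mult norm_divide power_mult_distrib power_divide field_simps eval_nat_numeral)
    then show "norm (zeta_reg (of_real (1 + e))) ^ 3 * norm (riemann_zeta (Complex (1 + e) t) / of_real e) ^ 4
      * norm (riemann_zeta (Complex (1 + e) (2 * t))) * e \<ge> 1"
      using zeta_341[of "1 + e" t] e by (simp only:) simp
  qed
  ultimately have "\<forall>\<^sub>F e in at_right (0::real). False" by eventually_elim simp
  then show False by simp
qed

text \<open>\<open>RH\<close> speaks only of the open critical strip; the line Re s = 1 needs its
  own nonvanishing theorem and the half-plane beyond it the Euler product.\<close>

lemma zeta_reg_nonzero:
  assumes "RH" "Re s > 1/2"
  shows "zeta_reg s \<noteq> 0"
proof (cases "s = 1")
  case False
  consider "Re s > 1" | "Re s = 1" | "Re s < 1" by linarith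
  then have "riemann_zeta s \<noteq> 0"
  proof cases
    case 1 then show ?thesis by (simp add: zeta_eq_exp_dser)
  next
    case 2
    then have "s = Complex 1 (Im s)" "Im s \<noteq> 0" using False by (auto simp: complex_eq_iff)
    then show ?thesis using zeta_nonzero_1_line by metis
  next
    case 3 then show ?thesis using assms unfolding RH_def by force
  qed
  then show ?thesis using zeta_reg_eq[of s] assms False by simp
qed (simp add: zeta_reg_def)

section \<open>A logarithm and its primitive under the Riemann hypothesis\<close>

text \<open>A branch of log (1 - s^(-2)). Written with three principal logarithms it is holomorphic
  for Re s > 1 and in the upper half-plane, where no argument meets the cut.\<close>

definition plog :: "complex \<Rightarrow> complex" where
  "plog s = Ln (s - 1) + Ln (s + 1) - 2 * Ln s"

text \<open>When the three terms z Ln z are differentiated, the constants 1 + 1 - 2 cancel. No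
  constant of integration is added, so that the function decays like 1/s
  (\<open>norm_plog_prim_le\<close>).\<close>

definition plog_prim :: "complex \<Rightarrow> complex" where
  "plog_prim s = (s - 1) * Ln (s - 1) + (s + 1) * Ln (s + 1) - 2 * s * Ln s"

lemma mult_Ln_has_field_derivative:
  fixes s c :: complex
  assumes "s + c \<notin> \<real>\<^sub>\<le>\<^sub>0"
  shows "((\<lambda>s. (s + c) * Ln (s + c)) has_field_derivative Ln (s + c) + 1) (at s)"
proof -
  have "s + c \<noteq> 0" using assms by auto
  then have "inverse (s + c) * s + inverse (s + c) * c = 1" by (simp add: distrib_left[symmetric])
  then show ?thesis using assms
    by (auto intro!: derivative_eq_intros simp: distrib_right)
qed

lemma plog_prim_has_field_derivative:
  assumes "s - 1 \<notin> \<real>\<^sub>\<le>\<^sub>0" "s + 1 \<notin> \<real>\<^sub>\<le>\<^sub>0" "s \<notin> \<real>\<^sub>\<le>\<^sub>0"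
  shows "(plog_prim has_field_derivative plog s) (at s)"
proof -
  have "((\<lambda>s. (s + - 1) * Ln (s + - 1) + (s + 1) * Ln (s + 1) - 2 * ((s + 0) * Ln (s + 0))) has_field_derivative
      (Ln (s + - 1) + 1) + (Ln (s + 1) + 1) - 2 * (Ln (s + 0) + 1)) (at s)"
    by (intro DERIV_diff DERIV_add DERIV_cmult mult_Ln_has_field_derivative) (use assms in auto)
  then show ?thesis by (simp add: plog_prim_def[abs_def] plog_def mult.assoc add_diff_eq)
qed

lemma exp_plog:
  assumes "s \<noteq> 1" "s \<noteq> -1" "s \<noteq> 0"
  shows "exp (plog s) = (s - 1) * (s + 1) / s ^ 2"
proof -
  have "s - 1 \<noteq> 0" "s + 1 \<noteq> 0" using assms by (auto simp: add_eq_0_iff2)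
  then show ?thesis using assms
    by (simp add: plog_def exp_add exp_diff exp_double)
qed

text \<open>With z = 1/s both functions are expanded at infinity: Ln (s \<plusminus> 1) = Ln s + Ln
  (1 \<plusminus> z), the linear terms cancel in \<open>plog\<close>, and \<open>plog_prim\<close>
  equals (s - 1) A + (s + 1) B + 2 z with remainders A, B of order z^2.\<close>

lemma
  assumes s: "Re s \<ge> 2"
  shows norm_plog_le: "norm (plog s) \<le> 4" and norm_plog_prim_le: "norm (plog_prim s) \<le> 8 / norm s"
proof -
  define z where "z = 1 / s"
  have ns: "norm s \<ge> 2" using s complex_Re_le_cmod[of s] by linarith
  then have s0: "s \<noteq> 0" by auto
  have sz: "s * z = 1" using s0 by (simp add: z_def)
  have z: "norm z \<le> 1/2" using frac_le[of 1 1 2 "norm s"] ns by (simp add: z_def norm_divide)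
  have rez: "\<bar>Re z\<bar> \<le> 1/2" using abs_Re_le_cmod[of z] z by linarith
  have ap: "norm (Ln (1 + w) - w) \<le> 2 * norm z ^ 2" if "norm w = norm z" for w
  proof -
    have "norm (Ln (1 + w) - w) \<le> norm w ^ 2 / (1 - norm w)" by (rule Ln_approx_linear) (use that z in simp)
    also have "\<dots> \<le> norm w ^ 2 / (1/2)" using that z by (intro divide_left_mono) auto
    finally show ?thesis using that by simp
  qed
  \<comment> \<open>Both factors have positive real part, so each argument lies within pi/2 of 0 and
    no multiple of 2 pi i appears.\<close>
  have sp: "Ln (s * (1 + w)) = Ln s + Ln (1 + w)" if "norm w = norm z" for w
  proof (rule Ln_times_simple)
    have "\<bar>Re w\<bar> \<le> 1/2" using abs_Re_le_cmod[of w] z that by linarith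
    then have p: "0 < Re (1 + w)" by auto
    then show nz: "1 + w \<noteq> 0" by (metis less_irrefl zero_complex.simps(1))
    have "\<bar>Im (Ln (1 + w))\<bar> < pi/2" using p nz Re_Ln_pos_lt by blast
    moreover have "\<bar>Im (Ln s)\<bar> < pi/2" using s s0 Re_Ln_pos_lt[of s] by auto
    ultimately show "- pi < Im (Ln s) + Im (Ln (1 + w))" "Im (Ln s) + Im (Ln (1 + w)) \<le> pi" by linarith+
  qed (use s0 in auto)
  have L: "Ln (s - 1) = Ln s + Ln (1 + (-z))" "Ln (s + 1) = Ln s + Ln (1 + z)"
    using sp[of "-z"] sp[of z] sz by (simp_all add: distrib_left right_diff_distrib)
  define A where "A = Ln (1 + (-z)) - (-z)"
  define B where "B = Ln (1 + z) - z"
  have AB: "norm A \<le> 2 * norm z ^ 2" "norm B \<le> 2 * norm z ^ 2" using ap[of "-z"] ap[of z] by (auto simp: A_def B_def)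
  have z2: "norm z ^ 2 \<le> norm z * (1/2)" using mult_left_mono[OF z norm_ge_zero[of z]] by (simp add: power2_eq_square)
  have "plog s = A + B" by (simp add: plog_def L A_def B_def)
  then have "norm (plog s) \<le> 2 * norm z ^ 2 + 2 * norm z ^ 2" using AB norm_triangle_ineq[of A B] by simp
  then show "norm (plog s) \<le> 4" using z2 z by linarith
  have "plog_prim s = (s - 1) * A + (s + 1) * B + 2 * z"
    unfolding plog_prim_def L A_def B_def using sz by (simp add: algebra_simps)
  also have "norm \<dots> \<le> norm ((s - 1) * A) + norm ((s + 1) * B) + norm (2 * z)"
    by (meson norm_triangle_ineq norm_triangle_mono order_refl)
  also have "\<dots> \<le> (norm s + 1) * (2 * norm z ^ 2) + (norm s + 1) * (2 * norm z ^ 2) + 2 * norm z"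
    unfolding norm_mult using AB norm_triangle_ineq4[of s 1] norm_triangle_ineq[of s 1]
    by (intro add_mono mult_mono) auto
  also have "\<dots> = (norm s * norm z) * (4 * norm z) + 4 * norm z ^ 2 + 2 * norm z"
    by (simp add: power2_eq_square algebra_simps)
  also have "norm s * norm z = 1" using sz by (metis norm_mult norm_one)
  finally have "norm (plog_prim s) \<le> 8 * norm z" using z2 norm_ge_zero[of z] by linarith
  then show "norm (plog_prim s) \<le> 8 / norm s" by (simp add: z_def norm_divide)
qed

text \<open>Coefficients of the primitive of \<open>dser vm\<close>, up to sign: integrating n^(-s)
  divides it by - log n.\<close>

definition vm2 :: "nat \<Rightarrow> real" where "vm2 n = vm n / ln (real n)"

lemma vm_small: "n < 2 \<Longrightarrow> vm n = 0"
  by (auto simp: vm_def less_2_cases_iff)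

lemma vm2_nonneg: "vm2 n \<ge> 0"
  by (cases "n = 0") (auto simp: vm2_def vm_nonneg)

lemma vm2_mult_ln: "vm2 n * ln (real n) = vm n"
  using vm_small[of n] by (cases "n < 2") (auto simp: vm2_def)

lemma vm2_abs_le: "\<bar>vm2 n\<bar> \<le> 2"
proof (cases "n < 2")
  case False
  have "(1/2::real) \<le> ln 2" using ln_le_minus_one[of "1/2::real"] by (simp add: ln_div)
  also have "ln 2 \<le> ln (real n)" using False by simp
  finally have "vm2 n \<le> 1 / (1/2)" unfolding vm2_def by (intro frac_le) (use vm_le_1 in auto)
  then show ?thesis using vm2_nonneg[of n] by simp
qed (simp add: vm2_def vm_small)

text \<open>The map g \<mapsto> g / (2 A - g) sends the half-plane Re g < A into the unit disc and 0
  to 0; the Schwarz lemma applies to the composition, and solving for g gives the bound.\<close>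

lemma borel_caratheodory:
  fixes f :: "complex \<Rightarrow> complex"
  assumes hol: "f holomorphic_on ball a R" and R: "0 < R" and M: "\<And>z. z \<in> ball a R \<Longrightarrow> Re (f z) < M"
    and z: "norm (z - a) \<le> r" and r: "r < R"
  shows "norm (f z) \<le> norm (f a) + 2 * (M + norm (f a)) * r / (R - r)"
proof -
  define A where "A = M - Re (f a)"
  have A: "A > 0" using M[of a] R by (simp add: A_def)
  have inb: "a + of_real R * w \<in> ball a R" if "norm w < 1" for w
    using that R by (simp add: dist_norm norm_mult)
  define g where "g w = f (a + of_real R * w) - f a" for w
  have Reg: "Re (g w) < A" if "norm w < 1" for w using M[OF inb[OF that]] by (simp add: g_def A_def)
  have ng: "2 * of_real A - g w \<noteq> 0" if "norm w < 1" for w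
  proof
    assume "2 * of_real A - g w = 0"
    then have "Re (g w) = 2 * A" by (metis Re_complex_of_real eq_iff_diff_eq_0 of_real_mult of_real_numeral)
    then show False using Reg[OF that] A by simp
  qed
  define h where "h w = g w / (2 * of_real A - g w)" for w
  have holg: "g holomorphic_on ball 0 1"
  proof -
    have "(f \<circ> (\<lambda>w. a + of_real R * w)) holomorphic_on ball 0 1"
      by (rule holomorphic_on_compose_gen[OF _ hol]) (use inb in \<open>auto intro!: holomorphic_intros\<close>)
    then show ?thesis unfolding g_def[abs_def] by (auto intro!: holomorphic_intros simp: o_def)
  qed
  have holh: "h holomorphic_on ball 0 1"
    unfolding h_def[abs_def] by (intro holomorphic_intros holg) (use ng in auto)
  have h1: "norm (h w) < 1" if "norm w < 1" for w
  proof -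
    have "norm (g w) ^ 2 < norm (2 * of_real A - g w) ^ 2"
    proof -
      have "norm (2 * of_real A - g w) ^ 2 = norm (g w) ^ 2 + 4 * A * (A - Re (g w))"
        unfolding cmod_power2 by (simp add: power2_eq_square algebra_simps)
      then show ?thesis using A Reg[OF that] by simp
    qed
    then have "norm (g w) < norm (2 * of_real A - g w)" by (rule power2_less_imp_less) simp
    then show ?thesis using ng[OF that] by (simp add: h_def norm_divide)
  qed
  have h0: "h 0 = 0" by (simp add: h_def g_def)
  define w where "w = (z - a) / of_real R"
  have w: "norm w \<le> r / R" "norm w < 1" "r / R < 1"
    using z r R by (auto simp: w_def norm_divide field_simps)
  have hw: "norm (h w) \<le> r / R" using Schwarz_Lemma(1)[OF holh h0 h1 w(2)] w(1) by simp
  have "h w * (2 * of_real A - g w) = g w" using ng[OF w(2)] by (simp add: h_def)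
  then have "g w * (1 + h w) = 2 * of_real A * h w" by (simp add: algebra_simps)
  then have "norm (g w) * norm (1 + h w) = 2 * A * norm (h w)"
    using A by (metis norm_mult norm_of_real norm_numeral abs_of_pos)
  moreover have "norm (1 + h w) \<ge> 1 - r / R" using norm_triangle_ineq4[of "1 + h w" "h w"] hw by simp
  ultimately have "norm (g w) * (1 - r / R) \<le> 2 * A * (r / R)"
    using hw A by (smt (verit) mult_left_mono norm_ge_zero)
  then have "norm (g w) \<le> 2 * A * (r / R) / (1 - r / R)" using w(3) by (subst pos_le_divide_eq) auto
  also have "\<dots> = 2 * A * r / (R - r)" using R r by (simp add: field_simps)
  also have "\<dots> \<le> 2 * (M + norm (f a)) * r / (R - r)"
  proof -
    have "r \<ge> 0" using z norm_ge_zero order_trans by blast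
    moreover have "A \<le> M + norm (f a)" using abs_Re_le_cmod[of "f a"] by (simp add: A_def)
    ultimately show ?thesis using r by (intro divide_right_mono mult_right_mono) auto
  qed
  finally have "norm (g w) \<le> 2 * (M + norm (f a)) * r / (R - r)" .
  moreover have "f z = g w + f a" using R by (simp add: g_def w_def)
  ultimately show ?thesis using norm_triangle_ineq[of "g w" "f a"] by simp
qed

text \<open>\<open>Lt\<close> is a logarithm of \<open>\<zeta>(s) (1 - s\<^sup>-\<^sup>2)\<close>: the second factor removes the pole at 1, and tends to 1 fast enough
  for the logarithm to have a primitive \<open>LL\<close> that decays at infinity.\<close>
locale zeta_log =
  fixes Lt LL :: "complex \<Rightarrow> complex"
  assumes Lt_holomorphic: "Lt holomorphic_on {s. 1/2 < Re s}"
    and exp_Lt: "\<And>s. 1/2 < Re s \<Longrightarrow> exp (Lt s) = zeta_reg s * (s + 1) / s ^ 2"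
    and LL_deriv: "\<And>s. 1/2 < Re s \<Longrightarrow> (LL has_field_derivative Lt s) (at s)"
    and Lt_eq: "\<And>s. 1 < Re s \<Longrightarrow> Lt s = dser vm s + plog s"
    and LL_eq: "\<And>s. 1 < Re s \<Longrightarrow> LL s = - dser vm2 s + plog_prim s"

text \<open>Nonvanishing on a half-plane gives some logarithm and some primitive of it. Each is
  determined up to a constant, and the two constants are fixed by comparison with the explicit
  series on Re s > 1.\<close>

lemma RH_imp_zeta_log:
  assumes "RH"
  obtains Lt LL where "zeta_log Lt LL"
proof -
  let ?H = "{s. 1/2 < Re s}" and ?H1 = "{s. 1 < Re s}"
  have cH: "convex ?H" "open ?H" and cH1: "convex ?H1" "open ?H1"
    using convex_halfspace_Re_gt open_halfspace_Re_gt by blast+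
  let ?Z = "\<lambda>s. zeta_reg s * (s + 1) / s ^ 2"
  have Zh: "?Z holomorphic_on ?H"
    by (intro holomorphic_intros holomorphic_on_subset[OF zeta_reg_holomorphic]) auto
  have Znz: "?Z s \<noteq> 0" if "s \<in> ?H" for s
  proof -
    have "0 < Re (s + 1)" "0 < Re s" using that by auto
    then have "s + 1 \<noteq> 0" "s \<noteq> 0" by (metis less_irrefl zero_complex.simps(1))+
    then show ?thesis using that zeta_reg_nonzero[OF assms, of s] by simp
  qed
  obtain L0 where L0: "L0 holomorphic_on ?H" "\<And>s. s \<in> ?H \<Longrightarrow> ?Z s = exp (L0 s)"
    using contractible_imp_holomorphic_log[OF Zh convex_imp_contractible[OF cH(1)] Znz] by blast
  have np: "s - 1 \<notin> \<real>\<^sub>\<le>\<^sub>0" "s + 1 \<notin> \<real>\<^sub>\<le>\<^sub>0" "s \<notin> \<real>\<^sub>\<le>\<^sub>0" if "Re s > 1" for s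
    using that by (auto simp: complex_nonpos_Reals_iff)
  have dserv: "dser vm holomorphic_on ?H1"
  proof -
    have "((\<lambda>s. - dser vm2 s) has_field_derivative dser vm s) (at s)" if "Re s > 1" for s
      using DERIV_minus[OF dser_has_field_derivative[of vm2 2 1 s]] that
      by (simp add: vm2_abs_le vm2_mult_ln vm_abs_le)
    note dd = DERIV_imp_deriv[OF this]
    have "(\<lambda>s. - dser vm2 s) holomorphic_on ?H1"
      by (intro holomorphic_on_minus dser_holomorphic[of vm2 2 1]) (simp_all add: vm2_abs_le vm2_mult_ln vm_abs_le)
    then have "deriv (\<lambda>s. - dser vm2 s) holomorphic_on ?H1" by (rule holomorphic_deriv[OF _ cH1(2)])
    then show ?thesis by (rule holomorphic_transform) (use dd in auto)
  qed
  have plogh: "plog holomorphic_on ?H1"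
    unfolding plog_def[abs_def] by (intro holomorphic_intros) (use np in auto)
  \<comment> \<open>\<open>exp (d s) = 1\<close> forces the derivative of d to vanish, so d is a
    constant c. Since \<open>exp c = 1\<close>, subtracting c from \<open>L0\<close> leaves a
    logarithm of the same function.\<close>
  define d where "d s = L0 s - (dser vm s + plog s)" for s
  have dh: "d holomorphic_on ?H1" unfolding d_def[abs_def]
    by (intro holomorphic_intros dserv plogh holomorphic_on_subset[OF L0(1)]) auto
  have ed: "exp (d s) = 1" if "s \<in> ?H1" for s
  proof -
    have s: "s \<noteq> 1" "s \<noteq> -1" "s \<noteq> 0" "s \<in> ?H" "0 < Re s" using that by auto
    have "exp (dser vm s + plog s) = riemann_zeta s * ((s - 1) * (s + 1) / s ^ 2)"
      using that s by (simp add: exp_add zeta_eq_exp_dser exp_plog)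
    also have "\<dots> = exp (L0 s)" using L0(2)[OF s(4)] zeta_reg_eq[OF s(5)] s by (simp add: mult_ac)
    finally show ?thesis by (simp add: d_def exp_diff)
  qed
  have "\<exists>c. \<forall>x\<in>?H1. d x = c"
  proof (rule has_field_derivative_zero_constant[OF cH1(1)])
    fix x assume x: "x \<in> ?H1"
    obtain D where D: "(d has_field_derivative D) (at x)"
      using dh cH1(2) x by (metis field_differentiable_def holomorphic_on_imp_differentiable_at)
    have "((\<lambda>s. exp (d s)) has_field_derivative exp (d x) * D) (at x)"
      using DERIV_fun_exp[OF D] .
    moreover have "((\<lambda>s. exp (d s)) has_field_derivative 0) (at x)"
      by (rule has_field_derivative_transform_within_open[of "\<lambda>_. 1", OF _ cH1(2) x]) (use ed in auto)
    ultimately have "exp (d x) * D = 0" by (rule DERIV_unique)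
    then show "(d has_field_derivative 0) (at x within ?H1)" using D by (auto intro: has_field_derivative_at_within)
  qed
  then obtain c where c: "\<And>s. s \<in> ?H1 \<Longrightarrow> d s = c" by blast
  have ec: "exp c = 1" using c[of 2] ed[of 2] by simp
  define Lt where "Lt s = L0 s - c" for s
  have Lth: "Lt holomorphic_on ?H" unfolding Lt_def[abs_def] by (intro holomorphic_intros L0(1))
  have Lte: "Lt s = dser vm s + plog s" if "1 < Re s" for s using c[of s] that by (auto simp: Lt_def d_def algebra_simps)
  obtain L1 where L1: "\<And>s. s \<in> ?H \<Longrightarrow> (L1 has_field_derivative Lt s) (at s within ?H)"
    using holomorphic_convex_primitive'[OF cH Lth] by blast
  have L1': "(L1 has_field_derivative Lt s) (at s)" if "1/2 < Re s" for s
    using L1[of s] that cH(2) at_within_open[of s ?H] by simp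
  have "\<exists>c. \<forall>s\<in>?H1. L1 s - (- dser vm2 s + plog_prim s) = c"
  proof (rule has_field_derivative_zero_constant[OF cH1(1)])
    fix s assume s: "s \<in> ?H1"
    have "((\<lambda>s. L1 s - (- dser vm2 s + plog_prim s)) has_field_derivative Lt s - (- (- dser (\<lambda>n. vm2 n * ln (real n)) s) + plog s)) (at s)"
      by (intro DERIV_diff DERIV_add DERIV_minus L1' plog_prim_has_field_derivative np dser_has_field_derivative[of vm2 2 1])
         (use s in \<open>auto simp: vm2_abs_le vm2_mult_ln vm_abs_le\<close>)
    then show "((\<lambda>s. L1 s - (- dser vm2 s + plog_prim s)) has_field_derivative 0) (at s within ?H1)"
      using Lte[of s] s by (auto simp: vm2_mult_ln intro: has_field_derivative_at_within)
  qed
  then obtain k where k: "\<And>s. s \<in> ?H1 \<Longrightarrow> L1 s - (- dser vm2 s + plog_prim s) = k" by blast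
  have "zeta_log Lt (\<lambda>s. L1 s - k)"
  proof
    show "Lt holomorphic_on ?H" by (rule Lth)
    fix s
    show "exp (Lt s) = zeta_reg s * (s + 1) / s ^ 2" if "1/2 < Re s"
      using L0(2)[of s] that ec by (simp add: Lt_def exp_diff)
    show "((\<lambda>s. L1 s - k) has_field_derivative Lt s) (at s)" if "1/2 < Re s"
      using DERIV_diff[OF L1'[OF that] DERIV_const[of k]] by simp
    show "Lt s = dser vm s + plog s" if "1 < Re s" by (rule Lte[OF that])
    show "L1 s - k = - dser vm2 s + plog_prim s" if "1 < Re s" using k[of s] that by (simp add: algebra_simps)
  qed
  then show ?thesis by (rule that)
qed

lemma horizontal_derivative:
  assumes "(f has_field_derivative f') (at (Complex x y))"
  shows "((\<lambda>x. f (Complex x y)) has_vector_derivative f') (at x)"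
proof -
  have "((\<lambda>x. of_real x + \<i> * of_real y) has_vector_derivative 1) (at x)"
    by (auto intro!: derivative_eq_intros)
  then have "((\<lambda>x. Complex x y) has_vector_derivative 1) (at x)" by (simp add: Complex_eq)
  from field_vector_diff_chain_at[OF this assms] show ?thesis by (simp add: o_def)
qed

lemma vertical_derivative:
  assumes "(f has_field_derivative f') (at (Complex x y))"
  shows "((\<lambda>y. f (Complex x y)) has_vector_derivative \<i> * f') (at y)"
proof -
  have "((\<lambda>y. of_real x + \<i> * of_real y) has_vector_derivative \<i>) (at y)"
    by (auto intro!: derivative_eq_intros)
  then have "((\<lambda>y. Complex x y) has_vector_derivative \<i>) (at y)" by (simp add: Complex_eq)
  from field_vector_diff_chain_at[OF this assms] show ?thesis by (simp add: o_def)
qed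

lemma Re_has_real_derivative:
  assumes "(f has_vector_derivative f') (at x within A)"
  shows "((\<lambda>x. Re (f x)) has_real_derivative Re f') (at x within A)"
  using bounded_linear.has_vector_derivative[OF bounded_linear_Re assms]
  by (simp add: has_real_derivative_iff_has_vector_derivative)

lemma norm_dser_le:
  assumes "\<And>n. \<bar>a n\<bar> \<le> B" and "Re s \<ge> 2"
  shows "norm (dser a s) \<le> B * (\<Sum>n. real n powr (-2))"
proof -
  have B: "B \<ge> 0" using assms(1)[of 0] by linarith
  have sm: "summable (\<lambda>n. B * real n powr (-2))"
    using summable_real_powr_iff[of "-2"] by (intro summable_mult) auto
  have le: "norm (of_real (a n) * of_nat n powr (-s) :: complex) \<le> B * real n powr (-2)" for n
  proof (cases "n = 0")
    case False
    then show ?thesis using assms B by (auto simp: norm_mult norm_nat_powr intro!: mult_mono powr_mono)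
  qed simp
  have sn: "summable (\<lambda>n. norm (of_real (a n) * of_nat n powr (-s) :: complex))"
    by (rule dser_summable[OF assms(1)]) (use assms(2) in auto)
  have "norm (dser a s) \<le> (\<Sum>n. B * real n powr (-2))"
    unfolding dser_def by (rule order_trans[OF summable_norm[OF sn] suminf_le[OF le sn sm]])
  then show ?thesis using suminf_mult[of "\<lambda>n. real n powr (-2)" B] summable_real_powr_iff[of "-2"] by simp
qed

section \<open>Growth of the logarithm and of its primitive\<close>

context zeta_log
begin

lemma Lt_LL_bounded_right:
  obtains K where "K > 0" "\<And>s. Re s \<ge> 2 \<Longrightarrow> norm (Lt s) \<le> K" "\<And>s. Re s \<ge> 2 \<Longrightarrow> norm (LL s) \<le> K"
proof
  define A where "A = (\<Sum>n. real n powr (-2))"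
  have A: "A \<ge> 0" unfolding A_def using summable_real_powr_iff[of "-2"] by (intro suminf_nonneg) auto
  show "2 * A + 4 > 0" using A by simp
  fix s :: complex assume s: "Re s \<ge> 2"
  show "norm (Lt s) \<le> 2 * A + 4"
    using norm_triangle_ineq[of "dser vm s" "plog s"] norm_dser_le[of vm 1 s] norm_plog_le[OF s] vm_abs_le s A
    by (simp add: Lt_eq A_def[symmetric])
  have "norm s \<ge> 2" using s complex_Re_le_cmod[of s] by linarith
  then have "8 / norm s \<le> 4" using frac_le[of 8 8 2 "norm s"] by simp
  then show "norm (LL s) \<le> 2 * A + 4"
    using norm_triangle_ineq[of "- dser vm2 s" "plog_prim s"] norm_dser_le[of vm2 2 s] norm_plog_prim_le[OF s] vm2_abs_le s
    by (simp add: LL_eq A_def[symmetric])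
qed

text \<open>The real part of a logarithm is the logarithm of a modulus, so polynomial growth of
  \<open>zeta_reg\<close> bounds it from above, uniformly up to the critical line since zeros only
  lower it. A linear bound instead of a logarithmic one is enough; Re s \<le> 4 leaves room for
  discs centred on Re s = 2.\<close>

lemma Re_Lt_upper:
  obtains K where "K > 0" "\<And>s. 1/2 < Re s \<Longrightarrow> Re s \<le> 4 \<Longrightarrow> Re (Lt s) < K * (1 + \<bar>Im s\<bar>)"
proof -
  obtain C where C: "C > 0" "\<And>s. 1/2 \<le> Re s \<Longrightarrow> norm (zeta_reg s) \<le> C * (1 + norm s) ^ 2"
    using zeta_reg_growth by blast
  define K where "K = \<bar>ln (4 * C)\<bar> + 15"
  show ?thesis
  proof (rule that[of K])
    show "K > 0" by (simp add: K_def)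
    fix s assume s: "1/2 < Re s" "Re s \<le> 4"
    have ns: "norm s > 1/2" using s complex_Re_le_cmod[of s] by linarith
    have "exp (Re (Lt s)) = norm (zeta_reg s) * norm (s + 1) / norm s ^ 2"
      using exp_Lt[OF s(1)] by (metis norm_divide norm_exp_eq_Re norm_mult norm_power)
    also have "\<dots> \<le> (C * (1 + norm s) ^ 2) * (1 + norm s) / (1/2) ^ 2"
      using C(2)[of s] s ns norm_triangle_ineq[of s 1] C(1)
      by (intro frac_le mult_mono power_mono) auto
    also have "\<dots> = 4 * C * (1 + norm s) ^ 3" by (simp add: eval_nat_numeral)
    finally have "Re (Lt s) \<le> ln (4 * C * (1 + norm s) ^ 3)"
      using C(1) ns by (subst ln_ge_iff) (auto intro!: mult_pos_pos zero_less_power)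
    also have "\<dots> = ln (4 * C) + 3 * ln (1 + norm s)" using C(1) ns by (subst ln_mult) (auto simp: ln_realpow)
    also have "\<dots> \<le> ln (4 * C) + 3 * norm s" using ln_add_one_self_le_self[of "norm s"] by simp
    also have "\<dots> \<le> \<bar>ln (4 * C)\<bar> + 3 * (4 + \<bar>Im s\<bar>)" using cmod_le[of s] s by simp
    also have "\<dots> < K * (1 + \<bar>Im s\<bar>)" by (simp add: K_def algebra_simps add_pos_nonneg)
    finally show "Re (Lt s) < K * (1 + \<bar>Im s\<bar>)" .
  qed
qed

text \<open>Borel-Caratheodory on discs about 2 + it of radius below 3/2 turns the upper bound for
  the real part into a bound for the modulus of \<open>Lt\<close>, and horizontal integration passes
  it on to \<open>LL\<close>. C may degenerate as \<sigma> tends to 1/2; it serves only for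
  integrability and for moving the line of integration and never enters a final estimate.\<close>

lemma Lt_LL_growth:
  assumes \<sigma>: "1/2 < \<sigma>"
  obtains C where "C > 0" "\<And>s. \<sigma> \<le> Re s \<Longrightarrow> Re s \<le> 2 \<Longrightarrow> norm (LL s) \<le> C * (1 + \<bar>Im s\<bar>)"
proof (cases "\<sigma> < 2")
  case True
  obtain K where K: "K > 0" "\<And>s. 1/2 < Re s \<Longrightarrow> Re s \<le> 4 \<Longrightarrow> Re (Lt s) < K * (1 + \<bar>Im s\<bar>)"
    using Re_Lt_upper by blast
  obtain B where B: "B > 0" "\<And>s. Re s \<ge> 2 \<Longrightarrow> norm (Lt s) \<le> B" "\<And>s. Re s \<ge> 2 \<Longrightarrow> norm (LL s) \<le> B"
    using Lt_LL_bounded_right by blast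
  define r where "r = 2 - \<sigma>"
  \<comment> \<open>The outer radius reaches half way from \<sigma> to 1/2, so the disc contains all
    points needed and still stays to the right of the critical line.\<close>
  define R where "R = 2 - (1/2 + \<sigma>) / 2"
  have R: "0 < R" "r < R" "R < 3/2" "r > 0" using \<sigma> True by (auto simp: R_def r_def)
  define D where "D = B + 2 * (3 * K + B) * r / (R - r)"
  have D0: "D \<ge> B" unfolding D_def using K B R by simp
  have Lt: "norm (Lt s) \<le> D * (1 + \<bar>Im s\<bar>)" if s: "\<sigma> \<le> Re s" "Re s \<le> 2" for s
  proof -
    define a where "a = Complex 2 (Im s)"
    define M where "M = K * (3 + \<bar>Im s\<bar>)"
    have "norm (Lt s) \<le> norm (Lt a) + 2 * (M + norm (Lt a)) * r / (R - r)"
    proof (rule borel_caratheodory[of Lt a R])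
      have sub: "1/2 < Re z" "Re z \<le> 4" "\<bar>Im z\<bar> \<le> \<bar>Im s\<bar> + 2" if "z \<in> ball a R" for z
        using that abs_Re_le_cmod[of "a - z"] abs_Im_le_cmod[of "a - z"] R by (auto simp: a_def dist_norm)
      show "Lt holomorphic_on ball a R" by (rule holomorphic_on_subset[OF Lt_holomorphic]) (use sub in auto)
      show "Re (Lt z) < M" if "z \<in> ball a R" for z
      proof -
        have "Re (Lt z) < K * (1 + \<bar>Im z\<bar>)" using K(2) sub[OF that] by blast
        also have "\<dots> \<le> M" unfolding M_def using K sub[OF that] by (intro mult_left_mono) auto
        finally show ?thesis .
      qed
      have "s - a = of_real (Re s - 2)" by (simp add: a_def complex_eq_iff)
      then have "norm (s - a) = \<bar>Re s - 2\<bar>" by (metis norm_of_real)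
      then show "norm (s - a) \<le> r" using s by (simp add: r_def)
    qed (use R in auto)
    also have "\<dots> \<le> B + 2 * (M + B) * r / (R - r)"
      using B(2)[of a] R by (intro add_mono divide_right_mono mult_right_mono) (auto simp: a_def)
    also have "\<dots> \<le> B * (1 + \<bar>Im s\<bar>) + (2 * (3 * K + B) * r / (R - r)) * (1 + \<bar>Im s\<bar>)"
    proof (intro add_mono)
      have "M + B \<le> (3 * K + B) * (1 + \<bar>Im s\<bar>)" using K(1) B(1) by (simp add: M_def algebra_simps)
      then have "2 * (M + B) * r / (R - r) \<le> 2 * ((3 * K + B) * (1 + \<bar>Im s\<bar>)) * r / (R - r)"
        using R by (intro divide_right_mono mult_right_mono) auto
      then show "2 * (M + B) * r / (R - r) \<le> (2 * (3 * K + B) * r / (R - r)) * (1 + \<bar>Im s\<bar>)"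
        by (simp only: times_divide_eq_left times_divide_eq_right mult_ac)
    qed (use B in simp)
    finally show ?thesis by (simp add: D_def algebra_simps)
  qed
  show ?thesis
  proof (rule that[of "B + 2 * D"])
    show "B + 2 * D > 0" using B D0 by simp
    fix s assume s: "\<sigma> \<le> Re s" "Re s \<le> 2"
    define a where "a = Complex 2 (Im s)"
    let ?V = "{z. \<sigma> \<le> Re z \<and> Re z \<le> 2 \<and> Im z = Im s}"
    have cv: "convex ?V"
    proof -
      have "?V = {z. \<sigma> \<le> Re z} \<inter> {z. Re z \<le> 2} \<inter> ({z. Im s \<le> Im z} \<inter> {z. Im z \<le> Im s})" by auto
      then show ?thesis
        by (simp add: convex_Int convex_halfspace_Re_ge convex_halfspace_Re_le convex_halfspace_Im_ge convex_halfspace_Im_le)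
    qed
    have "norm (LL s - LL a) \<le> D * (1 + \<bar>Im s\<bar>) * norm (s - a)"
    proof (rule field_differentiable_bound[OF cv])
      fix z assume z: "z \<in> ?V"
      show "(LL has_field_derivative Lt z) (at z within ?V)"
        using LL_deriv[of z] z \<sigma> by (auto intro: has_field_derivative_at_within)
      show "norm (Lt z) \<le> D * (1 + \<bar>Im s\<bar>)" using Lt[of z] z by simp
    qed (use s True in \<open>auto simp: a_def\<close>)
    also have "\<dots> \<le> D * (1 + \<bar>Im s\<bar>) * 2"
    proof (rule mult_left_mono)
      have "s - a = of_real (Re s - 2)" by (simp add: a_def complex_eq_iff)
      then have "norm (s - a) = \<bar>Re s - 2\<bar>" by (metis norm_of_real)
      then show "norm (s - a) \<le> 2" using s \<sigma> by simp
    qed (use D0 B in simp)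
    finally have "norm (LL s) \<le> B + D * (1 + \<bar>Im s\<bar>) * 2"
      using B(3)[of a] norm_triangle_ineq[of "LL s - LL a" "LL a"] by (simp add: a_def)
    also have "\<dots> \<le> (B + 2 * D) * (1 + \<bar>Im s\<bar>)" using B by (simp add: algebra_simps)
    finally show "norm (LL s) \<le> (B + 2 * D) * (1 + \<bar>Im s\<bar>)" .
  qed
next
  case False
  obtain B where B: "B > 0" "\<And>s. Re s \<ge> 2 \<Longrightarrow> norm (Lt s) \<le> B" "\<And>s. Re s \<ge> 2 \<Longrightarrow> norm (LL s) \<le> B"
    using Lt_LL_bounded_right by blast
  show ?thesis
  proof (rule that[OF B(1)])
    fix s assume "\<sigma> \<le> Re s" "Re s \<le> 2"
    then have "norm (LL s) \<le> B" using B(3)[of s] False by simp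
    also have "\<dots> \<le> B * (1 + \<bar>Im s\<bar>)" using B(1) by simp
    finally show "norm (LL s) \<le> B * (1 + \<bar>Im s\<bar>)" .
  qed
qed

text \<open>Unlike \<open>Lt_LL_growth\<close> this is uniform in Re s: the upper bound for the real
  part of \<open>Lt\<close> is integrated leftwards from 2. It supplies the a priori bound near the
  critical line in the final estimates.\<close>

lemma minus_Re_LL_upper:
  obtains K where "K > 0" "\<And>s. 1/2 < Re s \<Longrightarrow> Re s \<le> 2 \<Longrightarrow> - Re (LL s) \<le> K * (1 + \<bar>Im s\<bar>)"
proof -
  obtain K where K: "K > 0" "\<And>s. 1/2 < Re s \<Longrightarrow> Re s \<le> 4 \<Longrightarrow> Re (Lt s) < K * (1 + \<bar>Im s\<bar>)"
    using Re_Lt_upper by blast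
  obtain B where B: "B > 0" "\<And>s. Re s \<ge> 2 \<Longrightarrow> norm (Lt s) \<le> B" "\<And>s. Re s \<ge> 2 \<Longrightarrow> norm (LL s) \<le> B"
    using Lt_LL_bounded_right by blast
  show ?thesis
  proof (rule that[of "B + 2 * K"])
    fix s assume s: "1/2 < Re s" "Re s \<le> 2"
    let ?\<phi> = "\<lambda>x. Re (LL (Complex x (Im s))) - K * (1 + \<bar>Im s\<bar>) * x"
    have "?\<phi> 2 \<le> ?\<phi> (Re s)"
    proof (rule DERIV_nonpos_imp_nonincreasing[OF s(2)])
      fix x assume x: "Re s \<le> x" "x \<le> 2"
      have "((\<lambda>x. Re (LL (Complex x (Im s)))) has_real_derivative Re (Lt (Complex x (Im s)))) (at x)"
        by (intro Re_has_real_derivative horizontal_derivative LL_deriv) (use s x in simp)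
      then have "(?\<phi> has_real_derivative Re (Lt (Complex x (Im s))) - K * (1 + \<bar>Im s\<bar>)) (at x)"
        using DERIV_diff[OF _ DERIV_cmult[OF DERIV_ident, of "K * (1 + \<bar>Im s\<bar>)"]] by fastforce
      moreover have "Re (Lt (Complex x (Im s))) - K * (1 + \<bar>Im s\<bar>) \<le> 0" using K(2)[of "Complex x (Im s)"] s x by simp
      ultimately show "\<exists>y. (?\<phi> has_real_derivative y) (at x) \<and> y \<le> 0" by blast
    qed
    then have "- Re (LL s) \<le> - Re (LL (Complex 2 (Im s))) + K * (1 + \<bar>Im s\<bar>) * (2 - Re s)"
      by (simp add: algebra_simps)
    also have "\<dots> \<le> B + K * (1 + \<bar>Im s\<bar>) * 2"
      using B(3)[of "Complex 2 (Im s)"] abs_Re_le_cmod[of "LL (Complex 2 (Im s))"] K(1) s by (intro add_mono mult_left_mono) auto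
    also have "\<dots> \<le> (B + 2 * K) * (1 + \<bar>Im s\<bar>)" using B by (simp add: algebra_simps)
    finally show "- Re (LL s) \<le> (B + 2 * K) * (1 + \<bar>Im s\<bar>)" .
  qed (use K B in simp)
qed

end

section \<open>Gaussian convolution of the primitive\<close>

lemma gaussian_fourier:
  assumes "\<delta> > 0"
  shows "(\<integral>u. exp (\<i> * of_real (a * u)) * of_real (normal_density 0 \<delta> u) \<partial>lborel) = of_real (exp (- (\<delta> * a)\<^sup>2 / 2))"
proof -
  have "(\<integral>u. exp (\<i> * of_real (a * u)) * of_real (normal_density 0 \<delta> u) \<partial>lborel)
      = \<bar>\<delta>\<bar> *\<^sub>R (\<integral>u. exp (\<i> * of_real (a * (0 + \<delta> * u))) * of_real (normal_density 0 \<delta> (0 + \<delta> * u)) \<partial>lborel)"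
    by (rule lborel_integral_real_affine) (use assms in simp)
  also have "\<dots> = (\<integral>u. \<bar>\<delta>\<bar> *\<^sub>R (exp (\<i> * of_real (a * (0 + \<delta> * u))) * of_real (normal_density 0 \<delta> (0 + \<delta> * u))) \<partial>lborel)"
    by simp
  also have "\<dots> = (\<integral>u. std_normal_density u *\<^sub>R exp (\<i> * of_real ((\<delta> * a) * u)) \<partial>lborel)"
  proof (rule Bochner_Integration.integral_cong[OF refl])
    fix u :: real
    have e: "\<bar>\<delta>\<bar> * normal_density 0 \<delta> (0 + \<delta> * u) = std_normal_density u"
      using assms by (simp add: normal_density_def real_sqrt_mult power_mult_distrib field_simps)
    have "\<bar>\<delta>\<bar> *\<^sub>R (exp (\<i> * of_real (a * (0 + \<delta> * u))) * of_real (normal_density 0 \<delta> (0 + \<delta> * u)))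
        = (\<bar>\<delta>\<bar> * normal_density 0 \<delta> (0 + \<delta> * u)) *\<^sub>R exp (\<i> * of_real (a * (0 + \<delta> * u)))"
      by (simp add: scaleR_conv_of_real mult_ac)
    also have "\<dots> = std_normal_density u *\<^sub>R exp (\<i> * of_real ((\<delta> * a) * u))"
      unfolding e by (simp add: mult_ac)
    finally show "\<bar>\<delta>\<bar> *\<^sub>R (exp (\<i> * of_real (a * (0 + \<delta> * u))) * of_real (normal_density 0 \<delta> (0 + \<delta> * u)))
        = std_normal_density u *\<^sub>R exp (\<i> * of_real ((\<delta> * a) * u))" .
  qed
  also have "\<dots> = char std_normal_distribution (\<delta> * a)"
    unfolding char_def by (subst integral_density) (auto simp: normal_density_nonneg)
  also have "\<dots> = of_real (exp (- (\<delta> * a)\<^sup>2 / 2))" by (simp add: char_std_normal_distribution)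
  finally show ?thesis .
qed

lemma normal_density_integrable_abs:
  assumes "\<delta> > 0"
  shows "integrable lborel (\<lambda>u. normal_density 0 \<delta> u * \<bar>u\<bar>)"
    and "(\<integral>u. normal_density 0 \<delta> u * \<bar>u\<bar> \<partial>lborel) \<le> \<delta>"
proof -
  show "integrable lborel (\<lambda>u. normal_density 0 \<delta> u * \<bar>u\<bar>)"
    using integrable_normal_moment_abs[OF assms, of 0 1] by simp
  have "(\<integral>u. normal_density 0 \<delta> u * \<bar>u\<bar> \<partial>lborel) = \<delta> * sqrt (2 / pi)"
    using integral_normal_moment_abs_odd[OF assms, of 0 0] by simp
  also have "\<dots> \<le> \<delta> * 1" using assms pi_gt3 by (intro mult_left_mono) auto
  finally show "(\<integral>u. normal_density 0 \<delta> u * \<bar>u\<bar> \<partial>lborel) \<le> \<delta>" by simp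
qed

lemma vertical_derivative_shift:
  assumes "(f has_field_derivative f') (at (Complex x (t + u)))"
  shows "((\<lambda>u. f (Complex x (t + u))) has_vector_derivative \<i> * f') (at u)"
proof -
  have "((\<lambda>u. of_real x + \<i> * of_real (t + u)) has_vector_derivative \<i>) (at u)"
    by (auto intro!: derivative_eq_intros)
  then have "((\<lambda>u. Complex x (t + u)) has_vector_derivative \<i>) (at u)" by (simp add: Complex_eq)
  from field_vector_diff_chain_at[OF this assms] show ?thesis by (simp add: o_def)
qed

lemma integral_symmetric_limit:
  fixes g :: "real \<Rightarrow> complex"
  assumes "integrable lborel g"
  shows "(\<lambda>n. \<integral>u. indicator {- real n..real n} u *\<^sub>R g u \<partial>lborel) \<longlonglongrightarrow> (\<integral>u. g u \<partial>lborel)"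
proof (rule integral_dominated_convergence[where w = "\<lambda>u. norm (g u)"])
  have [measurable]: "g \<in> borel_measurable borel" using borel_measurable_integrable[OF assms] by simp
  show "g \<in> borel_measurable lborel" by simp
  show "(\<lambda>u. indicator {- real n..real n} u *\<^sub>R g u) \<in> borel_measurable lborel" for n by measurable
  show "integrable lborel (\<lambda>u. norm (g u))" using assms by simp
  show "AE u in lborel. (\<lambda>n. indicator {- real n..real n} u *\<^sub>R g u) \<longlonglongrightarrow> g u"
  proof (rule AE_I2)
    fix u :: real
    have "eventually (\<lambda>n. indicator {- real n..real n} u *\<^sub>R g u = g u) sequentially"
      using eventually_ge_at_top[of "nat \<lceil>\<bar>u\<bar>\<rceil>"]
    proof eventually_elim
      case (elim n)
      then have "\<bar>u\<bar> \<le> real n" by linarith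
      then show ?case by (auto simp: indicator_def)
    qed
    then show "(\<lambda>n. indicator {- real n..real n} u *\<^sub>R g u) \<longlonglongrightarrow> g u" by (rule tendsto_eventually)
  qed
  show "AE u in lborel. norm (indicator {- real n..real n} u *\<^sub>R g u) \<le> norm (g u)" for n
    by (auto simp: indicator_def)
qed

section \<open>Moving the line of integration against a Gaussian\<close>

text \<open>The normal density continued analytically to u - i a, because -(u - i a)^2 = (a + i
  u)^2. Its modulus exceeds the density by \<open>exp (a\<^sup>2 / (2 * \<delta>\<^sup>2))\<close>,
  which is the cost of a shift by a.\<close>

definition gshift :: "real \<Rightarrow> real \<Rightarrow> real \<Rightarrow> complex" where
  "gshift \<delta> a u = of_real (normal_density 0 \<delta> u) * exp (of_real (a\<^sup>2 / (2 * \<delta>\<^sup>2)) + \<i> * of_real (u * a / \<delta>\<^sup>2))"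

lemma gshift_0: "gshift \<delta> 0 u = of_real (normal_density 0 \<delta> u)"
  by (simp add: gshift_def)

lemma norm_gshift: "norm (gshift \<delta> a u) = normal_density 0 \<delta> u * exp (a\<^sup>2 / (2 * \<delta>\<^sup>2))"
  by (simp add: gshift_def norm_mult norm_exp_eq_Re)

lemma gshift_eq:
  assumes "\<delta> > 0"
  shows "gshift \<delta> a u = exp ((of_real a + \<i> * of_real u)\<^sup>2 / (2 * of_real \<delta> ^ 2)) / of_real (sqrt (2 * pi * \<delta>\<^sup>2))"
proof -
  have "(of_real a + \<i> * of_real u)\<^sup>2 = of_real (a\<^sup>2) + of_real (- (u\<^sup>2)) + \<i> * of_real (2 * (u * a))"
    by (simp add: power2_eq_square algebra_simps)
  then have "(of_real a + \<i> * of_real u)\<^sup>2 / (2 * of_real \<delta> ^ 2) = of_real (a\<^sup>2 / (2 * \<delta>\<^sup>2)) + of_real (- (u\<^sup>2) / (2 * \<delta>\<^sup>2)) + \<i> * of_real (u * a / \<delta>\<^sup>2)"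
    using assms by (simp add: add_divide_distrib diff_divide_distrib)
  then show ?thesis by (simp only: exp_add) (simp add: gshift_def normal_density_def exp_add exp_of_real[symmetric])
qed

text \<open>Cauchy's theorem on the rectangle between the abscissas \<sigma> and \<tau>, for f times
  the entire Gaussian \<open>k\<close> centred at \<open>Complex \<sigma> t\<close>. It is carried
  out with a primitive \<open>H\<close> of the product: truncated vertical integrals are differences
  of \<open>H\<close>, and the horizontal sides vanish because the Gaussian beats the linear growth
  of f.\<close>

lemma gauss_shift:
  fixes f :: "complex \<Rightarrow> complex"
  assumes hol: "f holomorphic_on {s. a0 < Re s}" and a0: "a0 < \<sigma>" and \<tau>: "\<sigma> \<le> \<tau>" and \<delta>: "\<delta> > 0"
    and bd: "\<And>x y. \<sigma> \<le> x \<Longrightarrow> x \<le> \<tau> \<Longrightarrow> norm (f (Complex x y)) \<le> C * (1 + \<bar>y\<bar>)"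
  shows "x \<in> {\<sigma>..\<tau>} \<Longrightarrow> integrable lborel (\<lambda>u. f (Complex x (t + u)) * gshift \<delta> (x - \<sigma>) u)"
    and "(\<integral>u. f (Complex \<sigma> (t + u)) * gshift \<delta> 0 u \<partial>lborel) = (\<integral>u. f (Complex \<tau> (t + u)) * gshift \<delta> (\<tau> - \<sigma>) u \<partial>lborel)"
proof -
  let ?U = "{s. a0 < Re s}"
  define k where "k s = exp ((s - Complex \<sigma> t)\<^sup>2 / (2 * of_real \<delta> ^ 2)) / of_real (sqrt (2 * pi * \<delta>\<^sup>2))" for s :: complex
  define h where "h s = f s * k s" for s
  have kg: "k (Complex x (t + u)) = gshift \<delta> (x - \<sigma>) u" for x u
  proof -
    have "Complex x (t + u) - Complex \<sigma> t = of_real (x - \<sigma>) + \<i> * of_real u" by (simp add: complex_eq_iff)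
    then show ?thesis using \<delta> by (simp add: k_def gshift_eq)
  qed
  have hh: "h holomorphic_on ?U" unfolding h_def[abs_def] k_def[abs_def]
    by (intro holomorphic_intros hol) (use \<delta> in auto)
  have C0: "C \<ge> 0" using order_trans[OF norm_ge_zero bd[of \<sigma> 0]] \<tau> by simp
  define B where "B = C * exp ((\<tau> - \<sigma>)\<^sup>2 / (2 * \<delta>\<^sup>2))"
  have B0: "B \<ge> 0" using C0 by (simp add: B_def)
  have hb: "norm (h (Complex x (t + u))) \<le> B * ((1 + \<bar>t\<bar> + \<bar>u\<bar>) * normal_density 0 \<delta> u)" if "x \<in> {\<sigma>..\<tau>}" for x u
  proof -
    have "norm (f (Complex x (t + u))) \<le> C * (1 + \<bar>t\<bar> + \<bar>u\<bar>)"
      using bd[of x "t + u"] that C0 by (auto intro!: order_trans[OF _ mult_left_mono[of "1 + \<bar>t + u\<bar>" _ C]])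
    moreover have "exp ((x - \<sigma>)\<^sup>2 / (2 * \<delta>\<^sup>2)) \<le> exp ((\<tau> - \<sigma>)\<^sup>2 / (2 * \<delta>\<^sup>2))"
      using that \<delta> by (auto intro!: divide_right_mono power_mono)
    ultimately have "norm (f (Complex x (t + u))) * (normal_density 0 \<delta> u * exp ((x - \<sigma>)\<^sup>2 / (2 * \<delta>\<^sup>2)))
       \<le> (C * (1 + \<bar>t\<bar> + \<bar>u\<bar>)) * (normal_density 0 \<delta> u * exp ((\<tau> - \<sigma>)\<^sup>2 / (2 * \<delta>\<^sup>2)))"
      using C0 by (intro mult_mono mult_left_mono) auto
    then show ?thesis by (simp add: h_def kg norm_mult norm_gshift B_def mult_ac)
  qed
  have cont: "continuous_on UNIV (\<lambda>u. h (Complex x (t + u)))" if "x \<in> {\<sigma>..\<tau>}" for x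
    by (rule continuous_on_compose2[OF holomorphic_on_imp_continuous_on[OF hh]])
       (use that a0 in \<open>auto intro!: continuous_intros simp: Complex_eq\<close>)
  have int: "integrable lborel (\<lambda>u. h (Complex x (t + u)))" if x: "x \<in> {\<sigma>..\<tau>}" for x
  proof (rule Bochner_Integration.integrable_bound)
    show "integrable lborel (\<lambda>u. B * ((1 + \<bar>t\<bar>) * normal_density 0 \<delta> u + normal_density 0 \<delta> u * \<bar>u\<bar>))"
      using \<delta> normal_density_integrable_abs(1)[OF \<delta>] by (intro integrable_mult_right Bochner_Integration.integrable_add) auto
    show "(\<lambda>u. h (Complex x (t + u))) \<in> borel_measurable lborel"
      using borel_measurable_continuous_onI[OF cont[OF x]] by simp
    show "AE u in lborel. norm (h (Complex x (t + u))) \<le> norm (B * ((1 + \<bar>t\<bar>) * normal_density 0 \<delta> u + normal_density 0 \<delta> u * \<bar>u\<bar>))"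
    proof (rule AE_I2)
      fix u
      have "norm (h (Complex x (t + u))) \<le> B * ((1 + \<bar>t\<bar>) * normal_density 0 \<delta> u + normal_density 0 \<delta> u * \<bar>u\<bar>)"
        using hb[OF x, of u] by (simp add: algebra_simps)
      then show "norm (h (Complex x (t + u))) \<le> norm (B * ((1 + \<bar>t\<bar>) * normal_density 0 \<delta> u + normal_density 0 \<delta> u * \<bar>u\<bar>))"
        by simp
    qed
  qed
  then show "x \<in> {\<sigma>..\<tau>} \<Longrightarrow> integrable lborel (\<lambda>u. f (Complex x (t + u)) * gshift \<delta> (x - \<sigma>) u)"
    by (simp add: h_def kg)
  obtain H where H: "\<And>s. s \<in> ?U \<Longrightarrow> (H has_field_derivative h s) (at s within ?U)"
    using holomorphic_convex_primitive'[OF convex_halfspace_Re_gt open_halfspace_Re_gt hh] by blast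
  have H': "(H has_field_derivative h s) (at s)" if "a0 < Re s" for s
    using H[of s] that open_halfspace_Re_gt at_within_open[of s ?U] by simp
  define I where "I x n = (\<integral>u. indicator {- real n..real n} u *\<^sub>R h (Complex x (t + u)) \<partial>lborel)" for x and n :: nat
  have I: "I x n = - \<i> * H (Complex x (t + real n)) - (- \<i> * H (Complex x (t + - real n)))" if x: "x \<in> {\<sigma>..\<tau>}" for x n
    unfolding I_def
  proof (rule integral_FTC_atLeastAtMost)
    fix u
    have "((\<lambda>u. - \<i> * H (Complex x (t + u))) has_vector_derivative - \<i> * (\<i> * h (Complex x (t + u)))) (at u)"
      by (intro has_vector_derivative_mult_right vertical_derivative_shift H') (use x a0 in auto)
    then show "((\<lambda>u. - \<i> * H (Complex x (t + u))) has_vector_derivative h (Complex x (t + u))) (at u within {- real n..real n})"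
      by (simp add: has_vector_derivative_at_within mult.assoc[symmetric])
  qed (use continuous_on_subset[OF cont[OF x]] in auto)
  \<comment> \<open>A horizontal side of the rectangle, estimated by the mean value inequality for
    \<open>H\<close>.\<close>
  have Hd: "norm (H (Complex \<tau> (t + u)) - H (Complex \<sigma> (t + u))) \<le> B * ((1 + \<bar>t\<bar> + \<bar>u\<bar>) * normal_density 0 \<delta> u) * (\<tau> - \<sigma>)" for u
  proof -
    let ?V = "{z. \<sigma> \<le> Re z \<and> Re z \<le> \<tau> \<and> Im z = t + u}"
    have cv: "convex ?V"
    proof -
      have "?V = {z. \<sigma> \<le> Re z} \<inter> {z. Re z \<le> \<tau>} \<inter> ({z. t + u \<le> Im z} \<inter> {z. Im z \<le> t + u})" by auto
      then show ?thesis
        by (simp add: convex_Int convex_halfspace_Re_ge convex_halfspace_Re_le convex_halfspace_Im_ge convex_halfspace_Im_le)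
    qed
    have "norm (H (Complex \<tau> (t + u)) - H (Complex \<sigma> (t + u))) \<le> B * ((1 + \<bar>t\<bar> + \<bar>u\<bar>) * normal_density 0 \<delta> u) * norm (Complex \<tau> (t + u) - Complex \<sigma> (t + u))"
    proof (rule field_differentiable_bound[OF cv])
      fix z assume z: "z \<in> ?V"
      show "(H has_field_derivative h z) (at z within ?V)"
        using H'[of z] z a0 by (auto intro: has_field_derivative_at_within)
      have "z = Complex (Re z) (t + u)" using z by (simp add: complex_eq_iff)
      then show "norm (h z) \<le> B * ((1 + \<bar>t\<bar> + \<bar>u\<bar>) * normal_density 0 \<delta> u)" using hb[of "Re z" u] z by auto
    qed (use \<tau> in auto)
    moreover have "norm (Complex \<tau> (t + u) - Complex \<sigma> (t + u)) = \<tau> - \<sigma>"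
    proof -
      have "Complex \<tau> (t + u) - Complex \<sigma> (t + u) = of_real (\<tau> - \<sigma>)" by (simp add: complex_eq_iff)
      then show ?thesis using \<tau> by (simp only: norm_of_real)
    qed
    ultimately show ?thesis by simp
  qed
  have lim0: "(\<lambda>n. I \<tau> n - I \<sigma> n) \<longlonglongrightarrow> 0"
  proof (rule Lim_null_comparison)
    show "\<forall>\<^sub>F n in sequentially. norm (I \<tau> n - I \<sigma> n) \<le> 2 * (B * ((1 + \<bar>t\<bar> + real n) * normal_density 0 \<delta> (real n)) * (\<tau> - \<sigma>))"
    proof (rule always_eventually, rule allI)
      fix n
      have "I \<tau> n - I \<sigma> n = - \<i> * (H (Complex \<tau> (t + real n)) - H (Complex \<sigma> (t + real n)))
          + \<i> * (H (Complex \<tau> (t + - real n)) - H (Complex \<sigma> (t + - real n)))"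
        using \<tau> by (subst (1 2) I) (auto simp: algebra_simps)
      also have "norm \<dots> \<le> norm (H (Complex \<tau> (t + real n)) - H (Complex \<sigma> (t + real n))) + norm (H (Complex \<tau> (t + - real n)) - H (Complex \<sigma> (t + - real n)))"
        by (rule order_trans[OF norm_triangle_ineq]) (simp add: norm_mult)
      also have "\<dots> \<le> 2 * (B * ((1 + \<bar>t\<bar> + real n) * normal_density 0 \<delta> (real n)) * (\<tau> - \<sigma>))"
      proof -
        have "normal_density 0 \<delta> (- real n) = normal_density 0 \<delta> (real n)" by (simp add: normal_density_def)
        then show ?thesis using Hd[of "real n"] Hd[of "- real n"] by simp
      qed
      finally show "norm (I \<tau> n - I \<sigma> n) \<le> 2 * (B * ((1 + \<bar>t\<bar> + real n) * normal_density 0 \<delta> (real n)) * (\<tau> - \<sigma>))" .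
    qed
    define c where "c = 1 / (2 * \<delta>\<^sup>2)"
    have c: "c > 0" using \<delta> by (simp add: c_def)
    have "(\<lambda>n. (1 + \<bar>t\<bar> + real n) * exp (- c * (real n)\<^sup>2)) \<longlonglongrightarrow> 0"
      using c by real_asymp
    then have "(\<lambda>n. (2 * B * (\<tau> - \<sigma>) * (1 / sqrt (2 * pi * \<delta>\<^sup>2))) * ((1 + \<bar>t\<bar> + real n) * exp (- c * (real n)\<^sup>2))) \<longlonglongrightarrow> (2 * B * (\<tau> - \<sigma>) * (1 / sqrt (2 * pi * \<delta>\<^sup>2))) * 0"
      by (rule tendsto_mult_left)
    moreover have nd: "normal_density 0 \<delta> (real n) = (1 / sqrt (2 * pi * \<delta>\<^sup>2)) * exp (- c * (real n)\<^sup>2)" for n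
      by (simp add: normal_density_def c_def)
    ultimately show "(\<lambda>n. 2 * (B * ((1 + \<bar>t\<bar> + real n) * normal_density 0 \<delta> (real n)) * (\<tau> - \<sigma>))) \<longlonglongrightarrow> 0"
      unfolding nd by (simp only: mult_ac mult_zero_left mult_zero_right)
  qed
  have "I \<tau> \<longlonglongrightarrow> (\<integral>u. h (Complex \<tau> (t + u)) \<partial>lborel)" "I \<sigma> \<longlonglongrightarrow> (\<integral>u. h (Complex \<sigma> (t + u)) \<partial>lborel)"
    unfolding I_def[abs_def] by (intro integral_symmetric_limit int; use \<tau> in auto)+
  then have "(\<lambda>n. I \<tau> n - I \<sigma> n) \<longlonglongrightarrow> (\<integral>u. h (Complex \<tau> (t + u)) \<partial>lborel) - (\<integral>u. h (Complex \<sigma> (t + u)) \<partial>lborel)"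
    by (rule tendsto_diff)
  with lim0 have "(\<integral>u. h (Complex \<tau> (t + u)) \<partial>lborel) - (\<integral>u. h (Complex \<sigma> (t + u)) \<partial>lborel) = 0"
    using LIMSEQ_unique by blast
  then show "(\<integral>u. f (Complex \<sigma> (t + u)) * gshift \<delta> 0 u \<partial>lborel) = (\<integral>u. f (Complex \<tau> (t + u)) * gshift \<delta> (\<tau> - \<sigma>) u \<partial>lborel)"
    by (simp add: h_def kg)
qed

text \<open>Each n^(-s) is entire and bounded to the right of \<sigma>, so a single term can be
  moved back from 2 to \<sigma> although the whole series need not converge there. On the line
  \<sigma> the Fourier transform of the Gaussian appears as the cutoff.\<close>

lemma gauss_shift_dirichlet_term:
  assumes n: "n > 0" and \<sigma>: "\<sigma> \<le> 2" and \<delta>: "\<delta> > 0"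
  shows "(\<integral>u. of_nat n powr (- Complex 2 (t + u)) * gshift \<delta> (2 - \<sigma>) u \<partial>lborel)
      = of_nat n powr (- Complex \<sigma> t) * of_real (exp (- (\<delta> * ln (real n))\<^sup>2 / 2))"
    and "integrable lborel (\<lambda>u. of_nat n powr (- Complex 2 (t + u)) * gshift \<delta> (2 - \<sigma>) u)"
proof -
  let ?f = "\<lambda>s. of_nat n powr (- s) :: complex"
  have hol: "?f holomorphic_on {s. \<sigma> - 1 < Re s}" using n by (intro holomorphic_intros) auto
  have bd: "norm (?f (Complex x y)) \<le> real n powr (- \<sigma>) * (1 + \<bar>y\<bar>)" if "\<sigma> \<le> x" for x y
  proof -
    have "norm (?f (Complex x y)) = real n powr (- x)" by (simp add: norm_nat_powr)
    also have "\<dots> \<le> real n powr (- \<sigma>) * 1" using that n by (simp add: powr_mono)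
    also have "\<dots> \<le> real n powr (- \<sigma>) * (1 + \<bar>y\<bar>)" by (intro mult_left_mono) auto
    finally show ?thesis .
  qed
  note gs = gauss_shift[OF hol _ \<sigma> \<delta> bd]
  show "integrable lborel (\<lambda>u. of_nat n powr (- Complex 2 (t + u)) * gshift \<delta> (2 - \<sigma>) u)"
    by (rule gs(1)) (use \<sigma> in auto)
  have "(\<integral>u. ?f (Complex 2 (t + u)) * gshift \<delta> (2 - \<sigma>) u \<partial>lborel) = (\<integral>u. ?f (Complex \<sigma> (t + u)) * gshift \<delta> 0 u \<partial>lborel)"
    by (rule gs(2)[symmetric]) auto
  also have "\<dots> = (\<integral>u. of_nat n powr (- Complex \<sigma> t) * (exp (\<i> * of_real (- ln (real n) * u)) * of_real (normal_density 0 \<delta> u)) \<partial>lborel)"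
  proof (rule Bochner_Integration.integral_cong[OF refl])
    fix u
    have "?f (Complex \<sigma> (t + u)) = of_nat n powr (- Complex \<sigma> t) * exp (\<i> * of_real (- ln (real n) * u))"
      using n by (simp add: powr_def Ln_of_nat Complex_eq exp_add[symmetric] algebra_simps)
    then show "?f (Complex \<sigma> (t + u)) * gshift \<delta> 0 u = of_nat n powr (- Complex \<sigma> t) * (exp (\<i> * of_real (- ln (real n) * u)) * of_real (normal_density 0 \<delta> u))"
      by (simp add: gshift_0 mult.assoc)
  qed
  also have "\<dots> = of_nat n powr (- Complex \<sigma> t) * of_real (exp (- (\<delta> * ln (real n))\<^sup>2 / 2))"
    using gaussian_fourier[OF \<delta>, of "- ln (real n)"] by simp
  finally show "(\<integral>u. of_nat n powr (- Complex 2 (t + u)) * gshift \<delta> (2 - \<sigma>) u \<partial>lborel)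
      = of_nat n powr (- Complex \<sigma> t) * of_real (exp (- (\<delta> * ln (real n))\<^sup>2 / 2))" .
qed

section \<open>The explicit formula for the Gaussian mean\<close>

definition gcoef :: "real \<Rightarrow> real \<Rightarrow> nat \<Rightarrow> real" where
  "gcoef \<sigma> \<delta> n = vm2 n * real n powr (- \<sigma>) * exp (- (\<delta> * ln (real n))\<^sup>2 / 2)"

lemma gcoef_nonneg: "gcoef \<sigma> \<delta> n \<ge> 0"
  by (simp add: gcoef_def vm2_nonneg)

text \<open>The cutoff outweighs the weak decay n^(-1/2): completing the square trades it for n^(-2)
  at the price \<open>exp (9 / (8 * \<delta>\<^sup>2))\<close>, where 9/8 is (2 - 1/2)^2 /
  2.\<close>

lemma gcoef_le:
  assumes \<sigma>: "\<sigma> \<ge> 1/2" and \<delta>: "\<delta> > 0"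
  shows "gcoef \<sigma> \<delta> n \<le> 2 * exp (9 / (8 * \<delta>\<^sup>2)) * real n powr (-2)"
proof (cases "n = 0")
  case False
  define x where "x = ln (real n)"
  have x: "x \<ge> 0" using False by (simp add: x_def)
  have "0 \<le> (\<delta> * x - 3 / (2 * \<delta>))\<^sup>2" by simp
  also have "\<dots> = (\<delta> * x)\<^sup>2 - 3 * x + 9 / (4 * \<delta>\<^sup>2)" using \<delta> by (simp add: power2_eq_square field_simps)
  finally have q: "- (\<sigma> * x) - (\<delta> * x)\<^sup>2 / 2 \<le> 9 / (8 * \<delta>\<^sup>2) - 2 * x"
    using mult_right_mono[OF \<sigma> x] by simp
  have "real n powr (- \<sigma>) * exp (- (\<delta> * x)\<^sup>2 / 2) = exp (- (\<sigma> * x) - (\<delta> * x)\<^sup>2 / 2)"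
    using False by (simp add: powr_def x_def mult_exp_exp)
  also have "\<dots> \<le> exp (9 / (8 * \<delta>\<^sup>2) - 2 * x)" using q by simp
  also have "\<dots> = exp (9 / (8 * \<delta>\<^sup>2)) * real n powr (-2)"
    using False by (simp add: powr_def x_def mult_exp_exp)
  finally have u1: "real n powr (- \<sigma>) * exp (- (\<delta> * x)\<^sup>2 / 2) \<le> exp (9 / (8 * \<delta>\<^sup>2)) * real n powr (-2)" .
  have u2: "vm2 n \<le> 2" using vm2_abs_le[of n] by simp
  have "vm2 n * (real n powr (- \<sigma>) * exp (- (\<delta> * x)\<^sup>2 / 2)) \<le> 2 * (exp (9 / (8 * \<delta>\<^sup>2)) * real n powr (-2))"
    by (rule mult_mono[OF u2 u1]) auto
  then show ?thesis by (simp add: gcoef_def x_def mult_ac)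
qed (simp add: gcoef_def)

lemma gcoef_summable:
  assumes "\<sigma> \<ge> 1/2" and "\<delta> > 0"
  shows "summable (gcoef \<sigma> \<delta>)"
  by (rule summable_comparison_test'[where N=0, OF summable_mult[of "\<lambda>n. real n powr (-2)" "2 * exp (9 / (8 * \<delta>\<^sup>2))"]])
     (use gcoef_le[OF assms] gcoef_nonneg summable_real_powr_iff[of "-2"] in auto)

lemma gcoef_suminf_le:
  assumes "\<sigma> \<ge> 1/2" and "\<delta> > 0"
  shows "suminf (gcoef \<sigma> \<delta>) \<le> 2 * (\<Sum>n. real n powr (-2)) * exp (9 / (8 * \<delta>\<^sup>2))"
proof -
  have sm: "summable (\<lambda>n. real n powr (-2))" using summable_real_powr_iff[of "-2"] by auto
  have "suminf (gcoef \<sigma> \<delta>) \<le> (\<Sum>n. 2 * exp (9 / (8 * \<delta>\<^sup>2)) * real n powr (-2))"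
    by (intro suminf_le gcoef_le gcoef_summable assms summable_mult sm)
  also have "\<dots> = 2 * exp (9 / (8 * \<delta>\<^sup>2)) * (\<Sum>n. real n powr (-2))" by (rule suminf_mult[OF sm])
  finally show ?thesis by (simp add: mult_ac)
qed

context zeta_log
begin

lemma LL_holomorphic: "LL holomorphic_on {s. 1/2 < Re s}"
  using LL_deriv holomorphic_on_open[OF open_halfspace_Re_gt[of "1/2"]] by blast

lemma LL_conv_integrable:
  assumes \<sigma>: "1/2 < \<sigma>" "\<sigma> \<le> 2" and \<delta>: "\<delta> > 0"
  shows "integrable lborel (\<lambda>u. LL (Complex \<sigma> (t + u)) * of_real (normal_density 0 \<delta> u))"
proof -
  obtain C where C: "C > 0" "\<And>s. \<sigma> \<le> Re s \<Longrightarrow> Re s \<le> 2 \<Longrightarrow> norm (LL s) \<le> C * (1 + \<bar>Im s\<bar>)"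
    using Lt_LL_growth[OF \<sigma>(1)] by blast
  have CC: "norm (LL (Complex x y)) \<le> C * (1 + \<bar>y\<bar>)" if "\<sigma> \<le> x" "x \<le> 2" for x y
    using C(2)[of "Complex x y"] that by simp
  have "integrable lborel (\<lambda>u. LL (Complex \<sigma> (t + u)) * gshift \<delta> (\<sigma> - \<sigma>) u)"
    by (rule gauss_shift(1)[OF LL_holomorphic \<sigma> \<delta> CC]) (use \<sigma> in auto)
  then show ?thesis by (simp add: gshift_0)
qed

lemma LL_conv_formula:
  assumes \<sigma>: "1/2 < \<sigma>" "\<sigma> \<le> 2" and \<delta>: "0 < \<delta>" "\<delta> \<le> 1"
  shows "\<bar>(\<integral>u. - Re (LL (Complex \<sigma> (t + u))) * normal_density 0 \<delta> u \<partial>lborel) - (\<Sum>n. gcoef \<sigma> \<delta> n * cos (t * ln (real n)))\<bar>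
      \<le> 32 * exp (9 / (8 * \<delta>\<^sup>2)) / (1 + \<bar>t\<bar>)"
proof -
  obtain C where C: "C > 0" "\<And>s. \<sigma> \<le> Re s \<Longrightarrow> Re s \<le> 2 \<Longrightarrow> norm (LL s) \<le> C * (1 + \<bar>Im s\<bar>)"
    using Lt_LL_growth[OF \<sigma>(1)] by blast
  have CC: "norm (LL (Complex x y)) \<le> C * (1 + \<bar>y\<bar>)" if "\<sigma> \<le> x" "x \<le> 2" for x y
    using C(2)[of "Complex x y"] that by simp
  define e where "e = exp ((2 - \<sigma>)\<^sup>2 / (2 * \<delta>\<^sup>2))"
  \<comment> \<open>The shift is by less than 3/2, whence the constant 9/8.\<close>
  have "(2 - \<sigma>)\<^sup>2 \<le> (3/2)\<^sup>2" using \<sigma> by (intro power_mono) auto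
  then have "(2 - \<sigma>)\<^sup>2 / (2 * \<delta>\<^sup>2) \<le> (9/4) / (2 * \<delta>\<^sup>2)" using \<delta> by (intro divide_right_mono) (auto simp: power2_eq_square)
  then have e: "0 < e" "e \<le> exp (9 / (8 * \<delta>\<^sup>2))" by (auto simp: e_def)
  let ?T = "\<lambda>n u. of_real (vm2 n) * (of_nat n powr (- Complex 2 (t + u)) * gshift \<delta> (2 - \<sigma>) u)"
  let ?J = "\<integral>u. LL (Complex \<sigma> (t + u)) * of_real (normal_density 0 \<delta> u) \<partial>lborel"
  have i2: "integrable lborel (\<lambda>u. LL (Complex 2 (t + u)) * gshift \<delta> (2 - \<sigma>) u)"
    by (rule gauss_shift(1)[OF LL_holomorphic \<sigma> \<delta>(1) CC]) (use \<sigma> in auto)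
  have J: "?J = (\<integral>u. LL (Complex 2 (t + u)) * gshift \<delta> (2 - \<sigma>) u \<partial>lborel)"
    using gauss_shift(2)[OF LL_holomorphic \<sigma> \<delta>(1) CC, of t] by (simp add: gshift_0)
  have Tn: "norm (?T n u) \<le> 2 * real n powr (-2) * (normal_density 0 \<delta> u * e)" for n u
    unfolding norm_mult norm_gshift e_def[symmetric] using vm2_abs_le[of n] e
    by (auto simp: norm_nat_powr mult.assoc intro!: mult_mono)
  have Ti: "integrable lborel (?T n)" for n
    using gauss_shift_dirichlet_term(2)[OF _ \<sigma>(2) \<delta>(1), of n t] by (cases "n = 0") auto
  have sm2: "summable (\<lambda>n. 2 * real n powr (-2))" using summable_real_powr_iff[of "-2"] by (intro summable_mult) auto
  have st: "(\<lambda>n. integral\<^sup>L lborel (?T n)) sums (\<integral>u. (\<Sum>n. ?T n u) \<partial>lborel)" and si: "integrable lborel (\<lambda>u. \<Sum>n. ?T n u)"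
  proof -
    have 1: "AE u in lborel. summable (\<lambda>n. norm (?T n u))"
    proof (rule AE_I2)
      fix u
      show "summable (\<lambda>n. norm (?T n u))"
        by (rule summable_comparison_test'[where N=0, OF summable_mult2[OF sm2, of "normal_density 0 \<delta> u * e"]])
           (use Tn[of _ u] in auto)
    qed
    have 2: "summable (\<lambda>n. \<integral>u. norm (?T n u) \<partial>lborel)"
    proof (rule summable_comparison_test'[where N=0, OF summable_mult2[OF sm2, of e]])
      fix n
      have "(\<integral>u. norm (?T n u) \<partial>lborel) \<le> (\<integral>u. 2 * real n powr (-2) * (normal_density 0 \<delta> u * e) \<partial>lborel)"
        by (intro integral_mono Tn integrable_norm Ti integrable_mult_right integrable_mult_left) (use \<delta> in auto)
      also have "\<dots> = 2 * real n powr (-2) * e" using \<delta> by simp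
      finally show "norm (\<integral>u. norm (?T n u) \<partial>lborel) \<le> 2 * real n powr (-2) * e" by simp
    qed
    show "(\<lambda>n. integral\<^sup>L lborel (?T n)) sums (\<integral>u. (\<Sum>n. ?T n u) \<partial>lborel)" by (rule sums_integral[OF Ti 1 2])
    show "integrable lborel (\<lambda>u. \<Sum>n. ?T n u)" by (rule integrable_suminf[OF Ti 1 2])
  qed
  have sT: "(\<Sum>n. ?T n u) = dser vm2 (Complex 2 (t + u)) * gshift \<delta> (2 - \<sigma>) u" for u
  proof -
    have "(\<lambda>n. (of_real (vm2 n) * of_nat n powr (- Complex 2 (t + u))) * gshift \<delta> (2 - \<sigma>) u) sums (dser vm2 (Complex 2 (t + u)) * gshift \<delta> (2 - \<sigma>) u)"
      by (intro sums_mult2 dser_sums[OF vm2_abs_le]) simp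
    then show ?thesis by (simp add: sums_iff mult.assoc)
  qed
  define E where "E = (\<integral>u. plog_prim (Complex 2 (t + u)) * gshift \<delta> (2 - \<sigma>) u \<partial>lborel)"
  have pp: "plog_prim (Complex 2 (t + u)) * gshift \<delta> (2 - \<sigma>) u = LL (Complex 2 (t + u)) * gshift \<delta> (2 - \<sigma>) u + (\<Sum>n. ?T n u)" for u
    unfolding sT by (simp add: LL_eq algebra_simps)
  have iP: "integrable lborel (\<lambda>u. plog_prim (Complex 2 (t + u)) * gshift \<delta> (2 - \<sigma>) u)"
    unfolding pp by (intro Bochner_Integration.integrable_add i2 si)
  have "E = ?J + (\<integral>u. (\<Sum>n. ?T n u) \<partial>lborel)"
    unfolding E_def J pp by (rule Bochner_Integration.integral_add[OF i2 si])
  then have main: "(\<lambda>n. integral\<^sup>L lborel (?T n)) sums (E - ?J)" using st by simp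
  have tm: "Re (integral\<^sup>L lborel (?T n)) = gcoef \<sigma> \<delta> n * cos (t * ln (real n))" for n
  proof (cases "n = 0")
    case False
    have a1: "integral\<^sup>L lborel (?T n) = of_real (vm2 n) * (of_nat n powr (- Complex \<sigma> t) * of_real (exp (- (\<delta> * ln (real n))\<^sup>2 / 2)))"
      using gauss_shift_dirichlet_term[OF _ \<sigma>(2) \<delta>(1), of n t] False by simp
    have a2: "Re (of_nat n powr (- Complex \<sigma> t)) = real n powr (-\<sigma>) * cos (t * ln (real n))"
      using False by (auto simp: powr_def Ln_of_nat Re_exp)
    show ?thesis unfolding a1 by (simp add: gcoef_def a2)
  qed (simp add: gcoef_def)
  have "(\<lambda>n. gcoef \<sigma> \<delta> n * cos (t * ln (real n))) sums Re (E - ?J)"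
    using sums_Re[OF main] unfolding tm .
  then have s1: "(\<Sum>n. gcoef \<sigma> \<delta> n * cos (t * ln (real n))) = Re E - Re ?J" by (simp add: sums_iff)
  have "Re ?J = (\<integral>u. Re (LL (Complex \<sigma> (t + u)) * of_real (normal_density 0 \<delta> u)) \<partial>lborel)"
    by (rule integral_Re[symmetric]) (rule LL_conv_integrable[OF \<sigma> \<delta>(1)])
  then have s2: "(\<integral>u. - Re (LL (Complex \<sigma> (t + u))) * normal_density 0 \<delta> u \<partial>lborel) = - Re ?J" by simp
  have "norm E \<le> (\<integral>u. norm (plog_prim (Complex 2 (t + u)) * gshift \<delta> (2 - \<sigma>) u) \<partial>lborel)"
    unfolding E_def by (rule integral_norm_bound)
  also have "\<dots> \<le> (\<integral>u. 16 * e / (1 + \<bar>t\<bar>) * (normal_density 0 \<delta> u + normal_density 0 \<delta> u * \<bar>u\<bar>) \<partial>lborel)"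
  proof (rule integral_mono)
    show "integrable lborel (\<lambda>u. norm (plog_prim (Complex 2 (t + u)) * gshift \<delta> (2 - \<sigma>) u))" using iP by simp
    show "integrable lborel (\<lambda>u. 16 * e / (1 + \<bar>t\<bar>) * (normal_density 0 \<delta> u + normal_density 0 \<delta> u * \<bar>u\<bar>))"
      using \<delta> normal_density_integrable_abs(1)[OF \<delta>(1)] by (intro integrable_mult_right Bochner_Integration.integrable_add) auto
    fix u
    define y where "y = \<bar>t + u\<bar>"
    have n2: "norm (Complex 2 (t + u)) \<ge> (1 + y) / 2"
      using abs_Re_le_cmod[of "Complex 2 (t + u)"] abs_Im_le_cmod[of "Complex 2 (t + u)"] by (simp add: y_def)
    have "norm (plog_prim (Complex 2 (t + u))) \<le> 8 / norm (Complex 2 (t + u))" by (rule norm_plog_prim_le) simp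
    also have "\<dots> \<le> 8 / ((1 + y) / 2)" by (rule divide_left_mono[OF n2]) (use n2 in \<open>auto simp: y_def intro!: mult_pos_pos\<close>)
    also have "\<dots> = 16 / (1 + y)" by simp
    \<comment> \<open>Peetre's inequality 1 + |t| \<le> (1 + |u|) (1 + |t + u|).\<close>
    also have "\<dots> \<le> 16 * (1 + \<bar>u\<bar>) / (1 + \<bar>t\<bar>)"
    proof -
      have "1 + \<bar>t\<bar> \<le> (1 + \<bar>u\<bar>) * (1 + y)"
      proof -
        have "\<bar>t\<bar> \<le> y + \<bar>u\<bar>" by (simp add: y_def)
        moreover have "0 \<le> \<bar>u\<bar> * y" by (simp add: y_def)
        ultimately show ?thesis by (simp add: algebra_simps)
      qed
      then have "16 * (1 + \<bar>t\<bar>) \<le> 16 * (1 + \<bar>u\<bar>) * (1 + y)" unfolding mult.assoc by (intro mult_left_mono) auto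
      moreover have "1 + y > 0" "1 + \<bar>t\<bar> > 0" by (simp_all add: y_def add_pos_nonneg)
      ultimately show ?thesis
        by (intro mult_imp_div_pos_le) (simp_all only: times_divide_eq_left mult_imp_le_div_pos)
    qed
    finally have "norm (plog_prim (Complex 2 (t + u))) * (normal_density 0 \<delta> u * e) \<le> 16 * (1 + \<bar>u\<bar>) / (1 + \<bar>t\<bar>) * (normal_density 0 \<delta> u * e)"
      using e by (intro mult_right_mono) auto
    then show "norm (plog_prim (Complex 2 (t + u)) * gshift \<delta> (2 - \<sigma>) u) \<le> 16 * e / (1 + \<bar>t\<bar>) * (normal_density 0 \<delta> u + normal_density 0 \<delta> u * \<bar>u\<bar>)"
      unfolding norm_mult norm_gshift e_def[symmetric] by (simp add: algebra_simps add_divide_distrib)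
  qed
  also have "\<dots> = 16 * e / (1 + \<bar>t\<bar>) * (1 + (\<integral>u. normal_density 0 \<delta> u * \<bar>u\<bar> \<partial>lborel))"
    using \<delta> normal_density_integrable_abs(1)[OF \<delta>(1)] by simp
  \<comment> \<open>The mean of 1 + |u| is at most 1 + \<delta> \<le> 2, which doubles 16 to
    32.\<close>
  also have "\<dots> \<le> 16 * e / (1 + \<bar>t\<bar>) * 2"
    using normal_density_integrable_abs(2)[OF \<delta>(1)] \<delta> e by (intro mult_left_mono) (auto intro!: divide_nonneg_pos)
  also have "\<dots> = 32 * e / (1 + \<bar>t\<bar>)" by simp
  also have "\<dots> \<le> 32 * exp (9 / (8 * \<delta>\<^sup>2)) / (1 + \<bar>t\<bar>)" using e by (intro divide_right_mono) auto
  finally have "\<bar>Re E\<bar> \<le> 32 * exp (9 / (8 * \<delta>\<^sup>2)) / (1 + \<bar>t\<bar>)" using abs_Re_le_cmod[of E] by linarith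
  then show ?thesis unfolding s1 s2 by simp
qed

end

section \<open>A lower bound of Chebyshev type\<close>

text \<open>Leibniz' harmonic triangle: the reciprocals of \<open>k (n choose k)\<close> are integer combinations of \<open>1/1, \<dots>, 1/n\<close>.\<close>
lemma leibniz_triangle_Ints:
  assumes "1 \<le> k" "k \<le> n" "\<And>i. i \<in> {1..n} \<Longrightarrow> i dvd d"
  shows "real d / (real k * real (n choose k)) \<in> \<int>"
  using assms
proof (induction k arbitrary: n rule: nat_induct_at_least)
  case base
  then have "n dvd d" "n \<noteq> 0" by auto
  then obtain c where "d = n * c" "n \<noteq> 0" by (auto elim: dvdE)
  then show ?case by simp
next
  case (Suc k)
  have k: "1 \<le> k" "k < n" using Suc by auto
  have "real d / (real k * real (n choose k)) \<in> \<int>" using Suc k by (intro Suc.IH) auto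
  moreover have "real d / (real k * real ((n - 1) choose k)) \<in> \<int>" using Suc.prems k by (intro Suc.IH) auto
  moreover have "real d / (real (Suc k) * real (n choose Suc k)) = real d / (real k * real ((n - 1) choose k)) - real d / (real k * real (n choose k))"
  proof -
    have "Suc k * (n choose Suc k) = (n - k) * (n choose k)"
      by (simp only: binomial_absorption binomial_absorb_comp)
    then have c1: "real (Suc k) * real (n choose Suc k) = real (n - k) * real (n choose k)"
      by (simp only: of_nat_mult[symmetric])
    have c2: "real n * real ((n - 1) choose k) = real (n - k) * real (n choose k)"
      using binomial_absorb_comp[of n k] by (metis of_nat_mult)
    define B where "B = real (n choose k)"
    have B: "B > 0" using k by (simp add: B_def)
    have nk: "real (n - k) = real n - real k" "real n - real k > 0" using k by auto
    have e: "real ((n - 1) choose k) = (real n - real k) * B / real n" using c2 k nk by (simp add: B_def field_simps)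
    show ?thesis unfolding c1 e B_def[symmetric] nk(1) using B nk(2) k by (simp add: divide_simps) (simp add: algebra_simps)
  qed
  ultimately show ?case by simp
qed

text \<open>By \<open>leibniz_triangle_Ints\<close> the least common multiple divided by n (2n
  choose n) is a positive integer, hence at least 1, and the central binomial coefficient is at
  least 4^n / (2n).\<close>

lemma Lcm_lower:
  assumes "n > 0"
  shows "real (Lcm {1..2*n}) \<ge> 4 ^ n / 2"
proof -
  define d where "d = Lcm {1..2*n}"
  have d0: "d > 0" unfolding d_def by (auto simp: Lcm_0_iff intro!: Nat.gr0I)
  have bin: "real ((2*n) choose n) > 0" by simp
  have I: "real d / (real n * real ((2*n) choose n)) \<in> \<int>"
    using assms by (intro leibniz_triangle_Ints) (auto simp: d_def)
  have "real d / (real n * real ((2*n) choose n)) > 0" using d0 assms bin by (intro divide_pos_pos mult_pos_pos) auto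
  then have "real d / (real n * real ((2*n) choose n)) \<ge> 1" using I by (auto elim!: Ints_cases)
  then have "real n * real ((2*n) choose n) \<le> real d" using assms bin by (simp add: divide_simps split: if_splits)
  moreover have "4 ^ n / 2 \<le> real n * real ((2*n) choose n)"
    using mult_left_mono[OF central_binomial_lower_bound[OF assms], of "real n"] assms by simp
  ultimately show ?thesis unfolding d_def by linarith
qed

text \<open>The exponent of p in a least common multiple is the maximum of its exponents in the
  numbers, hence attained by one of them.\<close>

lemma prime_power_dvd_Lcm:
  fixes p :: nat
  assumes p: "prime p" and "m \<ge> 1"
  shows "\<exists>i\<in>{1..m}. p ^ multiplicity p (Lcm {1..m}) dvd i"
  using assms(2)
proof (induction m rule: nat_induct_at_least)
  case base show ?case by simp
next
  case (Suc m)
  have nz: "Lcm {1..m} \<noteq> (0::nat)" by (auto simp: Lcm_0_iff)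
  have "{1..Suc m} = insert (Suc m) {1..m}" by auto
  then have "Lcm {1..Suc m} = lcm (Suc m) (Lcm {1..m})" by (simp only: Lcm_insert)
  then have "multiplicity p (Lcm {1..Suc m}) = max (multiplicity p (Suc m)) (multiplicity p (Lcm {1..m}))"
    using prime_factorization_lcm[of "Suc m" "Lcm {1..m}"] nz
    by (simp add: count_prime_factorization_prime[OF p, symmetric])
  then consider "multiplicity p (Lcm {1..Suc m}) = multiplicity p (Suc m)" | "multiplicity p (Lcm {1..Suc m}) = multiplicity p (Lcm {1..m})"
    by linarith
  then show ?case
  proof cases
    case 1
    then show ?thesis using multiplicity_dvd[of p "Suc m"] by (intro bexI[of _ "Suc m"]) auto
  next
    case 2
    then show ?thesis using Suc.IH by auto
  qed
qed

text \<open>Each prime power in the factorisation divides some i \<le> m, so it is at most m, and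
  the primes that occur are themselves at most m.\<close>

lemma Lcm_upper:
  assumes "m \<ge> 1"
  shows "Lcm {1..m} \<le> m ^ card {p::nat. prime p \<and> p \<le> m}"
proof -
  define L where "L = (Lcm {1..m} :: nat)"
  have L0: "L \<noteq> 0" by (auto simp: L_def Lcm_0_iff)
  have pm: "p ^ multiplicity p L \<le> m" if pr: "prime p" for p
  proof -
    obtain i where i: "i \<in> {1..m}" "p ^ multiplicity p L dvd i" using prime_power_dvd_Lcm[OF pr assms] by (auto simp: L_def)
    have "p ^ multiplicity p L \<le> i" using i by (intro dvd_imp_le) auto
    then show ?thesis using i by simp
  qed
  have sub: "prime_factors L \<subseteq> {p. prime p \<and> p \<le> m}"
  proof
    fix p assume p: "p \<in> prime_factors L"
    then have pr: "prime p" and "multiplicity p L > 0" using L0 by (auto simp: prime_factors_multiplicity)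
    then have "p ^ 1 \<le> p ^ multiplicity p L" using prime_gt_0_nat[OF pr] by (intro power_increasing) auto
    then show "p \<in> {p. prime p \<and> p \<le> m}" using pm[OF pr] pr by simp
  qed
  have "L = (\<Prod>p\<in>prime_factors L. p ^ multiplicity p L)"
    using prod_prime_factors[OF L0] by simp
  also have "\<dots> \<le> (\<Prod>p\<in>prime_factors L. m)"
    by (intro prod_mono) (use pm in \<open>auto simp: prime_factors_multiplicity\<close>)
  also have "\<dots> = m ^ card (prime_factors L)" by simp
  also have "\<dots> \<le> m ^ card {p. prime p \<and> p \<le> m}"
    using assms by (intro power_increasing card_mono sub) auto
  finally show ?thesis unfolding L_def .
qed

lemma prime_count_lower:
  assumes "n \<ge> 1"
  shows "real n * ln 2 \<le> real (card {p::nat. prime p \<and> p \<le> 2 * n}) * ln (2 * real n)"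
proof -
  have "(2::real) ^ n \<le> 4 ^ n / 2"
  proof -
    have "(2::real) ^ n * 2 \<le> 2 ^ n * 2 ^ n" using assms by (intro mult_left_mono self_le_power) auto
    also have "\<dots> = 4 ^ n" by (simp add: power_mult_distrib[symmetric])
    finally show ?thesis by simp
  qed
  also have "\<dots> \<le> real (Lcm {1..2*n})" using Lcm_lower assms by auto
  also have "\<dots> \<le> real ((2*n) ^ card {p::nat. prime p \<and> p \<le> 2 * n})"
    using Lcm_upper[of "2*n"] assms by (simp only: of_nat_le_iff)
  also have "\<dots> = (2 * real n) ^ card {p::nat. prime p \<and> p \<le> 2 * n}" by simp
  finally have "ln (2 ^ n) \<le> ln ((2 * real n) ^ card {p::nat. prime p \<and> p \<le> 2 * n})"
    using assms by (subst ln_le_cancel_iff) auto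
  moreover have "ln ((2 * real n) ^ card {p::nat. prime p \<and> p \<le> 2 * n}) = real (card {p::nat. prime p \<and> p \<le> 2 * n}) * ln (2 * real n)"
    by (rule ln_realpow)
  ultimately show ?thesis by (simp add: ln_realpow)
qed

section \<open>The size of the i-th prime\<close>

text \<open>Counted from 0: \<open>nth_pr 0 = 2\<close>.\<close>

definition nth_pr :: "nat \<Rightarrow> nat" where "nth_pr = enumerate {p. prime p}"

lemma nth_pr_prime: "prime (nth_pr i)"
  using enumerate_in_set[OF primes_infinite, of i] by (simp add: nth_pr_def)

lemma nth_pr_mono: "i < j \<Longrightarrow> nth_pr i < nth_pr j"
  unfolding nth_pr_def by (rule enumerate_mono[OF _ primes_infinite])

lemma nth_pr_inj: "inj nth_pr"
  unfolding nth_pr_def by (rule inj_enumerate[OF primes_infinite])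

lemma nth_pr_ge: "i \<le> nth_pr i"
  unfolding nth_pr_def by (rule le_enumerate[OF primes_infinite])

lemma nth_pr_le:
  assumes "card {p::nat. prime p \<and> p \<le> m} > i"
  shows "nth_pr i \<le> m"
proof (rule ccontr)
  assume "\<not> nth_pr i \<le> m"
  have "{p::nat. prime p \<and> p \<le> m} \<subseteq> nth_pr ` {..<i}"
  proof
    fix p assume p: "p \<in> {p::nat. prime p \<and> p \<le> m}"
    then obtain j where j: "nth_pr j = p" using enumerate_Ex[of "{p. prime p}" p] primes_infinite by (auto simp: nth_pr_def)
    have "j < i" using nth_pr_mono[of i j] j p \<open>\<not> nth_pr i \<le> m\<close> by (cases i j rule: linorder_cases) auto
    then show "p \<in> nth_pr ` {..<i}" using j by auto
  qed
  then have "card {p::nat. prime p \<and> p \<le> m} \<le> card (nth_pr ` {..<i})" by (intro card_mono) auto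
  also have "\<dots> \<le> i" using card_image_le[of "{..<i}" nth_pr] by simp
  finally show False using assms by simp
qed

text \<open>With y = 8 i ln i and n the least integer \<ge> y, \<open>prime_count_lower\<close>
  gives more than i primes up to 2n, and 2n \<le> 2 (y + 1) \<le> 20 i ln i. The constants are
  generous; only the order of magnitude matters.\<close>

lemma nth_pr_upper: "eventually (\<lambda>i. real (nth_pr i) \<le> 20 * real i * ln (real i)) at_top"
proof -
  have "eventually (\<lambda>x::real. 8 * x * ln x * ln 2 > (x + 1) * ln (2 * (8 * x * ln x + 1)) \<and> 2 * (8 * x * ln x + 1) \<le> 20 * x * ln x \<and> 8 * x * ln x \<ge> 1) at_top"
  proof (intro eventually_conj)
    have "(1/2::real) \<le> ln 2" using ln_le_minus_one[of "1/2::real"] by (simp add: ln_div)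
    moreover have "eventually (\<lambda>x::real. 4 * x * ln x > (x + 1) * ln (2 * (8 * x * ln x + 1)) \<and> x * ln x > 0) at_top"
      by (intro eventually_conj; real_asymp)
    ultimately show "eventually (\<lambda>x::real. 8 * x * ln x * ln 2 > (x + 1) * ln (2 * (8 * x * ln x + 1))) at_top"
    proof (elim eventually_mono)
      fix x :: real assume h: "1/2 \<le> ln (2::real)" and a: "4 * x * ln x > (x + 1) * ln (2 * (8 * x * ln x + 1)) \<and> x * ln x > 0"
      have "(x * ln x) * (1/2) \<le> (x * ln x) * ln 2" using h a by (intro mult_left_mono) auto
      then show "8 * x * ln x * ln 2 > (x + 1) * ln (2 * (8 * x * ln x + 1))" using a by linarith
    qed
  qed real_asymp+
  then have "eventually (\<lambda>i::nat. 8 * real i * ln (real i) * ln 2 > (real i + 1) * ln (2 * (8 * real i * ln (real i) + 1)) \<and> 2 * (8 * real i * ln (real i) + 1) \<le> 20 * real i * ln (real i) \<and> 8 * real i * ln (real i) \<ge> 1) at_top"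
    using filterlim_real_sequentially by (auto simp: filterlim_iff)
  then show ?thesis
  proof (rule eventually_mono)
    fix i :: nat
    define y where "y = 8 * real i * ln (real i)"
    assume "8 * real i * ln (real i) * ln 2 > (real i + 1) * ln (2 * (8 * real i * ln (real i) + 1)) \<and> 2 * (8 * real i * ln (real i) + 1) \<le> 20 * real i * ln (real i) \<and> 8 * real i * ln (real i) \<ge> 1"
    then have a: "y * ln 2 > (real i + 1) * ln (2 * (y + 1))" "2 * (y + 1) \<le> 20 * real i * ln (real i)" "y \<ge> 1" by (auto simp: y_def)
    define n where "n = nat \<lceil>y\<rceil>"
    have n: "y \<le> real n" "real n \<le> y + 1" "n \<ge> 1" using a(3) unfolding n_def by linarith+
    have l0: "ln (2 * real n) > 0" using n by (intro ln_gt_zero) auto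
    have "(real i + 1) * ln (2 * real n) \<le> (real i + 1) * ln (2 * (y + 1))" using n by (intro mult_left_mono) auto
    also have "\<dots> < y * ln 2" by (rule a)
    also have "\<dots> \<le> real n * ln 2" using n by (intro mult_right_mono) auto
    also have "\<dots> \<le> real (card {p::nat. prime p \<and> p \<le> 2 * n}) * ln (2 * real n)" by (rule prime_count_lower[OF n(3)])
    finally have "real i + 1 < real (card {p::nat. prime p \<and> p \<le> 2 * n})" using l0 by (simp add: mult_less_cancel_right)
    then have "nth_pr i \<le> 2 * n" by (intro nth_pr_le) linarith
    then have "real (nth_pr i) \<le> 2 * real n" by (metis of_nat_le_iff of_nat_mult of_nat_numeral)
    also have "2 * real n \<le> 2 * (y + 1)" using n(2) by simp
    finally have "real (nth_pr i) \<le> 2 * (y + 1)" .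
    then show "real (nth_pr i) \<le> 20 * real i * ln (real i)" using a(2) by (rule order_trans)
  qed
qed

section \<open>The resonator\<close>

locale resonator =
  fixes I :: "nat set" and P :: "nat \<Rightarrow> nat set" and n :: "nat \<Rightarrow> nat"
  assumes I: "finite I" and P: "\<And>k. k \<in> I \<Longrightarrow> finite (P k)"
    and disj: "\<And>j k. j \<in> I \<Longrightarrow> k \<in> I \<Longrightarrow> j \<noteq> k \<Longrightarrow> P j \<inter> P k = {}"
    and n: "\<And>k. k \<in> I \<Longrightarrow> 1 \<le> n k \<and> n k \<le> card (P k)"
begin

text \<open>A set of primes stands for the product of its members. Two consecutive cardinalities are
  allowed in each block, so that multiplication by a prime of the block can stay inside the
  support.\<close>

definition M :: "nat set set" where
  "M = {A. A \<subseteq> (\<Union>k\<in>I. P k) \<and> (\<forall>k\<in>I. card (A \<inter> P k) = n k - 1 \<or> card (A \<inter> P k) = n k)}"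

text \<open>The weight of the upper level of a block relative to the lower one. It satisfies
  \<open>(\<rho> k)\<^sup>2 * real (card (P k) - n k + 1) = real (n k)\<close>, which makes both
  levels carry the same mass (\<open>Low_half\<close>).\<close>

definition \<rho> :: "nat \<Rightarrow> real" where
  "\<rho> k = sqrt (real (n k) / real (card (P k) - n k + 1))"

definition f :: "nat set \<Rightarrow> real" where
  "f A = (\<Prod>k\<in>I. if card (A \<inter> P k) = n k then \<rho> k else 1)"

definition Y :: real where "Y = (\<Sum>A\<in>M. (f A)\<^sup>2)"

definition ext_dom :: "nat \<Rightarrow> nat set set" where
  "ext_dom p = {A \<in> M. p \<notin> A \<and> insert p A \<in> M}"

lemma finite_M: "finite M"
proof (rule finite_subset)
  show "M \<subseteq> Pow (\<Union>k\<in>I. P k)" by (auto simp: M_def)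
qed (use I P in auto)

lemma \<rho>_pos: "k \<in> I \<Longrightarrow> \<rho> k > 0"
  using n[of k] by (simp add: \<rho>_def)

lemma f_pos: "f A > 0"
  unfolding f_def by (intro prod_pos) (auto simp: \<rho>_pos)

text \<open>A member of \<open>M\<close> is determined by its traces on the blocks.\<close>

lemma card_M_le: "card M \<le> (\<Prod>k\<in>I. (card (P k) choose (n k - 1)) + (card (P k) choose n k))"
proof -
  let ?F = "\<lambda>k. {B. B \<subseteq> P k \<and> card B = n k - 1} \<union> {B. B \<subseteq> P k \<and> card B = n k}"
  let ?r = "\<lambda>A. restrict (\<lambda>k. A \<inter> P k) I"
  have fF: "finite (?F k)" if "k \<in> I" for k using P[OF that] by (auto intro: finite_subset[of _ "Pow (P k)"])
  have "inj_on ?r M"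
  proof (rule inj_onI)
    fix A B assume A: "A \<in> M" "B \<in> M" and e: "?r A = ?r B"
    have "A \<inter> P k = B \<inter> P k" if "k \<in> I" for k using fun_cong[OF e, of k] that by simp
    then show "A = B" using A by (auto simp: M_def) blast+
  qed
  then have "card M = card (?r ` M)" by (rule card_image[symmetric])
  also have "\<dots> \<le> card (Pi\<^sub>E I ?F)"
  proof (rule card_mono)
    show "finite (Pi\<^sub>E I ?F)" using I fF by (rule finite_PiE)
    show "?r ` M \<subseteq> Pi\<^sub>E I ?F" by (auto simp: M_def PiE_def Pi_def)
  qed
  also have "\<dots> = (\<Prod>k\<in>I. card (?F k))" by (rule card_PiE[OF I])
  also have "\<dots> \<le> (\<Prod>k\<in>I. (card (P k) choose (n k - 1)) + (card (P k) choose n k))"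
  proof (rule prod_mono, intro conjI)
    fix k assume k: "k \<in> I"
    show "card (?F k) \<le> (card (P k) choose (n k - 1)) + (card (P k) choose n k)"
      by (rule order_trans[OF card_Un_le]) (simp add: n_subsets[OF P[OF k]])
  qed simp
  finally show ?thesis .
qed

context
  fixes k :: nat assumes k: "k \<in> I"
begin

definition Low :: "nat set set" where "Low = {A \<in> M. card (A \<inter> P k) = n k - 1}"

definition High :: "nat set set" where "High = {A \<in> M. card (A \<inter> P k) = n k}"

lemma M_split: "M = Low \<union> High" "Low \<inter> High = {}"
  using n[OF k] k by (auto simp: Low_def High_def M_def)

lemma insert_inter:
  assumes "p \<in> P k" "j \<in> I" "j \<noteq> k"
  shows "insert p A \<inter> P j = A \<inter> P j" "(A - {p}) \<inter> P j = A \<inter> P j"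
  using disj[OF k assms(2)] assms by auto

lemma card_insert_inter:
  assumes "p \<in> P k" "p \<notin> A"
  shows "card (insert p A \<inter> P k) = Suc (card (A \<inter> P k))"
proof -
  have "insert p A \<inter> P k = insert p (A \<inter> P k)" using assms by auto
  then show ?thesis using assms P[OF k] by simp
qed

lemma insert_Low:
  assumes "A \<in> Low" "p \<in> P k" "p \<notin> A"
  shows "insert p A \<in> High" "f (insert p A) = \<rho> k * f A"
proof -
  have c: "card (insert p A \<inter> P k) = n k" "card (A \<inter> P k) \<noteq> n k"
    using card_insert_inter[OF assms(2,3)] assms(1) n[OF k] by (auto simp: Low_def)
  show "insert p A \<in> High"
    using assms c(1) k insert_inter[OF assms(2)] unfolding High_def Low_def M_def
    by (auto, metis)
  have "f (insert p A) = \<rho> k * (\<Prod>j\<in>I - {k}. if card (insert p A \<inter> P j) = n j then \<rho> j else 1)"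
    unfolding f_def by (subst prod.remove[OF I k]) (simp add: c(1))
  also have "(\<Prod>j\<in>I - {k}. if card (insert p A \<inter> P j) = n j then \<rho> j else 1) = (\<Prod>j\<in>I - {k}. if card (A \<inter> P j) = n j then \<rho> j else 1)"
    by (rule prod.cong) (auto simp: insert_inter[OF assms(2)])
  also have "\<dots> = f A" using prod.remove[OF I k, of "\<lambda>j. if card (A \<inter> P j) = n j then \<rho> j else 1"] c(2) by (simp add: f_def)
  finally show "f (insert p A) = \<rho> k * f A" .
qed

lemma remove_High:
  assumes "B \<in> High" "p \<in> P k" "p \<in> B"
  shows "B - {p} \<in> Low"
proof -
  have "Suc (card ((B - {p}) \<inter> P k)) = n k"
    using card_insert_inter[OF assms(2), of "B - {p}"] assms by (simp add: insert_absorb High_def)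
  then have "card ((B - {p}) \<inter> P k) = n k - 1" by linarith
  then show ?thesis using assms k insert_inter(2)[OF assms(2), of _ B] unfolding High_def Low_def M_def
    by (auto, metis)
qed

lemma card_complement: "A \<in> Low \<Longrightarrow> card (P k - A) = card (P k) - n k + 1"
proof -
  assume A: "A \<in> Low"
  have "card (P k - A) = card (P k) - card (P k \<inter> A)" using P[OF k] by (simp add: card_Diff_subset_Int)
  then show ?thesis using A n[OF k] by (simp add: Low_def Int_commute Suc_diff_le)
qed

text \<open>Double counting: pairs (A, p) with p to be added to a lower set correspond to pairs (B,
  p) with p to be removed from an upper set. A lower set has \<open>card (P k) - n k + 1\<close>
  primes to add, an upper one has \<open>n k\<close> to remove, and going up multiplies the square
  of f by that of \<open>\<rho> k\<close>; so the levels balance.\<close>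

lemma Low_half: "(\<Sum>A\<in>Low. (f A)\<^sup>2) = Y / 2"
proof -
  define w where "w = card (P k) - n k + 1"
  have fin: "finite Low" "finite High" using finite_M M_split by auto
  have rho2: "(\<rho> k)\<^sup>2 * real w = real (n k)" by (simp add: \<rho>_def w_def)
  have bij: "bij_betw (\<lambda>(A, p). (insert p A, p)) (Sigma Low (\<lambda>A. P k - A)) (Sigma High (\<lambda>B. B \<inter> P k))"
  proof (rule bij_betwI[where g = "\<lambda>(B, p). (B - {p}, p)"])
    show "(\<lambda>(A, p). (insert p A, p)) \<in> Sigma Low (\<lambda>A. P k - A) \<rightarrow> Sigma High (\<lambda>B. B \<inter> P k)"
      using insert_Low(1) by auto
    show "(\<lambda>(B, p). (B - {p}, p)) \<in> Sigma High (\<lambda>B. B \<inter> P k) \<rightarrow> Sigma Low (\<lambda>A. P k - A)"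
      using remove_High by auto
  qed (auto simp: insert_absorb)
  have "(\<Sum>B\<in>High. (f B)\<^sup>2 * real (n k)) = (\<Sum>B\<in>High. \<Sum>p\<in>B \<inter> P k. (f B)\<^sup>2)"
    by (intro sum.cong refl) (simp add: High_def)
  also have "\<dots> = (\<Sum>(B, p)\<in>Sigma High (\<lambda>B. B \<inter> P k). (f B)\<^sup>2)"
    using fin P[OF k] by (intro sum.Sigma) auto
  also have "\<dots> = (\<Sum>x\<in>Sigma Low (\<lambda>A. P k - A). case (case x of (A, p) \<Rightarrow> (insert p A, p)) of (B, p) \<Rightarrow> (f B)\<^sup>2)"
    by (rule sum.reindex_bij_betw[OF bij, symmetric])
  also have "\<dots> = (\<Sum>(A, p)\<in>Sigma Low (\<lambda>A. P k - A). (\<rho> k)\<^sup>2 * (f A)\<^sup>2)"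
    by (intro sum.cong refl) (auto simp: insert_Low(2) power_mult_distrib)
  also have "\<dots> = (\<Sum>A\<in>Low. \<Sum>p\<in>P k - A. (\<rho> k)\<^sup>2 * (f A)\<^sup>2)"
    using fin P[OF k] by (intro sum.Sigma[symmetric]) auto
  also have "\<dots> = (\<Sum>A\<in>Low. (f A)\<^sup>2 * real (n k))"
  proof (intro sum.cong refl)
    fix A assume "A \<in> Low"
    then have "card (P k - A) = w" using card_complement by (simp add: w_def)
    then show "(\<Sum>p\<in>P k - A. (\<rho> k)\<^sup>2 * (f A)\<^sup>2) = (f A)\<^sup>2 * real (n k)" by (simp add: rho2[symmetric])
  qed
  finally have "(\<Sum>B\<in>High. (f B)\<^sup>2) * real (n k) = (\<Sum>A\<in>Low. (f A)\<^sup>2) * real (n k)" by (simp add: sum_distrib_right)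
  then have e: "(\<Sum>B\<in>High. (f B)\<^sup>2) = (\<Sum>A\<in>Low. (f A)\<^sup>2)" using n[OF k] by simp
  have "Y = (\<Sum>A\<in>Low. (f A)\<^sup>2) + (\<Sum>B\<in>High. (f B)\<^sup>2)"
    unfolding Y_def M_split(1) by (rule sum.union_disjoint[OF fin M_split(2)])
  then show ?thesis using e by simp
qed

text \<open>A prime of block k can be added exactly on the lower level, so each lower A contributes
  \<rho> w times the square of f, where w counts its free primes. The lower level has mass Y/2, and
  \<rho> w = sqrt (n w).\<close>

lemma block_resonance:
  "(\<Sum>p\<in>P k. \<Sum>A\<in>ext_dom p. f A * f (insert p A)) = sqrt (real (n k) * real (card (P k) - n k + 1)) / 2 * Y"
proof -
  define w where "w = card (P k) - n k + 1"
  have fin: "finite Low" "finite High" using finite_M M_split by auto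
  \<comment> \<open>A set with \<open>n k\<close> elements in the block would leave the support when
    enlarged; this singles out \<open>Low\<close>.\<close>
  have ed: "ext_dom p = {A \<in> Low. p \<notin> A}" if p: "p \<in> P k" for p
  proof (intro equalityI subsetI)
    fix A assume "A \<in> ext_dom p"
    then have A: "A \<in> M" "p \<notin> A" "insert p A \<in> M" by (auto simp: ext_dom_def)
    have "card (insert p A \<inter> P k) = Suc (card (A \<inter> P k))" by (rule card_insert_inter[OF p A(2)])
    moreover have "card (insert p A \<inter> P k) \<le> n k" using A(3) k by (auto simp: M_def)
    moreover have "card (A \<inter> P k) = n k - 1 \<or> card (A \<inter> P k) = n k" using A(1) k by (auto simp: M_def)
    ultimately show "A \<in> {A \<in> Low. p \<notin> A}" using A by (auto simp: Low_def)
  next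
    fix A assume "A \<in> {A \<in> Low. p \<notin> A}"
    then show "A \<in> ext_dom p" using insert_Low(1)[of A p] p by (auto simp: ext_dom_def High_def Low_def)
  qed
  have "(\<Sum>p\<in>P k. \<Sum>A\<in>ext_dom p. f A * f (insert p A)) = (\<Sum>p\<in>P k. \<Sum>A\<in>{A \<in> Low. p \<notin> A}. \<rho> k * (f A)\<^sup>2)"
    by (intro sum.cong) (auto simp: ed insert_Low(2) power2_eq_square)
  also have "\<dots> = (\<Sum>A\<in>Low. \<Sum>p\<in>{p \<in> P k. p \<notin> A}. \<rho> k * (f A)\<^sup>2)"
    using fin P[OF k] by (intro sum.swap_restrict) auto
  also have "\<dots> = (\<Sum>A\<in>Low. (\<rho> k * real w) * (f A)\<^sup>2)"
  proof (intro sum.cong refl)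
    fix A assume A: "A \<in> Low"
    have "{p \<in> P k. p \<notin> A} = P k - A" by auto
    then show "(\<Sum>p\<in>{p \<in> P k. p \<notin> A}. \<rho> k * (f A)\<^sup>2) = (\<rho> k * real w) * (f A)\<^sup>2"
      using card_complement[OF A] by (simp add: w_def)
  qed
  also have "\<dots> = (\<rho> k * real w) * (Y / 2)" by (simp add: sum_distrib_left[symmetric] Low_half)
  also have "\<rho> k * real w = sqrt (real (n k) * real w)"
  proof -
    have "\<rho> k * real w = sqrt (real (n k) / real w) * sqrt ((real w)\<^sup>2)" by (simp add: \<rho>_def w_def)
    also have "\<dots> = sqrt (real (n k) / real w * (real w)\<^sup>2)" by (simp only: real_sqrt_mult)
    also have "real (n k) / real w * (real w)\<^sup>2 = real (n k) * real w" by (simp add: w_def power2_eq_square)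
    finally show ?thesis .
  qed
  finally show ?thesis by (simp add: w_def)
qed

end

lemma resonator_sum:
  assumes \<beta>: "\<And>k p. k \<in> I \<Longrightarrow> p \<in> P k \<Longrightarrow> \<beta> k \<le> b p"
  shows "(\<Sum>k\<in>I. \<beta> k * (sqrt (real (n k) * real (card (P k) - n k + 1)) / 2)) * Y
    \<le> (\<Sum>p\<in>(\<Union>k\<in>I. P k). b p * (\<Sum>A\<in>ext_dom p. f A * f (insert p A)))"
proof -
  have nn: "0 \<le> (\<Sum>A\<in>ext_dom p. f A * f (insert p A))" for p
    using f_pos by (intro sum_nonneg mult_nonneg_nonneg) (auto simp: less_imp_le)
  have "(\<Sum>k\<in>I. \<beta> k * (sqrt (real (n k) * real (card (P k) - n k + 1)) / 2)) * Y
      = (\<Sum>k\<in>I. \<beta> k * (\<Sum>p\<in>P k. \<Sum>A\<in>ext_dom p. f A * f (insert p A)))"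
    unfolding sum_distrib_right by (intro sum.cong refl) (simp add: block_resonance)
  also have "\<dots> \<le> (\<Sum>k\<in>I. \<Sum>p\<in>P k. b p * (\<Sum>A\<in>ext_dom p. f A * f (insert p A)))"
  proof (rule sum_mono)
    fix k assume k: "k \<in> I"
    have "\<beta> k * (\<Sum>p\<in>P k. \<Sum>A\<in>ext_dom p. f A * f (insert p A)) = (\<Sum>p\<in>P k. \<beta> k * (\<Sum>A\<in>ext_dom p. f A * f (insert p A)))"
      by (rule sum_distrib_left)
    also have "\<dots> \<le> (\<Sum>p\<in>P k. b p * (\<Sum>A\<in>ext_dom p. f A * f (insert p A)))"
      by (intro sum_mono mult_right_mono \<beta> nn k)
    finally show "\<beta> k * (\<Sum>p\<in>P k. \<Sum>A\<in>ext_dom p. f A * f (insert p A)) \<le> (\<Sum>p\<in>P k. b p * (\<Sum>A\<in>ext_dom p. f A * f (insert p A)))" .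
  qed
  also have "\<dots> = (\<Sum>p\<in>(\<Union>k\<in>I. P k). b p * (\<Sum>A\<in>ext_dom p. f A * f (insert p A)))"
    by (rule sum.UNION_disjoint[symmetric]) (use I P disj in auto)
  finally show ?thesis .
qed

end

section \<open>Choice of the blocks\<close>

text \<open>The n-th term of the series for exp n gives n^n / n! \<le> e^n; hence N choose n \<le>
  N^n / n! \<le> (e N / n)^n.\<close>

lemma binomial_le_exp:
  assumes "1 \<le> n" "n \<le> N"
  shows "real (N choose n) \<le> exp (real n * (1 + ln (real N / real n)))"
proof -
  have "real n ^ n / fact n \<le> exp (real n)"
  proof -
    have "(\<Sum>k\<in>{n}. real n ^ k /\<^sub>R fact k) \<le> (\<Sum>k. real n ^ k /\<^sub>R fact k)"
      by (intro sum_le_suminf summable_exp_generic) auto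
    then show ?thesis by (simp add: exp_def field_simps)
  qed
  then have f: "real n ^ n \<le> exp (real n) * fact n" by (simp add: field_simps)
  have "real (N choose n) * fact n \<le> real N ^ n"
    using binomial_fact_pow[of N n] by (metis of_nat_fact of_nat_le_iff of_nat_mult of_nat_power)
  then have "real (N choose n) * fact n * real n ^ n \<le> real N ^ n * (exp (real n) * fact n)"
    using f by (intro mult_mono) auto
  then have "real (N choose n) * real n ^ n \<le> real N ^ n * exp (real n)" by (simp add: mult_ac)
  then have "real (N choose n) \<le> exp (real n) * (real N / real n) ^ n"
    using assms by (simp add: power_divide field_simps)
  also have "(real N / real n) ^ n = exp (real n * ln (real N / real n))"
    using assms by (simp add: exp_of_nat_mult)
  finally show ?thesis by (simp add: exp_add distrib_left)
qed

lemma sum_inverse_squares_le: "(\<Sum>k=1..K. 1 / (real k)\<^sup>2) \<le> 2"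
proof (cases "K \<ge> 1")
  case True
  then have "(\<Sum>k=1..K. 1 / (real k)\<^sup>2) \<le> 2 - 1 / real K"
  proof (induction K rule: nat_induct_at_least)
    case (Suc K)
    have "1 / (real (Suc K))\<^sup>2 \<le> 1 / (real K * real (Suc K))"
      using Suc(1) by (intro divide_left_mono) (auto simp: power2_eq_square)
    also have "\<dots> = 1 / real K - 1 / real (Suc K)" using Suc(1) by (simp add: field_simps)
    finally show ?case using Suc.IH by simp
  qed simp
  then show ?thesis by (smt (verit) divide_nonneg_nonneg of_nat_0_le_iff)
qed simp

lemma harm_le_ln: "n \<ge> 1 \<Longrightarrow> harm n \<le> 1 + ln (real n)"
proof -
  assume "n \<ge> 1"
  then obtain m where m: "n = Suc m" by (cases n) auto
  have "harm (Suc m) - ln (real (Suc m)) \<le> harm (Suc 0) - ln (real (Suc 0))"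
    using decseq_harm_diff_ln by (rule decseqD) simp
  then show ?thesis by (simp add: m harm_expand)
qed

text \<open>Block \<open>k\<close> consists of the primes with indices in \<open>[W 2\<^sup>k, W 2\<^sup>k\<^sup>+\<^sup>1)\<close>, and the resonator uses about
  \<open>X / (k\<^sup>2 log log X)\<close> of them. The blocks contribute like \<open>1/k\<close>, and this harmonic sum over
  \<open>k \<le> (log X)\<^sup>1\<^sup>/\<^sup>2\<close> produces the additional factor \<open>log log X\<close>, whereas the cost of the binomial coefficients is again only
  \<open>\<Sum> k \<cdot> X / (k\<^sup>2 log log X) \<le> X\<close>.\<close>
lemma resonator_exists:
  assumes \<kappa>: "\<kappa> > 0"
  obtains c where "c > 0"
    "eventually (\<lambda>X. \<exists>I P n \<beta>. resonator I P n \<and> real (card (resonator.M I P n)) \<le> exp (\<kappa> * X) \<and>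
       (\<forall>k\<in>I. \<forall>p\<in>P k. prime p \<and> X \<le> real p \<and> ln (real p) \<le> 2 * ln X \<and> \<beta> k \<le> 1 / sqrt (real p)) \<and>
       c * sqrt (X * ln (ln X) / ln X) \<le> (\<Sum>k\<in>I. \<beta> k * (sqrt (real (n k) * real (card (P k) - n k + 1)) / 2))) at_top"
proof -
  \<comment> \<open>\<open>2 * \<alpha> \<le> \<kappa>\<close> closes the count of the support, and
    \<alpha> \<le> 1 keeps \<open>n k\<close> below X/2.\<close>
  define \<alpha> where "\<alpha> = min \<kappa> 1 / 2"
  have \<alpha>: "0 < \<alpha>" "\<alpha> \<le> 1" "2 * \<alpha> \<le> \<kappa>" using \<kappa> by (auto simp: \<alpha>_def)
  obtain i0 where i0: "\<And>i. i \<ge> i0 \<Longrightarrow> real (nth_pr i) \<le> 20 * real i * ln (real i)"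
    using nth_pr_upper by (auto simp: eventually_at_top_linorder)
  \<comment> \<open>The square root collects the lower bounds for one block: 1/2 from
    \<open>n k\<close>, 1/2 from the number of free primes, 1/120 from the square of
    \<open>\<beta> k\<close>. The 1/4 is the resonance factor 1/2 times the 1/2 from the harmonic
    sum.\<close>
  define c where "c = sqrt (\<alpha> / 480) / 4"
  define A where "A = ln (4 / \<alpha>)"
  have ev: "eventually (\<lambda>X::real. X \<ge> real i0 \<and> X \<ge> 4 \<and> ln X \<ge> 1 \<and> ln (ln X) \<ge> 2 \<and> \<alpha> * X / (ln X * ln (ln X)) \<ge> 2 \<and>
      ln (2 * X) + (sqrt (ln X) + 1) \<le> 3/2 * ln X \<and> ln 120 + sqrt (ln X) + ln X + ln (ln X) \<le> 2 * ln X \<and>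
      3 / ln (ln X) + 2 * (1 + ln (ln (ln X)) + A) / ln (ln X) \<le> 1/2 \<and> 1 + ln (ln (ln X)) + A \<ge> 0) at_top"
    using \<alpha>(1) by (intro eventually_conj eventually_ge_at_top; real_asymp)
  show ?thesis
  proof (rule that[of c])
    show "c > 0" using \<alpha> by (simp add: c_def)
    show "eventually (\<lambda>X. \<exists>I P n \<beta>. resonator I P n \<and> real (card (resonator.M I P n)) \<le> exp (\<kappa> * X) \<and>
       (\<forall>k\<in>I. \<forall>p\<in>P k. prime p \<and> X \<le> real p \<and> ln (real p) \<le> 2 * ln X \<and> \<beta> k \<le> 1 / sqrt (real p)) \<and>
       c * sqrt (X * ln (ln X) / ln X) \<le> (\<Sum>k\<in>I. \<beta> k * (sqrt (real (n k) * real (card (P k) - n k + 1)) / 2))) at_top"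
      using ev
    proof (rule eventually_mono)
      fix X :: real
      define l2 where "l2 = ln X"
      define l3 where "l3 = ln l2"
      assume "X \<ge> real i0 \<and> X \<ge> 4 \<and> ln X \<ge> 1 \<and> ln (ln X) \<ge> 2 \<and> \<alpha> * X / (ln X * ln (ln X)) \<ge> 2 \<and>
        ln (2 * X) + (sqrt (ln X) + 1) \<le> 3/2 * ln X \<and> ln 120 + sqrt (ln X) + ln X + ln (ln X) \<le> 2 * ln X \<and>
        3 / ln (ln X) + 2 * (1 + ln (ln (ln X)) + A) / ln (ln X) \<le> 1/2 \<and> 1 + ln (ln (ln X)) + A \<ge> 0"
      then have X: "X \<ge> real i0" "X \<ge> 4" "l2 \<ge> 1" "l3 \<ge> 2" "\<alpha> * X / (l2 * l3) \<ge> 2" "ln (2 * X) + (sqrt l2 + 1) \<le> 3/2 * l2"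
        "ln 120 + sqrt l2 + l2 + l3 \<le> 2 * l2" "3 / l3 + 2 * (1 + ln l3 + A) / l3 \<le> 1/2" "1 + ln l3 + A \<ge> 0"
        by (auto simp: l2_def l3_def)
      define W where "W = nat \<lceil>X\<rceil>"
      have W: "X \<le> real W" "real W \<le> X + 1" "W \<ge> 1" "W \<ge> i0" using X(1,2) unfolding W_def by linarith+
      \<comment> \<open>Stopping at the square root of ln X keeps \<open>2 ^ k\<close> below every
        fixed power of X, so that all primes obey ln p \<le> 2 ln X, while the harmonic sum up to K
        is still at least (ln (ln X)) / 2.\<close>
      define K where "K = nat \<lfloor>sqrt l2\<rfloor>"
      have K: "real K \<le> sqrt l2" "sqrt l2 \<le> real K + 1" "K \<ge> 1"
      proof -
        have "1 \<le> sqrt l2" using X(3) by simp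
        then show "real K \<le> sqrt l2" "sqrt l2 \<le> real K + 1" "K \<ge> 1" unfolding K_def by linarith+
      qed
      define I where "I = {1..K}"
      define P where "P k = nth_pr ` {W * 2 ^ k..<W * 2 ^ Suc k}" for k
      define n where "n k = nat \<lfloor>\<alpha> * X / ((real k)\<^sup>2 * l3)\<rfloor>" for k
      \<comment> \<open>Lower bound for the reciprocal root of a prime in block k: p \<le> 20 i ln i
        with i at most 4 * 2^k X and ln i at most 3/2 ln X, and 20 * 4 * 3/2 = 120.\<close>
      define \<beta> where "\<beta> k = 1 / sqrt (120 * 2 ^ k * X * l2)" for k :: nat
      have cP: "card (P k) = W * 2 ^ k" for k
        unfolding P_def by (subst card_image) (auto intro: inj_on_subset[OF nth_pr_inj])
      have kK: "1 \<le> k" "real k \<le> sqrt l2" "(real k)\<^sup>2 \<le> l2" if "k \<in> I" for k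
      proof -
        show k1: "1 \<le> k" using that by (simp add: I_def)
        show k2: "real k \<le> sqrt l2" using that K(1) by (auto simp: I_def intro: order_trans)
        show "(real k)\<^sup>2 \<le> l2" using power_mono[OF k2, of 2] X(3) by simp
      qed
      have y2: "\<alpha> * X / ((real k)\<^sup>2 * l3) \<ge> 2" if "k \<in> I" for k
      proof -
        have "2 \<le> \<alpha> * X / (l2 * l3)" by (rule X(5))
        also have "\<dots> \<le> \<alpha> * X / ((real k)\<^sup>2 * l3)"
          using kK[OF that] X \<alpha> by (intro divide_left_mono mult_right_mono mult_pos_pos) auto
        finally show ?thesis .
      qed
      have fl: "y / 2 \<le> real (nat \<lfloor>y\<rfloor>)" "1 \<le> nat \<lfloor>y\<rfloor>" "real (nat \<lfloor>y\<rfloor>) \<le> y" if "2 \<le> y" for y :: real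
        using that by linarith+
      have nlow: "real (n k) \<ge> \<alpha> * X / ((real k)\<^sup>2 * l3) / 2" "n k \<ge> 1" if "k \<in> I" for k
        unfolding n_def by (rule fl[OF y2[OF that]])+
      have nup: "real (n k) \<le> \<alpha> * X / ((real k)\<^sup>2 * l3)" if "k \<in> I" for k
        unfolding n_def by (rule fl[OF y2[OF that]])
      have nX: "real (n k) \<le> X / 2" if "k \<in> I" for k
      proof -
        have "\<alpha> * X / ((real k)\<^sup>2 * l3) \<le> 1 * X / (1 * 2)"
          using kK[OF that] X \<alpha> by (intro frac_le mult_mono) (auto simp: one_le_power)
        then have "real (n k) \<le> 1 * X / (1 * 2)" by (rule order_trans[OF nup[OF that]])
        then show ?thesis by simp
      qed
      have wge: "real (card (P k)) \<ge> 2 ^ k * X" "real (card (P k)) \<ge> X" for k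
      proof -
        show a: "real (card (P k)) \<ge> 2 ^ k * X" using W(1) by (simp add: cP mult.commute)
        have "X * 1 \<le> X * 2 ^ k" using X(2) by (intro mult_left_mono) auto
        then show "real (card (P k)) \<ge> X" using a by (simp add: mult.commute)
      qed
      have ncard: "n k \<le> card (P k)" if "k \<in> I" for k
        using nX[OF that] wge(2)[of k] X(2) by linarith
      interpret resonator I P n
      proof
        show "P j \<inter> P k = {}" if "j \<in> I" "k \<in> I" "j \<noteq> k" for j k
        proof -
          have aux: "P j \<inter> P k = {}" if "j < k" for j k
          proof -
            have "W * 2 ^ Suc j \<le> W * 2 ^ k" using that by (intro mult_left_mono power_increasing) auto
            then have "{W * 2 ^ j..<W * 2 ^ Suc j} \<inter> {W * 2 ^ k..<W * 2 ^ Suc k} = {}" by (auto simp del: power_Suc)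
            then show ?thesis unfolding P_def image_Int[OF nth_pr_inj, symmetric] by simp
          qed
          show ?thesis using aux[of j k] aux[of k j] \<open>j \<noteq> k\<close> by (metis Int_commute nat_neq_iff)
        qed
        show "1 \<le> n k \<and> n k \<le> card (P k)" if "k \<in> I" for k using nlow(2)[OF that] ncard[OF that] by simp
      qed (auto simp: I_def P_def)
      have pr: "prime p \<and> X \<le> real p \<and> ln (real p) \<le> 2 * ln X \<and> \<beta> k \<le> 1 / sqrt (real p)" if k: "k \<in> I" and p: "p \<in> P k" for k p
      proof -
        obtain i where i: "p = nth_pr i" "W * 2 ^ k \<le> i" "i < W * 2 ^ Suc k" using p by (auto simp: P_def)
        have "W * 1 \<le> W * 2 ^ k" by (intro mult_left_mono) auto
        then have iW: "i \<ge> W" using i(2) by linarith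
        have "real i < real (W * 2 ^ Suc k)" using i(3) by (simp only: of_nat_less_iff)
        then have i2: "real i \<le> real W * 2 ^ Suc k" by simp
        also have "\<dots> \<le> (2 * X) * 2 ^ Suc k" using W(2) X(2) by (intro mult_right_mono) auto
        finally have i3: "real i \<le> 4 * 2 ^ k * X" by (simp add: mult_ac)
        have lni: "ln (real i) \<le> 3/2 * l2"
        proof -
          have "ln (real i) \<le> ln ((2 * X) * 2 ^ Suc k)" using iW W(3) i3 X(2) by (subst ln_le_cancel_iff) (auto simp: mult_ac)
          also have "\<dots> = ln (2 * X) + real (Suc k) * ln 2" using X(2) by (subst ln_mult) (auto simp: ln_realpow simp del: power_Suc)
          also have "\<dots> \<le> ln (2 * X) + real (Suc k) * 1" using ln_le_minus_one[of "2::real"] by (intro add_left_mono mult_left_mono) auto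
          also have "\<dots> \<le> 3/2 * l2" using X(6) kK(2)[OF k] by simp
          finally show ?thesis .
        qed
        have lni0: "0 \<le> ln (real i)" using iW W(3) by simp
        have "real p \<le> 20 * real i * ln (real i)" unfolding i(1) using i0 iW W(4) by auto
        also have "\<dots> \<le> 20 * (4 * 2 ^ k * X) * (3/2 * l2)" using i3 lni lni0 X(2) by (intro mult_mono) auto
        finally have pub: "real p \<le> 120 * 2 ^ k * X * l2" by (simp add: mult_ac)
        have pX: "X \<le> real p" using nth_pr_ge[of i] iW W(1) unfolding i(1) by linarith
        have "ln (real p) \<le> ln (120 * 2 ^ k * X * l2)" using pub pX X by (subst ln_le_cancel_iff) auto
        also have "\<dots> = ln 120 + real k * ln 2 + ln X + ln l2" using X by (simp add: ln_mult ln_realpow)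
        also have "\<dots> \<le> ln 120 + real k * 1 + ln X + ln l2"
          using ln_le_minus_one[of "2::real"] by (intro add_mono mult_left_mono) auto
        also have "\<dots> \<le> 2 * ln X" using X(7) kK(2)[OF k] by (simp add: l2_def[symmetric] l3_def[symmetric])
        finally have "ln (real p) \<le> 2 * ln X" .
        moreover have "\<beta> k \<le> 1 / sqrt (real p)" unfolding \<beta>_def using pub pX X(2,3) by (intro divide_left_mono real_sqrt_le_mono mult_pos_pos) auto
        ultimately show ?thesis using pX nth_pr_prime[of i] by (simp add: i(1))
      qed
      have cardM: "real (card M) \<le> exp (\<kappa> * X)"
      proof -
        have "real (card M) \<le> real (\<Prod>k\<in>I. (card (P k) choose (n k - 1)) + (card (P k) choose n k))"
          using card_M_le by (simp only: of_nat_le_iff)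
        \<comment> \<open>Pascal's rule merges the two levels of a block.\<close>
        also have "\<dots> = (\<Prod>k\<in>I. real (Suc (card (P k)) choose n k))"
        proof -
          have "(card (P k) choose (n k - 1)) + (card (P k) choose n k) = Suc (card (P k)) choose n k" if "k \<in> I" for k
            using nlow(2)[OF that] by (cases "n k") auto
          then show ?thesis by simp
        qed
        also have "\<dots> \<le> (\<Prod>k\<in>I. exp (\<alpha> * X / l3 * (3 * (1 / real k) + (1 + ln l3 + A) * (1 / (real k)\<^sup>2))))"
        proof (rule prod_mono, intro conjI)
          fix k assume k: "k \<in> I"
          note k' = kK[OF k]
          have n1: "n k \<ge> 1" by (rule nlow(2)[OF k])
          have "real (Suc (card (P k)) choose n k) \<le> exp (real (n k) * (1 + ln (real (Suc (card (P k))) / real (n k))))"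
            by (rule binomial_le_exp) (use n1 ncard[OF k] in auto)
          also have "\<dots> \<le> exp ((\<alpha> * X / ((real k)\<^sup>2 * l3)) * (3 * real k + (1 + ln l3 + A)))"
          proof -
            \<comment> \<open>The logarithm of this ratio is at most 3 k plus terms of lower order,
              since k ln 2 \<le> k and 2 ln k \<le> 2 k. The factor k is compensated by the square
              of k in the denominator of \<open>n k\<close>.\<close>
            have r: "real (Suc (card (P k))) / real (n k) \<le> 4 * 2 ^ k * (real k)\<^sup>2 * l3 / \<alpha>"
            proof -
              have "real (Suc (card (P k))) \<le> 2 ^ k * (2 * X)"
              proof -
                have "real (Suc (card (P k))) = real W * 2 ^ k + 1" by (simp add: cP)
                also have "\<dots> \<le> (X + 1) * 2 ^ k + 1 * 2 ^ k" using W(2) by (intro add_mono mult_right_mono) auto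
                also have "\<dots> = 2 ^ k * (X + 2)" by (simp add: algebra_simps)
                also have "\<dots> \<le> 2 ^ k * (2 * X)" using X(2) by (intro mult_left_mono) auto
                finally show ?thesis .
              qed
              moreover have "\<alpha> * X / ((real k)\<^sup>2 * l3) / 2 > 0" using \<alpha> X k' by (intro divide_pos_pos mult_pos_pos) auto
              ultimately have "real (Suc (card (P k))) / real (n k) \<le> 2 ^ k * (2 * X) / (\<alpha> * X / ((real k)\<^sup>2 * l3) / 2)"
                using nlow(1)[OF k] X(2) by (intro frac_le) auto
              also have "\<dots> = 4 * 2 ^ k * (real k)\<^sup>2 * l3 / \<alpha>" using \<alpha> X k' by (simp add: field_simps)
              finally show ?thesis .
            qed
            have "ln (real (Suc (card (P k))) / real (n k)) \<le> ln (4 * 2 ^ k * (real k)\<^sup>2 * l3 / \<alpha>)"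
              using r n1 \<alpha> X k' by (subst ln_le_cancel_iff) (auto intro!: divide_pos_pos mult_pos_pos)
            also have "\<dots> = A + real k * ln 2 + 2 * ln (real k) + ln l3"
              using \<alpha> X k' by (simp add: A_def ln_mult ln_div ln_realpow)
            also have "\<dots> \<le> A + real k * 1 + 2 * real k + ln l3"
              using ln_le_minus_one[of "2::real"] ln_le_minus_one[of "real k"] k' by (intro add_mono mult_left_mono) auto
            finally have "1 + ln (real (Suc (card (P k))) / real (n k)) \<le> 3 * real k + (1 + ln l3 + A)" by simp
            moreover have "0 \<le> 3 * real k + (1 + ln l3 + A)" using X(9) by simp
            ultimately have "real (n k) * (1 + ln (real (Suc (card (P k))) / real (n k))) \<le> (\<alpha> * X / ((real k)\<^sup>2 * l3)) * (3 * real k + (1 + ln l3 + A))"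
              using nup[OF k] by (meson mult_left_mono mult_right_mono of_nat_0_le_iff order_trans)
            then show ?thesis by simp
          qed
          also have "(\<alpha> * X / ((real k)\<^sup>2 * l3)) * (3 * real k + (1 + ln l3 + A)) = \<alpha> * X / l3 * (3 * (1 / real k) + (1 + ln l3 + A) * (1 / (real k)\<^sup>2))"
            using k' X by (simp add: field_simps power2_eq_square)
          finally show "real (Suc (card (P k)) choose n k) \<le> exp (\<alpha> * X / l3 * (3 * (1 / real k) + (1 + ln l3 + A) * (1 / (real k)\<^sup>2)))" .
        qed simp
        also have "\<dots> = exp (\<Sum>k\<in>I. \<alpha> * X / l3 * (3 * (1 / real k) + (1 + ln l3 + A) * (1 / (real k)\<^sup>2)))"
          by (rule exp_sum[symmetric]) (simp add: I_def)
        also have "(\<Sum>k\<in>I. \<alpha> * X / l3 * (3 * (1 / real k) + (1 + ln l3 + A) * (1 / (real k)\<^sup>2)))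
            = \<alpha> * X / l3 * (3 * (\<Sum>k\<in>I. 1 / real k) + (1 + ln l3 + A) * (\<Sum>k\<in>I. 1 / (real k)\<^sup>2))"
          by (simp only: sum_distrib_left[symmetric] sum.distrib)
        also have "exp (\<dots>) \<le> exp (\<alpha> * X / l3 * (3 * (1 + l3 / 2) + (1 + ln l3 + A) * 2))"
        proof -
          have "(\<Sum>k\<in>I. 1 / real k) \<le> 1 + l3 / 2"
          proof -
            have "(\<Sum>k\<in>I. 1 / real k) = harm K" by (simp add: I_def harm_def inverse_eq_divide)
            also have "\<dots> \<le> 1 + ln (real K)" by (rule harm_le_ln[OF K(3)])
            also have "ln (real K) \<le> ln (sqrt l2)" using K X(3) by (subst ln_le_cancel_iff) auto
            also have "ln (sqrt l2) = l3 / 2" using X(3) by (simp add: ln_sqrt l3_def)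
            finally show ?thesis by simp
          qed
          then have "3 * (\<Sum>k\<in>I. 1 / real k) + (1 + ln l3 + A) * (\<Sum>k\<in>I. 1 / (real k)\<^sup>2) \<le> 3 * (1 + l3 / 2) + (1 + ln l3 + A) * 2"
            using sum_inverse_squares_le[of K] X(9) unfolding I_def by (intro add_mono mult_left_mono) auto
          moreover have "0 \<le> \<alpha> * X / l3" using \<alpha> X by simp
          ultimately have "\<alpha> * X / l3 * (3 * (\<Sum>k\<in>I. 1 / real k) + (1 + ln l3 + A) * (\<Sum>k\<in>I. 1 / (real k)\<^sup>2)) \<le> \<alpha> * X / l3 * (3 * (1 + l3 / 2) + (1 + ln l3 + A) * 2)"
            by (rule mult_left_mono)
          then show ?thesis by (simp only: exp_le_cancel_iff)
        qed
        \<comment> \<open>The term 3/2 comes from the harmonic sum, whose size l3 / 2 cancels the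
          division by l3; the remaining terms are at most 1/2 for large X.\<close>
        also have "\<alpha> * X / l3 * (3 * (1 + l3 / 2) + (1 + ln l3 + A) * 2) = \<alpha> * X * (3/2 + (3 / l3 + 2 * (1 + ln l3 + A) / l3))"
        proof -
          have "\<alpha> * X / l3 * (3 * (1 + l3 / 2) + Q * 2) = \<alpha> * X * (3/2 + (3 / l3 + 2 * Q / l3))" for Q
            using X(4) by (simp add: field_simps)
          then show ?thesis .
        qed
        also have "exp (\<dots>) \<le> exp (\<alpha> * X * 2)" 
        proof -
          have "3/2 + (3 / l3 + 2 * (1 + ln l3 + A) / l3) \<le> 2" using X(8) by linarith
          moreover have "0 \<le> \<alpha> * X" using \<alpha> X by simp
          ultimately have "\<alpha> * X * (3/2 + (3 / l3 + 2 * (1 + ln l3 + A) / l3)) \<le> \<alpha> * X * 2" by (rule mult_left_mono)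
          then show ?thesis by (simp only: exp_le_cancel_iff)
        qed
        also have "\<dots> \<le> exp (\<kappa> * X)" using \<alpha>(3) X(2) by simp
        finally show ?thesis .
      qed
      have main: "c * sqrt (X * ln (ln X) / ln X) \<le> (\<Sum>k\<in>I. \<beta> k * (sqrt (real (n k) * real (card (P k) - n k + 1)) / 2))"
      proof -
        \<comment> \<open>Block k contributes at least s / (2 k): the power \<open>2 ^ k\<close>
          cancels between \<open>\<beta> k\<close> and the number of free primes.\<close>
        define s where "s = sqrt (\<alpha> * X / (480 * l2 * l3))"
        have "l3 / 2 = ln (sqrt l2)" using X(3) by (simp add: ln_sqrt l3_def)
        also have "\<dots> \<le> ln (real K + 1)" using K X(3) by (subst ln_le_cancel_iff) auto
        also have "\<dots> \<le> harm K" by (rule ln_le_harm)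
        finally have hK: "l3 / 2 \<le> (\<Sum>k\<in>I. 1 / real k)" by (simp add: I_def harm_def inverse_eq_divide)
        have "c * sqrt (X * l3 / l2) = s * (l3 / 2) / 2"
        proof -
          have "sqrt (\<alpha> / 480) * sqrt (X * l3 / l2) = sqrt (\<alpha> * X / (480 * l2 * l3) * l3\<^sup>2)"
            unfolding real_sqrt_mult[symmetric] using X by (simp add: field_simps power2_eq_square)
          also have "\<dots> = s * l3" unfolding real_sqrt_mult s_def using X(4) by simp
          finally show ?thesis by (simp add: c_def)
        qed
        also have "\<dots> \<le> s * (\<Sum>k\<in>I. 1 / real k) / 2"
          using hK \<alpha> X by (intro divide_right_mono mult_left_mono) (auto simp: s_def)
        also have "\<dots> = (\<Sum>k\<in>I. s * (1 / real k) / 2)" by (simp add: sum_distrib_left sum_divide_distrib)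
        also have "\<dots> \<le> (\<Sum>k\<in>I. \<beta> k * (sqrt (real (n k) * real (card (P k) - n k + 1)) / 2))"
        proof (rule sum_mono)
          fix k assume k: "k \<in> I"
          note k' = kK[OF k]
          have pos: "0 < 120 * 2 ^ k * X * l2" using X by simp
          have w2: "real (card (P k) - n k + 1) \<ge> 2 ^ k * X / 2"
          proof -
            have "(2::real) ^ k \<ge> 1" by simp
            then have "X / 2 \<le> 2 ^ k * X / 2" using X(2) mult_right_mono[of 1 "2 ^ k" X] by simp
            then have "real (card (P k)) - real (n k) \<ge> 2 ^ k * X / 2" using wge(1)[of k] nX[OF k] by linarith
            then show ?thesis using ncard[OF k] by (simp add: of_nat_diff)
          qed
          have "s * (1 / real k) = sqrt (\<alpha> * X / (480 * l2 * l3) * (1 / (real k)\<^sup>2))"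
            unfolding s_def real_sqrt_mult by (simp add: real_sqrt_divide)
          also have "\<alpha> * X / (480 * l2 * l3) * (1 / (real k)\<^sup>2) = (\<alpha> * X / ((real k)\<^sup>2 * l3) / 2) * (2 ^ k * X / 2) / (120 * 2 ^ k * X * l2)"
            using X k' by (simp add: field_simps)
          also have "sqrt \<dots> \<le> sqrt (real (n k) * real (card (P k) - n k + 1) / (120 * 2 ^ k * X * l2))"
          proof (intro real_sqrt_le_mono divide_right_mono mult_mono)
            show "\<alpha> * X / ((real k)\<^sup>2 * l3) / 2 \<le> real (n k)" by (rule nlow(1)[OF k])
            show "2 ^ k * X / 2 \<le> real (card (P k) - n k + 1)" by (rule w2)
          qed (use X pos in auto)
          also have "\<dots> = \<beta> k * sqrt (real (n k) * real (card (P k) - n k + 1))"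
            by (simp add: \<beta>_def real_sqrt_divide)
          finally show "s * (1 / real k) / 2 \<le> \<beta> k * (sqrt (real (n k) * real (card (P k) - n k + 1)) / 2)" by simp
        qed
        finally show ?thesis by (simp add: l2_def l3_def)
      qed
      show "\<exists>I P n \<beta>. resonator I P n \<and> real (card (resonator.M I P n)) \<le> exp (\<kappa> * X) \<and>
       (\<forall>k\<in>I. \<forall>p\<in>P k. prime p \<and> X \<le> real p \<and> ln (real p) \<le> 2 * ln X \<and> \<beta> k \<le> 1 / sqrt (real p)) \<and>
       c * sqrt (X * ln (ln X) / ln X) \<le> (\<Sum>k\<in>I. \<beta> k * (sqrt (real (n k) * real (card (P k) - n k + 1)) / 2))"
        using resonator_axioms cardM pr main by (intro exI[of _ I] exI[of _ P] exI[of _ n] exI[of _ \<beta>]) blast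
    qed
  qed
qed

section \<open>The functions S and S1 on the critical line\<close>

text \<open>The values of d are multiples of 2 pi i, hence at distance at least 1 from each other
  when distinct.\<close>

lemma exp_eq_1_constant:
  fixes d :: "'a::topological_space \<Rightarrow> complex"
  assumes U: "connected U" and d: "continuous_on U d" and e: "\<And>x. x \<in> U \<Longrightarrow> exp (d x) = 1"
  shows "d constant_on U"
proof (rule continuous_discrete_range_constant[OF U d])
  fix x assume x: "x \<in> U"
  have "1 \<le> norm (d y - d x)" if y: "y \<in> U" "d y \<noteq> d x" for y
  proof -
    have "exp (d y - d x) = 1" using e[OF x] e[OF y(1)] by (simp add: exp_diff)
    then obtain n :: int where n: "Re (d y - d x) = 0" "Im (d y - d x) = of_int (2 * n) * pi" unfolding exp_eq_1 by blast
    have "n \<noteq> 0" using n y(2) by (auto simp: complex_eq_iff)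
    then have "1 \<le> \<bar>real_of_int n\<bar>" by linarith
    then have "1 * 1 \<le> \<bar>real_of_int n\<bar> * (2 * pi)" using pi_gt3 by (intro mult_mono) auto
    then have "1 \<le> \<bar>Im (d y - d x)\<bar>" unfolding n(2) by (simp add: abs_mult mult_ac)
    then show ?thesis using abs_Im_le_cmod[of "d y - d x"] by linarith
  qed
  then show "\<exists>e>0. \<forall>y. y \<in> U \<and> d y \<noteq> d x \<longrightarrow> e \<le> norm (d y - d x)" by (intro exI[of _ 1]) auto
qed

lemma plog_continuous:
  assumes "\<And>s. s \<in> A \<Longrightarrow> Im s > 0 \<or> Re s > 1"
  shows "continuous_on A plog"
  unfolding plog_def[abs_def] by (intro continuous_intros) (use assms in \<open>auto simp: complex_nonpos_Reals_iff dest!: assms\<close>)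

lemma Im_plog_bound:
  assumes "s \<noteq> 1" "s \<noteq> -1" "s \<noteq> 0"
  shows "\<bar>Im (plog s)\<bar> \<le> 4 * pi"
proof -
  have b: "\<bar>Im (Ln z)\<bar> \<le> pi" if "z \<noteq> 0" for z using mpi_less_Im_Ln[OF that] Im_Ln_le_pi[OF that] by linarith
  have "s - 1 \<noteq> 0" "s + 1 \<noteq> 0" using assms by (auto simp: add_eq_0_iff2)
  then show ?thesis using b[of "s - 1"] b[of "s + 1"] b[of s] assms unfolding plog_def by simp
qed

lemma norm_plog_prim_upper_strip:
  assumes s: "1/2 < Re s" "Re s \<le> 2" "Im s \<ge> 1"
  shows "norm (plog_prim s) \<le> 50"
proof -
  let ?V = "{z. 1/2 \<le> Re z \<and> Re z \<le> 2 \<and> Im z = Im s}"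
  have cv: "convex ?V"
  proof -
    have eq: "?V = {z. Re z \<ge> 1/2} \<inter> {z. Re z \<le> 2} \<inter> ({z. Im z \<ge> Im s} \<inter> {z. Im z \<le> Im s})" by auto
    show ?thesis unfolding eq
      by (intro convex_Int convex_halfspace_Re_ge convex_halfspace_Re_le convex_halfspace_Im_ge convex_halfspace_Im_le)
  qed
  have pb: "norm (plog z) \<le> 20" if z: "z \<in> ?V" for z
  proof -
    define y where "y = Im s"
    have y: "y \<ge> 1" using s by (simp add: y_def)
    have nz: "z \<noteq> 1" "z \<noteq> -1" "z \<noteq> 0" using z s by auto
    have lo: "norm (z - 1) \<ge> y" "norm (z + 1) \<ge> y" "norm z \<ge> y"
      using abs_Im_le_cmod[of "z - 1"] abs_Im_le_cmod[of "z + 1"] abs_Im_le_cmod[of z] z y by (auto simp: y_def)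
    have up: "norm z ^ 2 \<le> 5 * y ^ 2"
    proof -
      have "(Re z)\<^sup>2 \<le> 2\<^sup>2" using z by (intro power_mono) auto
      moreover have "(1::real) ^ 2 \<le> y ^ 2" using y by (intro power_mono) auto
      ultimately show ?thesis using z by (simp add: cmod_power2 y_def)
    qed
    have n1: "norm (z - 1) \<le> 2 * norm z" "norm (z + 1) \<le> 2 * norm z"
      using norm_triangle_ineq4[of z 1] norm_triangle_ineq[of z 1] lo y by auto
    have "exp (Re (plog z)) = norm (z - 1) * norm (z + 1) / norm z ^ 2"
      using exp_plog[OF nz] by (metis norm_divide norm_exp_eq_Re norm_mult norm_power)
    moreover have "1/5 \<le> norm (z - 1) * norm (z + 1) / norm z ^ 2"
    proof -
      have "norm z ^ 2 \<le> 5 * (norm (z - 1) * norm (z + 1))"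
        using up mult_mono[OF lo(1,2)] y by (simp add: power2_eq_square)
      then show ?thesis using nz by (simp add: field_simps)
    qed
    moreover have "norm (z - 1) * norm (z + 1) / norm z ^ 2 \<le> 4"
    proof -
      have "norm (z - 1) * norm (z + 1) \<le> (2 * norm z) * (2 * norm z)" by (intro mult_mono n1) auto
      then show ?thesis using nz by (simp add: field_simps power2_eq_square)
    qed
    ultimately have e: "1/5 \<le> exp (Re (plog z))" "exp (Re (plog z)) \<le> 4" by auto
    have "Re (plog z) \<le> 2"
    proof (rule ccontr)
      assume "\<not> Re (plog z) \<le> 2"
      then have "exp 2 < exp (Re (plog z))" by simp
      moreover have "(4::real) \<le> exp 2"
      proof -
        have "(2::real) \<le> exp 1" using exp_ge_add_one_self[of "1::real"] by simp
        then have "2 * 2 \<le> exp 1 * exp (1::real)" by (intro mult_mono) auto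
        then show ?thesis by (simp add: mult_exp_exp)
      qed
      ultimately show False using e by linarith
    qed
    moreover have "Re (plog z) \<ge> - 4"
    proof (rule ccontr)
      assume "\<not> Re (plog z) \<ge> - 4"
      then have "exp (Re (plog z)) < exp (- 4)" by simp
      moreover have "exp (- 4) \<le> (1/5::real)" using exp_ge_add_one_self[of "4::real"] by (simp add: exp_minus field_simps)
      ultimately show False using e by linarith
    qed
    moreover have "\<bar>Im (plog z)\<bar> \<le> 16" using Im_plog_bound[OF nz] pi_less_4 by linarith
    ultimately show ?thesis using cmod_le[of "plog z"] by linarith
  qed
  have "norm (plog_prim s - plog_prim (Complex 2 (Im s))) \<le> 20 * norm (s - Complex 2 (Im s))"
  proof (rule field_differentiable_bound[OF cv])
    fix z assume z: "z \<in> ?V"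
    show "(plog_prim has_field_derivative plog z) (at z within ?V)"
      by (rule has_field_derivative_at_within, rule plog_prim_has_field_derivative) (use z s in \<open>auto simp: complex_nonpos_Reals_iff\<close>)
    show "norm (plog z) \<le> 20" by (rule pb[OF z])
  qed (use s in auto)
  moreover have "norm (s - Complex 2 (Im s)) \<le> 2"
  proof -
    have "s - Complex 2 (Im s) = of_real (Re s - 2)" by (simp add: complex_eq_iff)
    then have "norm (s - Complex 2 (Im s)) = \<bar>Re s - 2\<bar>" by (metis norm_of_real)
    then show ?thesis using s by simp
  qed
  moreover have "norm (plog_prim (Complex 2 (Im s))) \<le> 4"
  proof -
    have "norm (Complex 2 (Im s)) \<ge> 2" using abs_Re_le_cmod[of "Complex 2 (Im s)"] by simp
    then have "8 / norm (Complex 2 (Im s)) \<le> 8 / 2" by (intro divide_left_mono) auto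
    then show ?thesis using norm_plog_prim_le[of "Complex 2 (Im s)"] by simp
  qed
  ultimately show ?thesis
    using norm_triangle_ineq[of "plog_prim s - plog_prim (Complex 2 (Im s))" "plog_prim (Complex 2 (Im s))"] by simp
qed

context zeta_log
begin

text \<open>This is log zeta itself. The singularity at 1 returns through \<open>plog\<close>,
  whence the restriction to the upper half-plane or to Re s > 1 below.\<close>

abbreviation Lh :: "complex \<Rightarrow> complex" where "Lh s \<equiv> Lt s - plog s"

lemma exp_Lh:
  assumes "1/2 < Re s" "Im s > 0 \<or> Re s > 1"
  shows "exp (Lh s) = riemann_zeta s"
proof -
  have nz: "s \<noteq> 1" "s \<noteq> -1" "s \<noteq> 0" using assms by auto
  have "s - 1 \<noteq> 0" "s + 1 \<noteq> 0" using nz by (auto simp: add_eq_0_iff2)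
  then show ?thesis using nz assms zeta_reg_eq[of s]
    by (simp add: exp_diff exp_Lt exp_plog)
qed

lemma zeta_reg_not_constant: "\<not> zeta_reg constant_on {s. 0 < Re s}" if "zeta_reg \<xi> = 0" "0 < Re \<xi>" for \<xi>
proof
  assume "zeta_reg constant_on {s. 0 < Re s}"
  then obtain c where c: "\<And>s. 0 < Re s \<Longrightarrow> zeta_reg s = c" by (auto simp: constant_on_def)
  have "zeta_reg 1 = 1" by (simp add: zeta_reg_def)
  then show False using c[of 1] c[of \<xi>] that by simp
qed

section \<open>Boundary behaviour at the critical line\<close>

text \<open>Dividing out a zero of order m at \<xi> leaves a nonvanishing function, which has a
  logarithm \<open>h\<close> across the critical line. For Re w > 1/2 the difference w - \<xi> has
  positive real part, so its principal logarithm is continuous there. The case m = 0 covers points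
  that are not zeros.\<close>

lemma Lt_boundary:
  assumes \<xi>: "Re \<xi> = 1/2"
  obtains r m h where "0 < r" "h holomorphic_on ball \<xi> r" "zeta_reg \<xi> \<noteq> 0 \<longrightarrow> m = 0"
    "\<And>w. w \<in> ball \<xi> r \<Longrightarrow> 1/2 < Re w \<Longrightarrow> Lt w = of_nat m * Ln (w - \<xi>) + h w"
    "\<And>w. w \<in> ball \<xi> r \<Longrightarrow> zeta_reg w * (w + 1) / w ^ 2 = (w - \<xi>) ^ m * exp (h w)"
proof -
  let ?H = "{s. 0 < Re s}"
  have H: "open ?H" "connected ?H" by (auto intro: open_halfspace_Re_gt convex_connected convex_halfspace_Re_gt)
  have \<xi>H: "\<xi> \<in> ?H" using \<xi> by simp
  have "\<exists>r m g. 0 < r \<and> ball \<xi> r \<subseteq> ?H \<and> g holomorphic_on ball \<xi> r \<and> (zeta_reg \<xi> \<noteq> 0 \<longrightarrow> m = 0) \<and>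
     (\<forall>w\<in>ball \<xi> r. zeta_reg w = (w - \<xi>) ^ m * g w \<and> g w \<noteq> 0)"
  proof (cases "zeta_reg \<xi> = 0")
    case True
    have nc: "\<not> zeta_reg constant_on ?H" using zeta_reg_not_constant[OF True] \<xi> by simp
    obtain g r m where "0 < m" "0 < r" "ball \<xi> r \<subseteq> ?H" "g holomorphic_on ball \<xi> r"
      "\<And>w. w \<in> ball \<xi> r \<Longrightarrow> zeta_reg w = (w - \<xi>) ^ m * g w" "\<And>w. w \<in> ball \<xi> r \<Longrightarrow> g w \<noteq> 0"
      by (rule holomorphic_factor_zero_nonconstant[OF zeta_reg_holomorphic H \<xi>H True nc]) (rule that)
    then show ?thesis using True by blast
  next
    case False
    have "continuous_on ?H zeta_reg" using zeta_reg_holomorphic by (rule holomorphic_on_imp_continuous_on)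
    then have "open (?H \<inter> zeta_reg -` (- {0}))" by (rule continuous_open_preimage[OF _ H(1)]) auto
    moreover have "?H \<inter> zeta_reg -` (- {0}) = {x \<in> ?H. zeta_reg x \<noteq> 0}" by auto
    ultimately have "open {x \<in> ?H. zeta_reg x \<noteq> 0}" by simp
    then obtain r where r: "0 < r" "ball \<xi> r \<subseteq> {x \<in> ?H. zeta_reg x \<noteq> 0}"
      using \<xi>H False open_contains_ball_eq by (metis (mono_tags, lifting) mem_Collect_eq)
    show ?thesis
      by (intro exI[of _ r] exI[of _ 0] exI[of _ zeta_reg])
         (use r in \<open>auto intro: holomorphic_on_subset[OF zeta_reg_holomorphic]\<close>)
  qed
  then obtain r m g where r: "0 < r" "ball \<xi> r \<subseteq> ?H" "g holomorphic_on ball \<xi> r" "zeta_reg \<xi> \<noteq> 0 \<longrightarrow> m = 0"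
    "\<And>w. w \<in> ball \<xi> r \<Longrightarrow> zeta_reg w = (w - \<xi>) ^ m * g w" "\<And>w. w \<in> ball \<xi> r \<Longrightarrow> g w \<noteq> 0" by blast
  let ?G = "\<lambda>w. g w * (w + 1) / w ^ 2"
  have pos: "w + 1 \<noteq> 0" "w \<noteq> 0" if "w \<in> ball \<xi> r" for w
  proof -
    have "0 < Re w" "0 < Re (w + 1)" using that r(2) by auto
    then show "w + 1 \<noteq> 0" "w \<noteq> 0" by (metis less_irrefl zero_complex.simps(1))+
  qed
  have Gh: "?G holomorphic_on ball \<xi> r" by (intro holomorphic_intros r(3)) (use pos in auto)
  have Gn: "?G w \<noteq> 0" if "w \<in> ball \<xi> r" for w using r(6)[OF that] pos[OF that] by simp
  obtain h0 where h0: "h0 holomorphic_on ball \<xi> r" "\<And>w. w \<in> ball \<xi> r \<Longrightarrow> ?G w = exp (h0 w)"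
    using contractible_imp_holomorphic_log[OF Gh convex_imp_contractible[OF convex_ball] Gn] by blast
  let ?V = "ball \<xi> r \<inter> {w. 1/2 < Re w}"
  \<comment> \<open>On the half disc d takes values in the multiples of 2 pi i, hence is a constant,
    which is absorbed into the logarithm.\<close>
  define d where "d w = Lt w - of_nat m * Ln (w - \<xi>) - h0 w" for w
  have V: "connected ?V" by (intro convex_connected convex_Int convex_ball convex_halfspace_Re_gt)
  have wx: "w - \<xi> \<noteq> 0" "w - \<xi> \<notin> \<real>\<^sub>\<le>\<^sub>0" if "1/2 < Re w" for w
    using that \<xi> by (auto simp: complex_nonpos_Reals_iff)
  have dc: "continuous_on ?V d" unfolding d_def[abs_def]
    by (intro continuous_intros continuous_on_subset[OF holomorphic_on_imp_continuous_on[OF Lt_holomorphic]]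
          continuous_on_subset[OF holomorphic_on_imp_continuous_on[OF h0(1)]]) (use wx in auto)
  have "exp (d w) = 1" if w: "w \<in> ?V" for w
  proof -
    have "exp (Lt w) = (w - \<xi>) ^ m * ?G w" using exp_Lt[of w] r(5)[of w] w by simp
    also have "\<dots> = exp (of_nat m * Ln (w - \<xi>)) * exp (h0 w)" using h0(2)[of w] w wx[of w] by (simp add: exp_of_nat_mult)
    finally show ?thesis by (simp add: d_def exp_diff)
  qed
  then obtain c where c: "\<And>w. w \<in> ?V \<Longrightarrow> d w = c" using exp_eq_1_constant[OF V dc] by (auto simp: constant_on_def)
  have vin: "\<xi> + of_real (r/2) \<in> ?V" using r(1) \<xi> by (simp add: dist_norm)
  have ec: "exp c = 1" using c[OF vin] \<open>\<And>w. w \<in> ?V \<Longrightarrow> exp (d w) = 1\<close>[OF vin] by simp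
  show ?thesis
  proof (rule that[of r "\<lambda>w. h0 w + c" m])
    show "(\<lambda>w. h0 w + c) holomorphic_on ball \<xi> r" by (intro holomorphic_intros h0(1))
    show "Lt w = of_nat m * Ln (w - \<xi>) + (h0 w + c)" if "w \<in> ball \<xi> r" "1/2 < Re w" for w
      using c[of w] that by (simp add: d_def algebra_simps)
    show "zeta_reg w * (w + 1) / w ^ 2 = (w - \<xi>) ^ m * exp (h0 w + c)" if "w \<in> ball \<xi> r" for w
      by (simp add: exp_add h0(2)[OF that, symmetric] r(5)[OF that] ec mult.assoc)
  qed (use r in auto)
qed

text \<open>At a zero the real part of the logarithm tends to minus infinity, but the imaginary part
  of m Ln (w - \<xi>) is at most m pi in modulus. This boundedness makes dominated convergence
  towards S possible.\<close>

lemma Im_Lt_locally_bounded: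
  assumes "1/2 \<le> Re \<xi>"
  obtains V B where "open V" "\<xi> \<in> V" "\<And>w. w \<in> V \<Longrightarrow> 1/2 < Re w \<Longrightarrow> \<bar>Im (Lt w)\<bar> \<le> B"
proof (cases "Re \<xi> = 1/2")
  case True
  obtain r m h where r: "0 < r" "h holomorphic_on ball \<xi> r" "zeta_reg \<xi> \<noteq> 0 \<longrightarrow> m = 0"
    "\<And>w. w \<in> ball \<xi> r \<Longrightarrow> 1/2 < Re w \<Longrightarrow> Lt w = of_nat m * Ln (w - \<xi>) + h w"
    "\<And>w. w \<in> ball \<xi> r \<Longrightarrow> zeta_reg w * (w + 1) / w ^ 2 = (w - \<xi>) ^ m * exp (h w)"
    by (rule Lt_boundary[OF True]) (rule that)
  have "compact (h ` cball \<xi> (r/2))"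
    using r(1) by (intro compact_continuous_image holomorphic_on_imp_continuous_on[OF holomorphic_on_subset[OF r(2)]]) auto
  then have "bounded (h ` cball \<xi> (r/2))" by (rule compact_imp_bounded)
  then obtain B where B: "\<And>w. w \<in> cball \<xi> (r/2) \<Longrightarrow> norm (h w) \<le> B" unfolding bounded_iff by blast
  show ?thesis
  proof (rule that[of "ball \<xi> (r/2)" "real m * pi + B"])
    fix w assume w: "w \<in> ball \<xi> (r/2)" "1/2 < Re w"
    have "w - \<xi> \<noteq> 0" using w True by auto
    then have "\<bar>Im (Ln (w - \<xi>))\<bar> \<le> pi" using mpi_less_Im_Ln[of "w - \<xi>"] Im_Ln_le_pi[of "w - \<xi>"] by linarith
    then have "real m * \<bar>Im (Ln (w - \<xi>))\<bar> \<le> real m * pi" by (intro mult_left_mono) auto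
    moreover have "\<bar>Im (h w)\<bar> \<le> B" using B[of w] abs_Im_le_cmod[of "h w"] w by auto
    moreover have "Im (Lt w) = real m * Im (Ln (w - \<xi>)) + Im (h w)" using r(4)[of w] w r(1) by simp
    moreover have "\<bar>real m * Im (Ln (w - \<xi>))\<bar> = real m * \<bar>Im (Ln (w - \<xi>))\<bar>" by (simp add: abs_mult)
    ultimately show "\<bar>Im (Lt w)\<bar> \<le> real m * pi + B" by linarith
  qed (use r(1) in auto)
next
  case False
  then have \<xi>: "1/2 < Re \<xi>" using assms by simp
  have "open {s. 1/2 < Re s}" by (rule open_halfspace_Re_gt)
  then obtain r where r: "0 < r" "cball \<xi> r \<subseteq> {s. 1/2 < Re s}" using \<xi> open_contains_cball by blast
  have "compact (Lt ` cball \<xi> r)"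
    by (intro compact_continuous_image holomorphic_on_imp_continuous_on[OF holomorphic_on_subset[OF Lt_holomorphic r(2)]]) auto
  then have "bounded (Lt ` cball \<xi> r)" by (rule compact_imp_bounded)
  then obtain B where B: "\<And>w. w \<in> cball \<xi> r \<Longrightarrow> norm (Lt w) \<le> B" unfolding bounded_iff by blast
  show ?thesis
  proof (rule that[of "ball \<xi> r" B])
    fix w assume "w \<in> ball \<xi> r"
    then show "\<bar>Im (Lt w)\<bar> \<le> B" using B[of w] abs_Im_le_cmod[of "Lt w"] by auto
  qed (use r in auto)
qed

text \<open>The local bounds become uniform by compactness of a rectangle that includes the critical
  line itself.\<close>

lemma Im_Lt_bounded:
  obtains B where "\<And>x y. 1/2 < x \<Longrightarrow> x \<le> 2 \<Longrightarrow> 0 \<le> y \<Longrightarrow> y \<le> T \<Longrightarrow> \<bar>Im (Lt (Complex x y))\<bar> \<le> B"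
proof -
  let ?K = "cbox (Complex (1/2) 0) (Complex 2 T)"
  have "\<exists>V B. open V \<and> \<xi> \<in> V \<and> (\<forall>w\<in>V. 1/2 < Re w \<longrightarrow> \<bar>Im (Lt w)\<bar> \<le> B)" if "\<xi> \<in> ?K" for \<xi>
  proof -
    have "1/2 \<le> Re \<xi>" using that by (simp add: in_cbox_complex_iff)
    from Im_Lt_locally_bounded[OF this] show ?thesis by metis
  qed
  then obtain V B where VB: "\<And>\<xi>. \<xi> \<in> ?K \<Longrightarrow> open (V \<xi>)" "\<And>\<xi>. \<xi> \<in> ?K \<Longrightarrow> \<xi> \<in> V \<xi>"
    "\<And>\<xi> w. \<xi> \<in> ?K \<Longrightarrow> w \<in> V \<xi> \<Longrightarrow> 1/2 < Re w \<Longrightarrow> \<bar>Im (Lt w)\<bar> \<le> B \<xi>" by metis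
  obtain C where C: "C \<subseteq> ?K" "finite C" "?K \<subseteq> (\<Union>c\<in>C. V c)"
    by (rule compactE_image[OF compact_cbox, of ?K V]) (use VB in auto)
  show ?thesis
  proof (rule that[of "\<Sum>c\<in>C. \<bar>B c\<bar>"])
    fix x y :: real assume xy: "1/2 < x" "x \<le> 2" "0 \<le> y" "y \<le> T"
    then have "Complex x y \<in> ?K" by (simp add: in_cbox_complex_iff)
    then obtain c where c: "c \<in> C" "Complex x y \<in> V c" using C(3) by blast
    have "\<bar>Im (Lt (Complex x y))\<bar> \<le> B c" using VB(3)[of c] c C(1) xy by auto
    also have "\<dots> \<le> \<bar>B c\<bar>" by simp
    also have "\<dots> \<le> (\<Sum>c\<in>C. \<bar>B c\<bar>)" using C(2) c(1) by (intro member_le_sum) auto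
    finally show "\<bar>Im (Lt (Complex x y))\<bar> \<le> (\<Sum>c\<in>C. \<bar>B c\<bar>)" .
  qed
qed

section \<open>Identification of S with boundary values of log zeta\<close>

lemma S_path_image:
  assumes t: "t > 0" and s: "s \<in> path_image (S_path t)" and ne: "s \<noteq> Complex (1/2) t"
  shows "1/2 < Re s" "Im s > 0 \<or> Re s > 1"
proof -
  have "s \<in> closed_segment 2 (2 + \<i> * of_real t) \<or> s \<in> closed_segment (2 + \<i> * of_real t) (1/2 + \<i> * of_real t)"
    using s unfolding S_path_def by (subst (asm) path_image_join) auto
  then have "1/2 < Re s \<and> (Im s > 0 \<or> Re s > 1)"
  proof
    assume "s \<in> closed_segment 2 (2 + \<i> * of_real t)"
    then obtain u where "s = (1 - u) *\<^sub>R 2 + u *\<^sub>R (2 + \<i> * of_real t)" by (auto simp: closed_segment_def)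
    then have "Re s = 2" by (simp add: algebra_simps)
    then show ?thesis by simp
  next
    assume "s \<in> closed_segment (2 + \<i> * of_real t) (1/2 + \<i> * of_real t)"
    then obtain u where u: "0 \<le> u" "u \<le> 1" "s = (1 - u) *\<^sub>R (2 + \<i> * of_real t) + u *\<^sub>R (1/2 + \<i> * of_real t)" by (auto simp: closed_segment_def)
    have "Im s = (1 - u) * t + u * t" "Re s = (1 - u) * 2 + u * (1/2)" by (simp_all add: u(3))
    then have s: "Im s = t" "Re s = 2 - u * (3/2)" by (simp_all add: algebra_simps)
    have "u \<noteq> 1" using ne s by (auto simp: complex_eq_iff)
    then show ?thesis using s u t by simp
  qed
  then show "1/2 < Re s" "Im s > 0 \<or> Re s > 1" by auto
qed

text \<open>Along \<open>S_path t\<close> a continuous logarithm of zeta with given initial value is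
  unique: two of them differ by a continuous function with values in the multiples of 2 pi i. So
  \<open>SOME\<close> must select \<open>Lh\<close> followed along the path. The hypotheses, which
  exclude a zero at the end point, say that \<open>h\<close> continues \<open>Lt\<close>
  there.\<close>

lemma log_zeta_half_eq:
  assumes t: "t > 0" and r: "0 < r" and h: "h holomorphic_on ball (Complex (1/2) t) r"
    and eq: "\<And>w. w \<in> ball (Complex (1/2) t) r \<Longrightarrow> 1/2 < Re w \<Longrightarrow> Lt w = h w"
    and ex: "\<And>w. w \<in> ball (Complex (1/2) t) r \<Longrightarrow> zeta_reg w * (w + 1) / w ^ 2 = exp (h w)"
  shows "log_zeta_half t = h (Complex (1/2) t) - plog (Complex (1/2) t)"
proof -
  define \<xi> where "\<xi> = Complex (1/2) t"
  \<comment> \<open>\<open>Lt\<close> on the open half-plane, continued by \<open>h\<close> to the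
    end point of the path; the two agree on the overlap.\<close>
  define L where "L s = (if 1/2 < Re s then Lt s else h s)" for s
  let ?H = "{s. 1/2 < Re s}"
  have Lb: "L w = h w" if "w \<in> ball \<xi> r" for w using eq[of w] that by (simp add: L_def \<xi>_def)
  have "continuous_on (?H \<union> ball \<xi> r) L"
  proof (rule continuous_on_open_Un)
    show "continuous_on ?H L"
      by (rule continuous_on_eq[OF holomorphic_on_imp_continuous_on[OF Lt_holomorphic]]) (simp add: L_def)
    show "continuous_on (ball \<xi> r) L"
      by (rule continuous_on_eq[OF holomorphic_on_imp_continuous_on[OF h[folded \<xi>_def]]]) (simp add: Lb)
  qed (rule open_halfspace_Re_gt, rule open_ball)
  let ?P = "path_image (S_path t)"
  have Pn: "s = \<xi> \<or> (1/2 < Re s \<and> (Im s > 0 \<or> Re s > 1))" if "s \<in> ?P" for s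
    using S_path_image[OF t that] by (auto simp: \<xi>_def)
  have cL: "continuous_on ?P L"
  proof (rule continuous_on_subset[OF \<open>continuous_on (?H \<union> ball \<xi> r) L\<close>], rule subsetI)
    fix s assume "s \<in> ?P"
    then show "s \<in> ?H \<union> ball \<xi> r" using Pn[of s] r by (cases "s = \<xi>") auto
  qed
  have Pn2: "Im s > 0 \<or> Re s > 1" if "s \<in> ?P" for s using Pn[OF that] t by (auto simp: \<xi>_def)
  have cp: "continuous_on ?P plog" by (rule plog_continuous[OF Pn2])
  have pS: "path (S_path t)" unfolding S_path_def by (intro path_join_imp) auto
  define g where "g u = L (S_path t u) - plog (S_path t u)" for u
  have gc: "continuous_on {0..1} g" unfolding g_def[abs_def]
    by (intro continuous_on_diff continuous_on_compose2[OF cL] continuous_on_compose2[OF cp])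
       (use pS in \<open>auto simp: path_def path_image_def\<close>)
  have ge: "exp (g u) = riemann_zeta (S_path t u)" if u: "u \<in> {0..1}" for u
  proof -
    define s where "s = S_path t u"
    have sP: "s \<in> ?P" using u by (auto simp: s_def path_image_def)
    show ?thesis
    proof (cases "s = \<xi>")
      case True
      have nz: "\<xi> \<noteq> 1" "\<xi> \<noteq> -1" "\<xi> \<noteq> 0" using t by (auto simp: \<xi>_def complex_eq_iff)
      have nz2: "\<xi> - 1 \<noteq> 0" "\<xi> + 1 \<noteq> 0" using nz by (auto simp: add_eq_0_iff2)
      have "exp (h \<xi>) = zeta_reg \<xi> * (\<xi> + 1) / \<xi> ^ 2" using ex[of \<xi>] r by (simp add: \<xi>_def)
      also have "zeta_reg \<xi> = (\<xi> - 1) * riemann_zeta \<xi>" using zeta_reg_eq[of \<xi>] nz by (simp add: \<xi>_def)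
      finally have "exp (h \<xi> - plog \<xi>) = riemann_zeta \<xi>" using nz nz2 by (simp add: exp_diff exp_plog)
      moreover have "L \<xi> = h \<xi>" using Lb[of \<xi>] r by simp
      ultimately show ?thesis using True by (simp add: g_def s_def)
    next
      case False
      then have "1/2 < Re s" "Im s > 0 \<or> Re s > 1" using Pn[OF sP] by auto
      then show ?thesis using exp_Lh[of s] by (simp add: g_def s_def L_def)
    qed
  qed
  \<comment> \<open>\<open>dser vm 2\<close> is real, so it is the principal logarithm of zeta at
    2.\<close>
  have g0: "g 0 = Ln (riemann_zeta 2)"
  proof -
    have "S_path t 0 = 2" by (simp add: S_path_def joinpaths_def linepath_def)
    then have "g 0 = dser vm 2" by (simp add: g_def L_def Lt_eq)
    moreover have "Im (dser vm 2) = 0"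
    proof -
      have s2: "(\<lambda>n. of_real (vm n) * of_nat n powr (-2)) sums dser vm 2" by (rule dser_sums[OF vm_abs_le]) simp
      have e: "Im (of_real (vm n) * of_nat n powr (-2)) = 0" for n
        by (cases "n = 0") (auto simp: powr_def Ln_of_nat Im_exp)
      show ?thesis using sums_Im[OF s2] unfolding e by (simp add: sums_iff)
    qed
    moreover have "Ln (exp (dser vm 2)) = dser vm 2" using calculation(2) pi_gt_zero by (intro Ln_exp) auto
    moreover have "riemann_zeta 2 = exp (dser vm 2)" by (rule zeta_eq_exp_dser) simp
    ultimately show ?thesis by simp
  qed
  define Q where "Q g \<longleftrightarrow> continuous_on {0..1} g \<and> (\<forall>u\<in>{0..1}. exp (g u) = riemann_zeta (S_path t u)) \<and>
       g 0 = Ln (riemann_zeta 2)" for g :: "real \<Rightarrow> complex"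
  have Qg: "Q g" unfolding Q_def using gc ge g0 by blast
  define g' where "g' = (SOME g. Q g)"
  have "Q g'" unfolding g'_def by (rule someI[of Q, OF Qg])
  then have g': "continuous_on {0..1} g'" "\<And>u. u \<in> {0..1} \<Longrightarrow> exp (g' u) = riemann_zeta (S_path t u)" "g' 0 = Ln (riemann_zeta 2)"
    unfolding Q_def by blast+
  have "(\<lambda>u. g' u - g u) constant_on {0..1}"
  proof (rule exp_eq_1_constant)
    show "continuous_on {0..1} (\<lambda>u. g' u - g u)" by (intro continuous_on_diff g' gc)
    show "exp (g' u - g u) = 1" if "u \<in> {0..1}" for u
    proof -
      have "exp (g' u) = exp (g u)" using g'(2)[OF that] ge[OF that] by simp
      then show ?thesis by (simp add: exp_diff)
    qed
  qed simp
  then obtain c where "\<And>u. u \<in> {0..1} \<Longrightarrow> g' u - g u = c" by (auto simp: constant_on_def)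
  moreover have "g' 0 - g 0 = 0" using g'(3) g0 by simp
  ultimately have "g' 1 = g 1" by (metis atLeastAtMost_iff eq_iff_diff_eq_0 order_refl zero_le_one)
  moreover have "log_zeta_half t = g' 1" unfolding log_zeta_half_def g'_def Q_def by (rule refl)
  moreover have "S_path t 1 = \<xi>" by (simp add: S_path_def joinpaths_def linepath_def \<xi>_def complex_eq_iff)
  ultimately show ?thesis using Lb[of \<xi>] r by (simp add: g_def \<xi>_def[symmetric])
qed

text \<open>Away from zeros on the critical line \<open>Lt\<close> continues holomorphically across
  it, so the value defined by the path is the horizontal limit.\<close>

lemma S_eq_limit:
  assumes t: "t > 0" and nz: "zeta_reg (Complex (1/2) t) \<noteq> 0"
  shows "((\<lambda>\<sigma>. Im (Lh (Complex \<sigma> t)) / pi) \<longlongrightarrow> S t) (at_right (1/2))"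
proof -
  define \<xi> where "\<xi> = Complex (1/2) t"
  have re\<xi>: "Re \<xi> = 1/2" by (simp add: \<xi>_def)
  obtain r m h where r: "0 < r" "h holomorphic_on ball \<xi> r" "zeta_reg \<xi> \<noteq> 0 \<longrightarrow> m = 0"
    "\<And>w. w \<in> ball \<xi> r \<Longrightarrow> 1/2 < Re w \<Longrightarrow> Lt w = of_nat m * Ln (w - \<xi>) + h w"
    "\<And>w. w \<in> ball \<xi> r \<Longrightarrow> zeta_reg w * (w + 1) / w ^ 2 = (w - \<xi>) ^ m * exp (h w)"
    by (rule Lt_boundary[OF re\<xi>]) (rule that)
  have m: "m = 0" using r(3) nz by (simp add: \<xi>_def)
  define F where "F \<tau> = Im (h (Complex (1/2) \<tau>) - plog (Complex (1/2) \<tau>)) / pi" for \<tau>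
  define r' where "r' = min r t"
  have r': "0 < r'" "r' \<le> r" "r' \<le> t" using r t by (auto simp: r'_def)
  have dist: "dist \<xi> (Complex (1/2) \<tau>) = \<bar>\<tau> - t\<bar>" for \<tau>
  proof -
    have "\<xi> - Complex (1/2) \<tau> = \<i> * of_real (t - \<tau>)" by (simp add: \<xi>_def complex_eq_iff)
    then show ?thesis by (simp add: dist_norm norm_mult abs_minus_commute del: of_real_diff)
  qed
  have S0F: "S0 \<tau> = F \<tau>" if "\<bar>\<tau> - t\<bar> < r'" for \<tau>
  proof -
    have tp: "\<tau> > 0" using that r' by linarith
    have sub: "ball (Complex (1/2) \<tau>) (r' - \<bar>\<tau> - t\<bar>) \<subseteq> ball \<xi> r"
    proof
      fix w assume "w \<in> ball (Complex (1/2) \<tau>) (r' - \<bar>\<tau> - t\<bar>)"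
      then show "w \<in> ball \<xi> r" using dist_triangle[of \<xi> w "Complex (1/2) \<tau>"] dist[of \<tau>] r' by (simp add: dist_commute)
    qed
    have "log_zeta_half \<tau> = h (Complex (1/2) \<tau>) - plog (Complex (1/2) \<tau>)"
      by (rule log_zeta_half_eq[OF tp, of "r' - \<bar>\<tau> - t\<bar>"])
         (use that sub r m in \<open>auto intro: holomorphic_on_subset[OF r(2)]\<close>)
    then show ?thesis by (simp add: S0_def F_def)
  qed
  have hc: "continuous_on (ball \<xi> r) h" using r(2) by (rule holomorphic_on_imp_continuous_on)
  have isF: "isCont F t"
  proof -
    have "continuous_on {\<tau>. \<bar>\<tau> - t\<bar> < r'} F"
      unfolding F_def[abs_def]
      by (intro continuous_intros continuous_on_compose2[OF hc] continuous_on_compose2[OF plog_continuous[of "{s. Im s > 0}"]])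
         (use dist r' in \<open>auto simp: Complex_eq intro!: continuous_intros\<close>)
    moreover have "open {\<tau>. \<bar>\<tau> - t\<bar> < r'}"
    proof -
      have "{\<tau>. \<bar>\<tau> - t\<bar> < r'} = ball t r'" by (auto simp: dist_real_def abs_minus_commute)
      then show ?thesis by simp
    qed
    ultimately show ?thesis using r'(1) by (simp add: continuous_on_eq_continuous_at)
  qed
  have St: "S t = F t"
  \<comment> \<open>\<open>zero_ordinate\<close> refers to zeros of any real part, so the assumption
    at \<open>Complex (1/2) t\<close> does not decide it. As \<open>F\<close> is continuous at t,
    the symmetric mean gives the same value.\<close>
  proof (cases "zero_ordinate t")
    case True
    have "((\<lambda>e. F (t + e)) \<longlongrightarrow> F t) (at_right 0)" "((\<lambda>e. F (t - e)) \<longlongrightarrow> F t) (at_right 0)"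
      by (rule isCont_tendsto_compose[OF isF]; auto intro!: tendsto_eq_intros)+
    then have "((\<lambda>e. (F (t + e) + F (t - e)) / 2) \<longlongrightarrow> (F t + F t) / 2) (at_right 0)"
      by (intro tendsto_intros) auto
    then have "((\<lambda>e. (F (t + e) + F (t - e)) / 2) \<longlongrightarrow> F t) (at_right 0)" by simp
    moreover have "\<forall>\<^sub>F e in at_right 0. (F (t + e) + F (t - e)) / 2 = (S0 (t + e) + S0 (t - e)) / 2"
    proof -
      have "\<forall>\<^sub>F e in at_right 0. e \<in> {0<..<r'}" using r'(1) by (rule eventually_at_right_real)
      then show ?thesis by eventually_elim (simp add: S0F)
    qed
    ultimately have "((\<lambda>e. (S0 (t + e) + S0 (t - e)) / 2) \<longlongrightarrow> F t) (at_right 0)"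
      by (rule Lim_transform_eventually)
    then have "Lim (at_right 0) (\<lambda>e. (S0 (t + e) + S0 (t - e)) / 2) = F t"
      by (intro tendsto_Lim) auto
    then show ?thesis using True by (simp add: S_def)
  next
    case False
    then show ?thesis using S0F[of t] r' by (simp add: S_def)
  qed
  have "((\<lambda>\<sigma>. Im (h (Complex \<sigma> t) - plog (Complex \<sigma> t)) / pi) \<longlongrightarrow> F t) (at_right (1/2))"
    unfolding F_def
  proof (intro tendsto_intros)
    have cx: "((\<lambda>\<sigma>. Complex \<sigma> t) \<longlongrightarrow> Complex (1/2) t) (at_right (1/2))"
      by (auto intro!: tendsto_eq_intros simp: tendsto_complex_iff)
    have "isCont h \<xi>" using hc r(1) by (simp add: continuous_on_eq_continuous_at)
    then show "((\<lambda>\<sigma>. h (Complex \<sigma> t)) \<longlongrightarrow> h (Complex (1/2) t)) (at_right (1/2))"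
      unfolding \<xi>_def by (rule isCont_tendsto_compose[OF _ cx])
    have "isCont plog \<xi>" using plog_continuous[of "{s. Im s > 0}"] t
      by (simp add: continuous_on_eq_continuous_at open_halfspace_Im_gt \<xi>_def)
    then show "((\<lambda>\<sigma>. plog (Complex \<sigma> t)) \<longlongrightarrow> plog (Complex (1/2) t)) (at_right (1/2))"
      unfolding \<xi>_def by (rule isCont_tendsto_compose[OF _ cx])
  qed auto
  moreover have "\<forall>\<^sub>F \<sigma> in at_right (1/2). Im (h (Complex \<sigma> t) - plog (Complex \<sigma> t)) / pi = Im (Lh (Complex \<sigma> t)) / pi"
  proof -
    have "\<forall>\<^sub>F \<sigma> in at_right (1/2). \<sigma> \<in> {1/2<..<1/2 + r}" using r(1) by (intro eventually_at_right_real) auto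
    then show ?thesis
    proof eventually_elim
      case (elim \<sigma>)
      have "\<xi> - Complex \<sigma> t = of_real (1/2 - \<sigma>)" by (simp add: \<xi>_def complex_eq_iff)
      then have "dist \<xi> (Complex \<sigma> t) = \<bar>1/2 - \<sigma>\<bar>" unfolding dist_norm by (metis norm_of_real)
      then have "Complex \<sigma> t \<in> ball \<xi> r" using elim by auto
      then show ?case using r(4)[of "Complex \<sigma> t"] elim m by simp
    qed
  qed
  ultimately show ?thesis unfolding St by (rule Lim_transform_eventually)
qed

definition crit_zeros :: "real \<Rightarrow> real set" where
  "crit_zeros T = {t \<in> {0..T}. zeta_reg (Complex (1/2) t) = 0}"

lemma finite_crit_zeros: "finite (crit_zeros T)"
proof (cases "crit_zeros T = {}")
  case False
  then obtain t0 where t0: "zeta_reg (Complex (1/2) t0) = 0" by (auto simp: crit_zeros_def)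
  let ?K = "(\<lambda>t. Complex (1/2) t) ` {0..T}"
  have "finite {z \<in> ?K. zeta_reg z = 0}"
  proof (rule holomorphic_compact_finite_zeros[OF zeta_reg_holomorphic])
    show "compact ?K" by (intro compact_continuous_image) (auto simp: Complex_eq intro!: continuous_intros)
    show "\<not> zeta_reg constant_on {s. 0 < Re s}" using zeta_reg_not_constant[OF t0] by simp
  qed (auto intro: open_halfspace_Re_gt convex_connected convex_halfspace_Re_gt)
  then have "finite (Im ` {z \<in> ?K. zeta_reg z = 0})" by (rule finite_imageI)
  moreover have "crit_zeros T \<subseteq> Im ` {z \<in> ?K. zeta_reg z = 0}" by (force simp: crit_zeros_def)
  ultimately show ?thesis by (rule finite_subset[rotated])
qed simp

lemma Lh_bound:
  obtains B where "B > 0" "\<And>x y. 1/2 < x \<Longrightarrow> x \<le> 2 \<Longrightarrow> 0 < y \<Longrightarrow> y \<le> T \<Longrightarrow> \<bar>Im (Lh (Complex x y)) / pi\<bar> \<le> B"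
proof -
  obtain B where B: "\<And>x y. 1/2 < x \<Longrightarrow> x \<le> 2 \<Longrightarrow> 0 \<le> y \<Longrightarrow> y \<le> T \<Longrightarrow> \<bar>Im (Lt (Complex x y))\<bar> \<le> B"
    using Im_Lt_bounded by blast
  show ?thesis
  proof (rule that[of "(\<bar>B\<bar> + 4 * pi) / pi"])
    show "0 < (\<bar>B\<bar> + 4 * pi) / pi" by (simp add: add_nonneg_pos)
    fix x y :: real assume xy: "1/2 < x" "x \<le> 2" "0 < y" "y \<le> T"
    have "Complex x y \<noteq> 1" "Complex x y \<noteq> -1" "Complex x y \<noteq> 0" using xy by (auto simp: complex_eq_iff)
    then have "\<bar>Im (plog (Complex x y))\<bar> \<le> 4 * pi" by (rule Im_plog_bound)
    then have "\<bar>Im (Lh (Complex x y))\<bar> \<le> \<bar>B\<bar> + 4 * pi" using B[of x y] xy by simp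
    then show "\<bar>Im (Lh (Complex x y)) / pi\<bar> \<le> (\<bar>B\<bar> + 4 * pi) / pi" by (simp add: divide_right_mono)
  qed
qed

text \<open>The uniform bound for \<open>Lh\<close> passes to the limit outside a finite set; the
  values at 0 and at the zeros, whatever they are, are covered by adding the finite sum of their
  moduli.\<close>

lemma S_bounded:
  obtains B where "B > 0" "\<And>t. t \<in> {0..T} \<Longrightarrow> \<bar>S t\<bar> \<le> B"
proof -
  obtain B where B: "B > 0" "\<And>x y. 1/2 < x \<Longrightarrow> x \<le> 2 \<Longrightarrow> 0 < y \<Longrightarrow> y \<le> T \<Longrightarrow> \<bar>Im (Lh (Complex x y)) / pi\<bar> \<le> B"
    using Lh_bound by blast
  let ?E = "insert 0 (crit_zeros T)"
  have fin: "finite ?E" using finite_crit_zeros by simp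
  have gen: "\<bar>S t\<bar> \<le> B" if t: "t \<in> {0..T}" "t \<notin> ?E" for t
  proof -
    have "((\<lambda>\<sigma>. Im (Lh (Complex \<sigma> t)) / pi) \<longlongrightarrow> S t) (at_right (1/2))"
      by (rule S_eq_limit) (use t in \<open>auto simp: crit_zeros_def\<close>)
    then have "((\<lambda>\<sigma>. \<bar>Im (Lh (Complex \<sigma> t)) / pi\<bar>) \<longlongrightarrow> \<bar>S t\<bar>) (at_right (1/2))" by (rule tendsto_rabs)
    moreover have "\<forall>\<^sub>F \<sigma> in at_right (1/2). \<bar>Im (Lh (Complex \<sigma> t)) / pi\<bar> \<le> B"
    proof -
      have "\<forall>\<^sub>F \<sigma> in at_right (1/2::real). \<sigma> \<in> {1/2<..<2}" by (intro eventually_at_right_real) auto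
      then show ?thesis by eventually_elim (use B(2)[of _ t] t in auto)
    qed
    ultimately show ?thesis by (rule tendsto_upperbound) simp
  qed
  show ?thesis
  proof (rule that[of "B + (\<Sum>t\<in>?E. \<bar>S t\<bar>)"])
    show "B + (\<Sum>t\<in>?E. \<bar>S t\<bar>) > 0" using B(1) by (intro add_pos_nonneg sum_nonneg) auto
    fix t assume t: "t \<in> {0..T}"
    show "\<bar>S t\<bar> \<le> B + (\<Sum>t\<in>?E. \<bar>S t\<bar>)"
    proof (cases "t \<in> ?E")
      case True
      then have "\<bar>S t\<bar> \<le> (\<Sum>t\<in>?E. \<bar>S t\<bar>)" using fin by (intro member_le_sum) auto
      then show ?thesis using B(1) by linarith
    next
      case False
      then have "\<bar>S t\<bar> \<le> B" using gen t by blast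
      moreover have "0 \<le> (\<Sum>t\<in>?E. \<bar>S t\<bar>)" by (intro sum_nonneg) auto
      ultimately show ?thesis by linarith
    qed
  qed
qed

text \<open>A primitive of Im \<open>Lh\<close> / pi along the line \<sigma>: differentiating Re
  F(\<sigma> + it) in t gives - Im F'(\<sigma> + it), whence the sign.\<close>

definition s1 :: "real \<Rightarrow> real \<Rightarrow> real" where
  "s1 \<sigma> t = - Re (LL (Complex \<sigma> t) - plog_prim (Complex \<sigma> t)) / pi"

lemma s1_deriv:
  assumes "1/2 < \<sigma>" "t > 0"
  shows "(s1 \<sigma> has_vector_derivative Im (Lh (Complex \<sigma> t)) / pi) (at t)"
proof -
  have "((\<lambda>s. LL s - plog_prim s) has_field_derivative Lh (Complex \<sigma> t)) (at (Complex \<sigma> t))"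
    by (intro DERIV_diff LL_deriv plog_prim_has_field_derivative) (use assms in \<open>auto simp: complex_nonpos_Reals_iff\<close>)
  from Re_has_real_derivative[OF vertical_derivative[OF this]]
  have "((\<lambda>t. Re (LL (Complex \<sigma> t) - plog_prim (Complex \<sigma> t))) has_real_derivative - Im (Lh (Complex \<sigma> t))) (at t)" by simp
  from DERIV_cdivide[OF DERIV_minus[OF this], of pi] show ?thesis
    unfolding s1_def[abs_def] has_real_derivative_iff_has_vector_derivative[symmetric] by simp
qed

lemma Lh_line_continuous:
  assumes "1/2 < \<sigma>"
  shows "continuous_on {0<..} (\<lambda>t. Im (Lh (Complex \<sigma> t)) / pi)"
proof -
  have c: "continuous_on {s. 1/2 < Re s \<and> Im s > 0} Lh"
    by (intro continuous_on_diff plog_continuous continuous_on_subset[OF holomorphic_on_imp_continuous_on[OF Lt_holomorphic]]) auto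
  show ?thesis
    by (intro continuous_intros continuous_on_compose2[OF c]) (use assms in \<open>auto simp: Complex_eq intro!: continuous_intros\<close>)
qed

text \<open>Dominated convergence as \<sigma> decreases to 1/2: the integrands are bounded uniformly
  and tend to S off a finite set. Convergence in mean makes the increments of
  \<open>s1 \<sigma>\<close> tend to those of S_1 uniformly in t. They start at 1, not at 0, to stay
  clear of the real axis, where \<open>plog\<close> has its cut.\<close>

lemma S_integrable_and_approx:
  assumes T: "T \<ge> 1"
  shows "S integrable_on {0..T}"
    and "\<epsilon> > 0 \<Longrightarrow> \<eta> > 0 \<Longrightarrow> \<exists>\<sigma>. 1/2 < \<sigma> \<and> \<sigma> < 1/2 + \<eta> \<and> \<sigma> \<le> 2 \<and> (\<forall>t\<in>{1..T}. \<bar>S1 t - S1 1 - (s1 \<sigma> t - s1 \<sigma> 1)\<bar> \<le> \<epsilon>)"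
proof -
  define U where "U = {0<..T} - crit_zeros T"
  obtain B where B: "B > 0" "\<And>x y. 1/2 < x \<Longrightarrow> x \<le> 2 \<Longrightarrow> 0 < y \<Longrightarrow> y \<le> T \<Longrightarrow> \<bar>Im (Lh (Complex x y)) / pi\<bar> \<le> B"
    using Lh_bound by blast
  obtain B' where B': "B' > 0" "\<And>t. t \<in> {0..T} \<Longrightarrow> \<bar>S t\<bar> \<le> B'" using S_bounded[of T] by blast
  define sg where "sg k = 1/2 + 1 / real (k + 2)" for k :: nat
  have sg: "1/2 < sg k" "sg k \<le> 2" for k by (auto simp: sg_def field_simps)
  have sgl: "sg \<longlonglongrightarrow> 1/2" unfolding sg_def[abs_def] by real_asymp
  have sgr: "filterlim sg (at_right (1/2)) sequentially"
    by (rule tendsto_imp_filterlim_at_right[OF sgl]) (use sg in auto)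
  define fk where "fk k t = Im (Lh (Complex (sg k) t)) / pi" for k t
  have Ulm: "U \<in> lmeasurable"
  proof -
    have "{0<..T} \<in> lmeasurable" by (rule bounded_set_imp_lmeasurable) auto
    moreover have "crit_zeros T \<in> lmeasurable" using finite_crit_zeros by (simp add: finite_imp_compact lmeasurable_compact)
    ultimately show ?thesis unfolding U_def by (rule fmeasurable.Diff)
  qed
  have cint: "(\<lambda>_. c) integrable_on U" for c :: real
    using Ulm by (simp add: integrable_on_const)
  have fki: "fk k integrable_on U" for k
  proof (rule measurable_bounded_by_integrable_imp_integrable[OF _ cint[of B]])
    have "continuous_on U (fk k)" unfolding fk_def[abs_def]
      by (rule continuous_on_subset[OF Lh_line_continuous[OF sg(1)]]) (auto simp: U_def)
    then show "fk k \<in> borel_measurable (lebesgue_on U)"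
      by (rule continuous_imp_measurable_on_sets_lebesgue) (use Ulm fmeasurableD in blast)
    show "norm (fk k t) \<le> B" if "t \<in> U" for t using B(2)[OF sg(1)[of k] sg(2)[of k], of t] that by (simp add: fk_def U_def)
    show "U \<in> sets lebesgue" using Ulm fmeasurableD by blast
  qed
  have lim: "(\<lambda>k. fk k t) \<longlonglongrightarrow> S t" if "t \<in> U" for t
    unfolding fk_def using S_eq_limit[of t] that sgr
    by (intro filterlim_compose[OF _ sgr]) (auto simp: U_def crit_zeros_def)
  have SU: "S integrable_on U"
  proof (rule dominated_convergence(1)[OF fki cint[of B]])
    show "norm (fk k t) \<le> B" if "t \<in> U" for k t using B(2)[OF sg(1)[of k] sg(2)[of k], of t] that by (simp add: fk_def U_def)
  qed (rule lim)
  have neg: "negligible {x \<in> U - {0..T}. P x}" "negligible {x \<in> {0..T} - U. P x}" for P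
  proof -
    have e: "{x \<in> U - {0..T}. P x} = {}" by (auto simp: U_def)
    show "negligible {x \<in> U - {0..T}. P x}" unfolding e by (rule negligible_empty)
    have "{x \<in> {0..T} - U. P x} \<subseteq> insert 0 (crit_zeros T)" by (auto simp: U_def)
    then have "finite {x \<in> {0..T} - U. P x}" using finite_crit_zeros finite_subset by blast
    then show "negligible {x \<in> {0..T} - U. P x}" by (rule negligible_finite)
  qed
  show SI: "S integrable_on {0..T}" by (rule integrable_spike_set[OF SU neg])
  assume \<epsilon>: "\<epsilon> > 0" and \<eta>: "\<eta> > 0"
  define g where "g k t = \<bar>S t - fk k t\<bar>" for k t
  have Sabs: "S absolutely_integrable_on U"
  proof (rule absolutely_integrable_integrable_bound[OF _ SU cint[of B']])
    show "norm (S x) \<le> B'" if "x \<in> U" for x using B'(2)[of x] that by (auto simp: U_def)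
  qed
  have fkabs: "fk k absolutely_integrable_on U" for k
  proof (rule absolutely_integrable_integrable_bound[OF _ fki cint[of B]])
    show "norm (fk k t) \<le> B" if "t \<in> U" for t using B(2)[OF sg(1)[of k] sg(2)[of k], of t] that by (simp add: fk_def U_def)
  qed
  have gi: "g k integrable_on U" for k
    using set_integral_diff(1)[OF Sabs fkabs[of k]] unfolding g_def[abs_def]
    by (auto dest: absolutely_integrable_on_def[THEN iffD1] simp: absolutely_integrable_on_def)
  have "(\<lambda>k. integral U (g k)) \<longlonglongrightarrow> integral U (\<lambda>_. 0)"
  proof (rule dominated_convergence(2)[OF gi cint[of "B' + B"]])
    show "norm (g k t) \<le> B' + B" if "t \<in> U" for k t
    proof -
      have "\<bar>fk k t\<bar> \<le> B" using B(2)[OF sg(1)[of k] sg(2)[of k], of t] that by (simp add: fk_def U_def)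
      moreover have "\<bar>S t\<bar> \<le> B'" using B'(2)[of t] that by (simp add: U_def)
      ultimately show ?thesis unfolding g_def real_norm_def by linarith
    qed
    show "(\<lambda>k. g k t) \<longlonglongrightarrow> 0" if "t \<in> U" for t
      unfolding g_def using tendsto_rabs[OF tendsto_diff[OF tendsto_const[of "S t"] lim[OF that]]] by simp
  qed
  then have "(\<lambda>k. integral U (g k)) \<longlonglongrightarrow> 0" by simp
  then have "\<forall>\<^sub>F k in sequentially. integral U (g k) < \<epsilon>" using \<epsilon> by (rule order_tendstoD)
  moreover have "\<forall>\<^sub>F k in sequentially. sg k < 1/2 + \<eta>" by (rule order_tendstoD[OF sgl]) (use \<eta> in simp)
  ultimately have "\<forall>\<^sub>F k in sequentially. integral U (g k) < \<epsilon> \<and> sg k < 1/2 + \<eta>" by eventually_elim simp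
  then obtain k where k: "integral U (g k) < \<epsilon>" "sg k < 1/2 + \<eta>" using eventually_happens by force
  have gT: "g k integrable_on {0..T}" by (rule integrable_spike_set[OF gi neg])
  have gTU: "integral {0..T} (g k) = integral U (g k)" by (rule integral_spike_set[OF neg(2,1)])
  have "\<bar>S1 t - S1 1 - (s1 (sg k) t - s1 (sg k) 1)\<bar> \<le> \<epsilon>" if t: "t \<in> {1..T}" for t
  proof -
    have S0t: "S integrable_on {0..t}" by (rule integrable_on_subinterval[OF SI]) (use t in auto)
    have S1t: "S integrable_on {1..t}" by (rule integrable_on_subinterval[OF SI]) (use t in auto)
    have "S1 t = S1 1 + integral {1..t} S"
      unfolding S1_def using Henstock_Kurzweil_Integration.integral_combine[of 0 1 t S] S0t t by simp
    moreover have fint: "(fk k has_integral (s1 (sg k) t - s1 (sg k) 1)) {1..t}"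
    proof (rule fundamental_theorem_of_calculus)
      show "(s1 (sg k) has_vector_derivative fk k x) (at x within {1..t})" if "x \<in> {1..t}" for x
        unfolding fk_def using s1_deriv[OF sg(1), of x k] that by (auto intro: has_vector_derivative_at_within)
    qed (use t in auto)
    ultimately have "S1 t - S1 1 - (s1 (sg k) t - s1 (sg k) 1) = integral {1..t} (\<lambda>x. S x - fk k x)"
      by (simp add: integral_diff[OF S1t has_integral_integrable[OF fint]] integral_unique[OF fint])
    also have "\<bar>\<dots>\<bar> \<le> integral {1..t} (g k)"
    proof -
      have "norm (integral {1..t} (\<lambda>x. S x - fk k x)) \<le> integral {1..t} (g k)"
      proof (rule integral_norm_bound_integral)
        show "(\<lambda>x. S x - fk k x) integrable_on {1..t}" using S1t fint by (intro integrable_diff) auto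
        show "g k integrable_on {1..t}" by (rule integrable_on_subinterval[OF gT]) (use t in auto)
      qed (simp add: g_def)
      then show ?thesis by simp
    qed
    also have "\<dots> \<le> integral {0..T} (g k)"
      by (rule integral_subset_le) (use t gT integrable_on_subinterval[OF gT, of 1 t] in \<open>auto simp: g_def\<close>)
    also have "\<dots> \<le> \<epsilon>" using k(1) gTU by simp
    finally show ?thesis .
  qed
  then show "\<exists>\<sigma>. 1/2 < \<sigma> \<and> \<sigma> < 1/2 + \<eta> \<and> \<sigma> \<le> 2 \<and> (\<forall>t\<in>{1..T}. \<bar>S1 t - S1 1 - (s1 \<sigma> t - s1 \<sigma> 1)\<bar> \<le> \<epsilon>)"
    using sg[of k] k(2) by (intro exI[of _ "sg k"]) auto
qed

end

section \<open>The resonance inequality\<close>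

lemma gaussian_cos:
  assumes "\<delta> > 0"
  shows "integrable lborel (\<lambda>u. cos (a * u) * normal_density 0 \<delta> u)"
    and "(\<integral>u. cos (a * u) * normal_density 0 \<delta> u \<partial>lborel) = exp (- (\<delta> * a)\<^sup>2 / 2)"
proof -
  have i: "integrable lborel (\<lambda>u. exp (\<i> * of_real (a * u)) * of_real (normal_density 0 \<delta> u))"
    by (rule Bochner_Integration.integrable_bound[OF integrable_normal_density[OF assms, of 0]])
       (auto simp: norm_mult norm_exp_eq_Re)
  have e: "Re (exp (\<i> * of_real (a * u)) * of_real (normal_density 0 \<delta> u)) = cos (a * u) * normal_density 0 \<delta> u" for u
    by (simp add: Re_exp)
  show "integrable lborel (\<lambda>u. cos (a * u) * normal_density 0 \<delta> u)"
    using integrable_Re[OF i] unfolding e .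
  show "(\<integral>u. cos (a * u) * normal_density 0 \<delta> u \<partial>lborel) = exp (- (\<delta> * a)\<^sup>2 / 2)"
    using integral_Re[OF i] unfolding e gaussian_fourier[OF assms] by simp
qed

lemma gaussian_cos_cos:
  assumes "\<delta> > 0"
  shows "integrable lborel (\<lambda>u. cos (a * u) * cos (b * u) * normal_density 0 \<delta> u)"
    and "(\<integral>u. cos (a * u) * cos (b * u) * normal_density 0 \<delta> u \<partial>lborel)
      = (exp (- (\<delta> * (a - b))\<^sup>2 / 2) + exp (- (\<delta> * (a + b))\<^sup>2 / 2)) / 2"
proof -
  have e: "cos (a * u) * cos (b * u) * normal_density 0 \<delta> u
      = (1/2) * (cos ((a - b) * u) * normal_density 0 \<delta> u + cos ((a + b) * u) * normal_density 0 \<delta> u)" for u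
    by (simp add: cos_times_cos algebra_simps)
  show "integrable lborel (\<lambda>u. cos (a * u) * cos (b * u) * normal_density 0 \<delta> u)"
    unfolding e by (intro integrable_mult_right Bochner_Integration.integrable_add gaussian_cos assms)
  show "(\<integral>u. cos (a * u) * cos (b * u) * normal_density 0 \<delta> u \<partial>lborel)
      = (exp (- (\<delta> * (a - b))\<^sup>2 / 2) + exp (- (\<delta> * (a + b))\<^sup>2 / 2)) / 2"
    unfolding e using gaussian_cos[OF assms] by simp
qed

definition gauss_mass :: real where "gauss_mass = 2 / (1 - exp (-1/2))"

lemma gauss_mass_pos: "gauss_mass > 0"
  by (simp add: gauss_mass_def)

text \<open>Since k^2 \<ge> |k| for integers, the sum is dominated by two geometric series of ratio
  exp (-1/2), one on each side of j.\<close>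

lemma sum_gauss_int_le:
  assumes "finite K"
  shows "(\<Sum>k\<in>K. exp (- (real_of_int (j - k))\<^sup>2 / 2)) \<le> gauss_mass"
proof -
  define q where "q = exp (-1/2::real)"
  have q: "0 < q" "q < 1" by (auto simp: q_def)
  have tm: "exp (- (real_of_int (j - k))\<^sup>2 / 2) \<le> q ^ nat \<bar>j - k\<bar>" for k
  proof -
    have "\<bar>j - k\<bar> \<le> (j - k)\<^sup>2" using self_le_power[of "\<bar>j - k\<bar>" 2] by (cases "j = k") auto
    then have "real_of_int \<bar>j - k\<bar> \<le> (real_of_int (j - k))\<^sup>2"
      by (metis of_int_le_iff of_int_power)
    then have "exp (- (real_of_int (j - k))\<^sup>2 / 2) \<le> exp (real (nat \<bar>j - k\<bar>) * (-1/2))" by simp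
    also have "\<dots> = q ^ nat \<bar>j - k\<bar>" unfolding q_def by (rule exp_of_nat_mult)
    finally show ?thesis .
  qed
  have part: "(\<Sum>k\<in>X. q ^ nat \<bar>j - k\<bar>) \<le> 1 / (1 - q)" if "finite X" "inj_on (\<lambda>k. nat \<bar>j - k\<bar>) X" for X
  proof -
    have "(\<Sum>k\<in>X. q ^ nat \<bar>j - k\<bar>) = (\<Sum>n\<in>(\<lambda>k. nat \<bar>j - k\<bar>) ` X. q ^ n)"
      by (simp add: sum.reindex[OF that(2)])
    also have "\<dots> \<le> (\<Sum>n. q ^ n)"
      by (rule sum_le_suminf) (use that q in \<open>auto intro: summable_geometric\<close>)
    also have "\<dots> = 1 / (1 - q)" using q by (intro suminf_geometric) auto
    finally show ?thesis .
  qed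
  have "(\<Sum>k\<in>K. exp (- (real_of_int (j - k))\<^sup>2 / 2)) \<le> (\<Sum>k\<in>K. q ^ nat \<bar>j - k\<bar>)"
    by (intro sum_mono tm)
  also have "\<dots> = (\<Sum>k\<in>{k \<in> K. k \<le> j} \<union> {k \<in> K. j < k}. q ^ nat \<bar>j - k\<bar>)" by (rule sum.cong) auto
  also have "\<dots> = (\<Sum>k\<in>{k \<in> K. k \<le> j}. q ^ nat \<bar>j - k\<bar>) + (\<Sum>k\<in>{k \<in> K. j < k}. q ^ nat \<bar>j - k\<bar>)"
    by (rule sum.union_disjoint) (use assms in auto)
  also have "\<dots> \<le> 1 / (1 - q) + 1 / (1 - q)"
    by (intro add_mono part) (use assms in \<open>auto simp: inj_on_def\<close>)
  also have "\<dots> = gauss_mass" by (simp add: gauss_mass_def q_def)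
  finally show ?thesis .
qed

text \<open>Half of the exponent is spent on the decay; the other half is a normal density of
  doubled variance, which still has mass 1. The factor sqrt 2 between the normalisations is rounded
  up to 2.\<close>

lemma normal_density_tail:
  assumes "T1 > 0" "\<bar>t\<bar> \<ge> T'" "T' \<ge> 0"
  shows "normal_density 0 T1 t \<le> 2 * exp (- T'\<^sup>2 / (4 * T1\<^sup>2)) * normal_density 0 (sqrt 2 * T1) t"
proof -
  have sq: "T'\<^sup>2 \<le> t\<^sup>2" using assms by (simp add: abs_le_square_iff[symmetric])
  have e1: "normal_density 0 T1 t = sqrt 2 * (exp (- t\<^sup>2 / (4 * T1\<^sup>2)) * normal_density 0 (sqrt 2 * T1) t)"
  proof -
    define E where "E = exp (- t\<^sup>2 / (4 * T1\<^sup>2))"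
    define s where "s = sqrt (2 * pi * T1\<^sup>2)"
    have EE: "E * E = exp (- t\<^sup>2 / (2 * T1\<^sup>2))" unfolding E_def mult_exp_exp by simp
    have q: "sqrt (2 * pi * (sqrt 2 * T1)\<^sup>2) = sqrt 2 * s"
      unfolding s_def real_sqrt_mult[symmetric] by (simp add: power_mult_distrib mult_ac)
    have a: "normal_density 0 (sqrt 2 * T1) t = 1 / (sqrt 2 * s) * E"
      unfolding normal_density_def q by (simp add: power_mult_distrib E_def)
    have b: "normal_density 0 T1 t = 1 / s * (E * E)"
      unfolding EE by (simp add: normal_density_def s_def)
    show ?thesis unfolding a b E_def[symmetric] by (simp add: field_simps)
  qed
  have "exp (- t\<^sup>2 / (4 * T1\<^sup>2)) \<le> exp (- T'\<^sup>2 / (4 * T1\<^sup>2))"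
    using sq assms by (simp add: divide_right_mono)
  then have "normal_density 0 T1 t \<le> sqrt 2 * (exp (- T'\<^sup>2 / (4 * T1\<^sup>2)) * normal_density 0 (sqrt 2 * T1) t)"
    unfolding e1 by (intro mult_left_mono mult_right_mono) auto
  also have "\<dots> \<le> 2 * (exp (- T'\<^sup>2 / (4 * T1\<^sup>2)) * normal_density 0 (sqrt 2 * T1) t)"
    by (intro mult_right_mono) (auto intro!: real_le_lsqrt simp: normal_density_nonneg)
  finally show ?thesis by (simp add: mult.assoc)
qed

lemma normal_density_le_inverse:
  assumes "T1 > 0" shows "normal_density 0 T1 t \<le> 1 / T1"
proof -
  have "normal_density 0 T1 t \<le> 1 / sqrt (2 * pi * T1\<^sup>2) * 1"
    unfolding normal_density_def by (intro mult_left_mono) (use assms in auto)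
  also have "\<dots> \<le> 1 / T1"
  proof -
    have "T1 \<le> sqrt (2 * pi * T1\<^sup>2)"
      using pi_gt3 assms by (intro real_le_rsqrt) (auto simp: mult_le_cancel_right1)
    then show ?thesis using assms by (simp add: frac_le)
  qed
  finally show ?thesis .
qed

text \<open>The resonator \<open>V\<close> is built on the lattice \<open>(1/T1) \<int>\<close> instead of on the frequencies \<open>lam x\<close> themselves:
  all frequencies in one cell are merged, which makes the mean square of \<open>V\<close> computable however close the \<open>lam x\<close> lie.
  Nothing is lost in the lower bound because \<open>b\<close> and the Fourier transform of the weight are nonnegative.\<close>
lemma resonance_bound:
  fixes lam :: "'a \<Rightarrow> real" and f :: "'a \<Rightarrow> real" and b :: "nat \<Rightarrow> real" and ext :: "nat \<Rightarrow> 'a \<Rightarrow> 'a"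
  assumes M: "finite M" and f: "\<And>x. x \<in> M \<Longrightarrow> f x \<ge> 0"
    and b: "\<And>n. b n \<ge> 0" "summable b" and T1: "T1 > 0" and P: "finite P"
    and A: "\<And>p. p \<in> P \<Longrightarrow> A p \<subseteq> M" "\<And>p x. p \<in> P \<Longrightarrow> x \<in> A p \<Longrightarrow> ext p x \<in> M"
    and inj: "\<And>p. p \<in> P \<Longrightarrow> inj_on (ext p) (A p)"
    and lam: "\<And>p x. p \<in> P \<Longrightarrow> x \<in> A p \<Longrightarrow> lam (ext p x) = lam x + ln (real p)"
    and T0: "0 \<le> T0" "0 \<le> T'"
    and Bd: "0 \<le> Bd" "\<And>t. T0 \<le> t \<Longrightarrow> t \<le> T' \<Longrightarrow> (\<Sum>n. b n * cos (t * ln (real n))) \<le> Bd"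
  shows "(1/2) * exp (-1/2) * (\<Sum>p\<in>P. b p * (\<Sum>x\<in>A p. f x * f (ext p x)))
    \<le> (\<Sum>x\<in>M. (f x)\<^sup>2) * (gauss_mass * Bd + suminf b * real (card M) * (2 * T0 / T1 + 2 * exp (- T'\<^sup>2 / (4 * T1\<^sup>2))))"
proof -
  define cell where "cell x = \<lfloor>lam x * T1\<rfloor>" for x
  define J where "J = cell ` M"
  have J: "finite J" using M by (simp add: J_def)
  define fib where "fib j = {x \<in> M. cell x = j}" for j
  \<comment> \<open>The l2 norm over a cell rather than a sum: the squares of \<open>r\<close> then
    still add up to Y, and Cauchy-Schwarz on fibres fits below.\<close>
  define r where "r j = sqrt (\<Sum>x\<in>fib j. (f x)\<^sup>2)" for j
  define Y where "Y = (\<Sum>x\<in>M. (f x)\<^sup>2)"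
  have r0: "r j \<ge> 0" for j by (simp add: r_def sum_nonneg)
  have r2: "(r j)\<^sup>2 = (\<Sum>x\<in>fib j. (f x)\<^sup>2)" for j by (simp add: r_def sum_nonneg)
  have Yr: "(\<Sum>j\<in>J. (r j)\<^sup>2) = Y"
    unfolding r2 Y_def fib_def J_def using M by (rule sum.image_gen[symmetric])
  have Y0: "Y \<ge> 0" by (simp add: Y_def sum_nonneg)
  let ?nd = "normal_density 0 T1"
  \<comment> \<open>The squared modulus of the sum of r_j exp (i j t / T1), expanded into cosines;
    \<open>V_eq\<close> shows nonnegativity.\<close>
  define V where "V t = (\<Sum>j\<in>J. \<Sum>k\<in>J. r j * r k * cos (real_of_int (j - k) / T1 * t))" for t
  have V_eq: "V t = (\<Sum>j\<in>J. r j * cos (real_of_int j / T1 * t))\<^sup>2 + (\<Sum>j\<in>J. r j * sin (real_of_int j / T1 * t))\<^sup>2" for t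
  proof -
    have "cos (real_of_int (j - k) / T1 * t) = cos (real_of_int j / T1 * t) * cos (real_of_int k / T1 * t) + sin (real_of_int j / T1 * t) * sin (real_of_int k / T1 * t)" for j k
      using cos_diff[of "real_of_int j / T1 * t" "real_of_int k / T1 * t"] by (simp add: algebra_simps diff_divide_distrib)
    then show ?thesis
      unfolding V_def power2_eq_square sum_product sum.distrib[symmetric]
      by (intro sum.cong refl) (simp add: algebra_simps)
  qed
  have V0: "V t \<ge> 0" for t unfolding V_eq by simp
  have VM: "V t \<le> real (card M) * Y" for t
  proof -
    have "V t \<le> (\<Sum>j\<in>J. \<Sum>k\<in>J. r j * r k)"
      unfolding V_def by (intro sum_mono) (use r0 in \<open>auto intro!: mult_left_le mult_nonneg_nonneg\<close>)
    also have "\<dots> = (\<Sum>j\<in>J. r j)\<^sup>2" by (simp add: power2_eq_square sum_product)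
    also have "\<dots> \<le> real (card J) * (\<Sum>j\<in>J. (r j)\<^sup>2)"
      using Cauchy_Schwarz_ineq_sum[of "\<lambda>_. 1" r J] by simp
    also have "\<dots> \<le> real (card M) * Y" unfolding Yr using card_image_le[OF M, of cell] Y0 by (intro mult_right_mono) (auto simp: J_def)
    finally show ?thesis .
  qed
  have Vc: "continuous_on UNIV V" unfolding V_def[abs_def] by (intro continuous_intros)
  then have Vm[measurable]: "V \<in> borel_measurable borel" by (rule borel_measurable_continuous_onI)
  have cosV: "integrable lborel (\<lambda>t. cos (a * t) * V t * ?nd t)"
       "(\<integral>t. cos (a * t) * V t * ?nd t \<partial>lborel) = (\<Sum>j\<in>J. \<Sum>k\<in>J. r j * r k *
          ((exp (- (T1 * a - real_of_int (j - k))\<^sup>2 / 2) + exp (- (T1 * a + real_of_int (j - k))\<^sup>2 / 2)) / 2))" for a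
  proof -
    have e: "cos (a * t) * V t * ?nd t = (\<Sum>j\<in>J. \<Sum>k\<in>J. r j * r k * (cos (a * t) * cos (real_of_int (j - k) / T1 * t) * ?nd t))" for t
      unfolding V_def by (simp add: sum_distrib_left sum_distrib_right mult_ac)
    show "integrable lborel (\<lambda>t. cos (a * t) * V t * ?nd t)"
      unfolding e by (intro Bochner_Integration.integrable_sum integrable_mult_right gaussian_cos_cos T1)
    have ii: "integrable lborel (\<lambda>t. r j * r k * (cos (a * t) * cos (real_of_int (j - k) / T1 * t) * ?nd t))" for j k
      by (intro integrable_mult_right gaussian_cos_cos T1)
    have "(\<integral>t. cos (a * t) * V t * ?nd t \<partial>lborel) = (\<Sum>j\<in>J. \<integral>t. (\<Sum>k\<in>J. r j * r k * (cos (a * t) * cos (real_of_int (j - k) / T1 * t) * ?nd t)) \<partial>lborel)"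
      unfolding e by (rule Bochner_Integration.integral_sum) (intro Bochner_Integration.integrable_sum ii)
    also have "\<dots> = (\<Sum>j\<in>J. \<Sum>k\<in>J. \<integral>t. r j * r k * (cos (a * t) * cos (real_of_int (j - k) / T1 * t) * ?nd t) \<partial>lborel)"
      by (intro sum.cong refl Bochner_Integration.integral_sum ii)
    also have "\<dots> = (\<Sum>j\<in>J. \<Sum>k\<in>J. r j * r k * (\<integral>t. cos (a * t) * cos (real_of_int (j - k) / T1 * t) * ?nd t \<partial>lborel))"
      by (simp only: integral_mult_right_zero)
    also have "\<dots> = (\<Sum>j\<in>J. \<Sum>k\<in>J. r j * r k *
          ((exp (- (T1 * a - real_of_int (j - k))\<^sup>2 / 2) + exp (- (T1 * a + real_of_int (j - k))\<^sup>2 / 2)) / 2))"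
    proof -
      have x: "T1 * (a - d / T1) = T1 * a - d" "T1 * (a + d / T1) = T1 * a + d" for d
        using T1 by (simp_all add: right_diff_distrib distrib_left)
      show ?thesis unfolding gaussian_cos_cos(2)[OF T1] x by (rule refl)
    qed
    finally show "(\<integral>t. cos (a * t) * V t * ?nd t \<partial>lborel) = (\<Sum>j\<in>J. \<Sum>k\<in>J. r j * r k *
          ((exp (- (T1 * a - real_of_int (j - k))\<^sup>2 / 2) + exp (- (T1 * a + real_of_int (j - k))\<^sup>2 / 2)) / 2))" .
  qed
  have Vi: "integrable lborel (\<lambda>t. V t * ?nd t)" using cosV(1)[of 0] by simp
  \<comment> \<open>On the lattice the Gaussian mean of V is a quadratic form with entries exp (-(j
    - k)^2 / 2); r_j r_k \<le> (r_j^2 + r_k^2) / 2 and bounded row sums give a multiple of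
    Y.\<close>
  have I1: "(\<integral>t. V t * ?nd t \<partial>lborel) \<le> gauss_mass * Y"
  proof -
    have "(\<integral>t. V t * ?nd t \<partial>lborel) = (\<Sum>j\<in>J. \<Sum>k\<in>J. r j * r k * exp (- (real_of_int (j - k))\<^sup>2 / 2))"
      using cosV(2)[of 0] by (simp del: of_int_diff)
    also have "\<dots> \<le> (\<Sum>j\<in>J. \<Sum>k\<in>J. ((r j)\<^sup>2 / 2 + (r k)\<^sup>2 / 2) * exp (- (real_of_int (j - k))\<^sup>2 / 2))"
    proof (intro sum_mono mult_right_mono)
      fix j k show "r j * r k \<le> (r j)\<^sup>2 / 2 + (r k)\<^sup>2 / 2"
        using sum_squares_bound[of "r j" "r k"] by simp
    qed auto
    also have "\<dots> = (\<Sum>j\<in>J. \<Sum>k\<in>J. (r j)\<^sup>2 / 2 * exp (- (real_of_int (j - k))\<^sup>2 / 2)) + (\<Sum>j\<in>J. \<Sum>k\<in>J. (r k)\<^sup>2 / 2 * exp (- (real_of_int (j - k))\<^sup>2 / 2))"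
      by (simp add: distrib_right sum.distrib)
    also have "(\<Sum>j\<in>J. \<Sum>k\<in>J. (r k)\<^sup>2 / 2 * exp (- (real_of_int (j - k))\<^sup>2 / 2)) = (\<Sum>j\<in>J. \<Sum>k\<in>J. (r j)\<^sup>2 / 2 * exp (- (real_of_int (j - k))\<^sup>2 / 2))"
      by (subst sum.swap) (intro sum.cong refl, simp add: power2_commute[of "real_of_int _" "real_of_int _"])
    also have "(\<Sum>j\<in>J. \<Sum>k\<in>J. (r j)\<^sup>2 / 2 * exp (- (real_of_int (j - k))\<^sup>2 / 2)) = (\<Sum>j\<in>J. (r j)\<^sup>2 / 2 * (\<Sum>k\<in>J. exp (- (real_of_int (j - k))\<^sup>2 / 2)))"
      by (simp add: sum_distrib_left)
    also have "\<dots> + \<dots> \<le> (\<Sum>j\<in>J. (r j)\<^sup>2 / 2 * gauss_mass) + (\<Sum>j\<in>J. (r j)\<^sup>2 / 2 * gauss_mass)"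
      by (intro add_mono sum_mono mult_left_mono sum_gauss_int_le J) auto
    also have "\<dots> = gauss_mass * Y" by (simp add: Yr[symmetric] sum_distrib_left sum_distrib_right sum.distrib[symmetric] mult_ac)
    finally show ?thesis .
  qed
  have ind: "integrable lborel (indicat_real {- T0..T0})"
    by (intro integrable_real_indicator) (auto simp: emeasure_lborel_Icc_eq)
  define D where "D t = (\<Sum>n. b n * cos (t * ln (real n)))" for t
  have bs: "summable (\<lambda>n. norm (b n * cos (t * ln (real n))))" for t
    by (rule summable_comparison_test'[where N=0, OF b(2)]) (use b(1) in \<open>auto simp: abs_mult mult_left_le\<close>)
  have Dabs: "D t \<le> suminf b" for t
    unfolding D_def by (rule suminf_le[OF _ summable_norm_cancel[OF bs] b(2)]) (use b(1) in \<open>simp add: mult_left_le\<close>)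
  have Deven: "D (- t) = D t" for t by (simp add: D_def)
  let ?g = "\<lambda>n t. b n * (cos (ln (real n) * t) * V t * ?nd t)"
  have gi: "integrable lborel (?g n)" for n by (intro integrable_mult_right cosV)
  have gn: "norm (?g n t) \<le> b n * (real (card M) * Y * ?nd t)" for n t
  proof -
    have "norm (?g n t) = b n * (\<bar>cos (ln (real n) * t)\<bar> * V t * ?nd t)"
      using b(1)[of n] V0[of t] by (simp add: abs_mult)
    also have "\<dots> \<le> b n * (1 * (real (card M) * Y) * ?nd t)"
      by (intro mult_left_mono mult_right_mono mult_mono) (use b(1) VM V0 in auto)
    finally show ?thesis by simp
  qed
  have g1: "AE t in lborel. summable (\<lambda>n. norm (?g n t))"
  proof (rule AE_I2)
    fix t show "summable (\<lambda>n. norm (?g n t))"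
      by (rule summable_comparison_test'[where N=0, OF summable_mult2[OF b(2)]]) (use gn[of _ t] in auto)
  qed
  have g2: "summable (\<lambda>n. \<integral>t. norm (?g n t) \<partial>lborel)"
  proof (rule summable_comparison_test'[where N=0, OF summable_mult2[OF b(2), of "real (card M) * Y"]])
    fix n
    have "(\<integral>t. norm (?g n t) \<partial>lborel) \<le> (\<integral>t. b n * (real (card M) * Y * ?nd t) \<partial>lborel)"
      by (intro integral_mono gn integrable_norm gi integrable_mult_right) (use T1 in auto)
    also have "\<dots> = b n * (real (card M) * Y)" using T1 by simp
    finally show "norm (\<integral>t. norm (?g n t) \<partial>lborel) \<le> b n * (real (card M) * Y)" by simp
  qed
  have sg: "(\<Sum>n. ?g n t) = D t * V t * ?nd t" for t
  proof -
    have "(\<lambda>n. (b n * cos (t * ln (real n))) * (V t * ?nd t)) sums (D t * (V t * ?nd t))"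
      unfolding D_def by (intro sums_mult2 summable_sums summable_norm_cancel[OF bs])
    then show ?thesis by (simp add: sums_iff mult_ac)
  qed
  have I2: "(\<lambda>n. integral\<^sup>L lborel (?g n)) sums (\<integral>t. D t * V t * ?nd t \<partial>lborel)"
    and DVi: "integrable lborel (\<lambda>t. D t * V t * ?nd t)"
    using sums_integral[OF gi g1 g2] integrable_suminf[OF gi g1 g2] unfolding sg by auto
  have g0: "integral\<^sup>L lborel (?g n) \<ge> 0" for n
    by (simp add: cosV(2)) (intro mult_nonneg_nonneg b sum_nonneg; use r0 in simp)
  \<comment> \<open>For x in cell j and \<open>ext p x\<close> in cell k, flooring gives |T1 ln p +
    j - k| \<le> 1, so this pair of cells contributes at least exp (-1/2) / 2 times r_j r_k. All
    other pairs contribute nonnegatively and are dropped.\<close>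
  have low: "(1/2) * exp (-1/2) * (\<Sum>x\<in>A p. f x * f (ext p x)) \<le> (\<integral>t. cos (ln (real p) * t) * V t * ?nd t \<partial>lborel)" if p: "p \<in> P" for p
  proof -
    define h where "h x = (cell x, cell (ext p x))" for x
    have fA: "finite (A p)" using A(1)[OF p] M finite_subset by blast
    have hJ: "h ` A p \<subseteq> J \<times> J" using A p by (auto simp: h_def J_def)
    have "(\<Sum>x\<in>A p. f x * f (ext p x)) = (\<Sum>jk\<in>h ` A p. \<Sum>x\<in>{x \<in> A p. h x = jk}. f x * f (ext p x))"
      using fA by (rule sum.image_gen)
    also have "\<dots> \<le> (\<Sum>jk\<in>h ` A p. r (fst jk) * r (snd jk))"
    proof (rule sum_mono)
      fix jk assume "jk \<in> h ` A p"
      let ?X = "{x \<in> A p. h x = jk}"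
      \<comment> \<open>Cauchy-Schwarz on a fibre of \<open>h\<close>; injectivity of
        \<open>ext p\<close> bounds the second factor by the mass of the target cell.\<close>
      have "(\<Sum>x\<in>?X. f x * f (ext p x)) \<le> sqrt ((\<Sum>x\<in>?X. (f x)\<^sup>2) * (\<Sum>x\<in>?X. (f (ext p x))\<^sup>2))"
        by (rule real_le_rsqrt) (rule Cauchy_Schwarz_ineq_sum)
      also have "\<dots> = sqrt (\<Sum>x\<in>?X. (f x)\<^sup>2) * sqrt (\<Sum>x\<in>?X. (f (ext p x))\<^sup>2)" by (rule real_sqrt_mult)
      also have "\<dots> \<le> r (fst jk) * r (snd jk)"
      proof (rule mult_mono)
        show "sqrt (\<Sum>x\<in>?X. (f x)\<^sup>2) \<le> r (fst jk)"
          unfolding r_def fib_def using A(1)[OF p] M by (intro real_sqrt_le_mono sum_mono2) (auto simp: h_def)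
        have "(\<Sum>x\<in>?X. (f (ext p x))\<^sup>2) = (\<Sum>y\<in>ext p ` ?X. (f y)\<^sup>2)"
          by (subst sum.reindex) (auto intro: inj_on_subset[OF inj[OF p]])
        also have "\<dots> \<le> (\<Sum>y\<in>fib (snd jk). (f y)\<^sup>2)"
          unfolding fib_def using A(2)[OF p] M by (intro sum_mono2) (auto simp: h_def)
        finally show "sqrt (\<Sum>x\<in>?X. (f (ext p x))\<^sup>2) \<le> r (snd jk)" unfolding r_def by (rule real_sqrt_le_mono)
      qed (use r0 in \<open>auto intro: sum_nonneg\<close>)
      finally show "(\<Sum>x\<in>?X. f x * f (ext p x)) \<le> r (fst jk) * r (snd jk)" .
    qed
    finally have "(1/2) * exp (-1/2) * (\<Sum>x\<in>A p. f x * f (ext p x)) \<le> (1/2) * exp (-1/2) * (\<Sum>jk\<in>h ` A p. r (fst jk) * r (snd jk))"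
      by (intro mult_left_mono) auto
    also have "\<dots> = (\<Sum>jk\<in>h ` A p. r (fst jk) * r (snd jk) * (exp (-1/2) / 2))" by (simp add: sum_distrib_left sum_distrib_right mult_ac)
    also have "\<dots> \<le> (\<Sum>jk\<in>h ` A p. r (fst jk) * r (snd jk) *
          ((exp (- (T1 * ln (real p) - real_of_int (fst jk - snd jk))\<^sup>2 / 2) + exp (- (T1 * ln (real p) + real_of_int (fst jk - snd jk))\<^sup>2 / 2)) / 2))"
    proof (intro sum_mono mult_left_mono divide_right_mono)
      fix jk assume "jk \<in> h ` A p"
      then obtain x where x: "x \<in> A p" "jk = h x" by blast
      have "\<bar>T1 * ln (real p) + real_of_int (fst jk - snd jk)\<bar> \<le> 1"
        unfolding x(2) h_def cell_def fst_conv snd_conv lam[OF p x(1)] distrib_right by (simp add: mult.commute) linarith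
      then have "(T1 * ln (real p) + real_of_int (fst jk - snd jk))\<^sup>2 \<le> 1" by (simp add: abs_square_le_1)
      then have "exp (-1/2) \<le> exp (- (T1 * ln (real p) + real_of_int (fst jk - snd jk))\<^sup>2 / 2)" by simp
      then show "exp (-1/2) \<le> exp (- (T1 * ln (real p) - real_of_int (fst jk - snd jk))\<^sup>2 / 2) + exp (- (T1 * ln (real p) + real_of_int (fst jk - snd jk))\<^sup>2 / 2)"
        by (rule add_increasing[rotated]) simp
    qed (use r0 in auto)
    also have "\<dots> \<le> (\<Sum>jk\<in>J \<times> J. r (fst jk) * r (snd jk) *
          ((exp (- (T1 * ln (real p) - real_of_int (fst jk - snd jk))\<^sup>2 / 2) + exp (- (T1 * ln (real p) + real_of_int (fst jk - snd jk))\<^sup>2 / 2)) / 2))"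
      by (rule sum_mono2) (use J hJ r0 in \<open>auto intro!: mult_nonneg_nonneg\<close>)
    also have "\<dots> = (\<integral>t. cos (ln (real p) * t) * V t * ?nd t \<partial>lborel)"
      unfolding cosV(2) sum.cartesian_product by (simp add: case_prod_beta)
    finally show ?thesis .
  qed
  have "(1/2) * exp (-1/2) * (\<Sum>p\<in>P. b p * (\<Sum>x\<in>A p. f x * f (ext p x))) = (\<Sum>p\<in>P. b p * ((1/2) * exp (-1/2) * (\<Sum>x\<in>A p. f x * f (ext p x))))"
    unfolding sum_distrib_left[of _ _ P] by (intro sum.cong refl) (simp only: mult_ac)
  also have "\<dots> \<le> (\<Sum>p\<in>P. integral\<^sup>L lborel (?g p))"
    unfolding integral_mult_right_zero by (intro sum_mono mult_left_mono low b)
  \<comment> \<open>Every term of the series has nonnegative mean by \<open>g0\<close>, so the terms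
    outside P may be added.\<close>
  also have "\<dots> \<le> (\<Sum>n. integral\<^sup>L lborel (?g n))"
    by (rule sum_le_suminf[OF sums_summable[OF I2] P]) (use g0 in auto)
  also have "\<dots> = (\<integral>t. D t * V t * ?nd t \<partial>lborel)" using I2 by (simp add: sums_iff)
  \<comment> \<open>Three ranges: for T0 \<le> |t| \<le> T' the hypothesis applies to the even
    function \<open>D\<close>; for smaller |t| the density is at most 1/T1; for larger |t| it is
    replaced by its tail bound. The last two use the trivial bounds for \<open>D\<close> and
    V.\<close>
  also have "\<dots> \<le> (\<integral>t. Bd * (V t * ?nd t) + suminf b * real (card M) * Y * (indicator {- T0..T0} t * (1 / T1) + 2 * exp (- T'\<^sup>2 / (4 * T1\<^sup>2)) * normal_density 0 (sqrt 2 * T1) t) \<partial>lborel)"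
  proof (rule integral_mono[OF DVi])
    have sb: "suminf b \<ge> 0" using b by (intro suminf_nonneg) auto
    show "integrable lborel (\<lambda>t. Bd * (V t * ?nd t) + suminf b * real (card M) * Y * (indicator {- T0..T0} t * (1 / T1) + 2 * exp (- T'\<^sup>2 / (4 * T1\<^sup>2)) * normal_density 0 (sqrt 2 * T1) t))"
      using T1 Vi ind by (intro Bochner_Integration.integrable_add integrable_mult_right integrable_mult_left) auto
    fix t
    have nn: "0 \<le> indicator {- T0..T0} t * (1 / T1)" "0 \<le> 2 * exp (- T'\<^sup>2 / (4 * T1\<^sup>2)) * normal_density 0 (sqrt 2 * T1) t"
      using T1 by (auto simp: indicator_def)
    have cY: "0 \<le> suminf b * real (card M) * Y" using sb Y0 by simp
    show "D t * V t * ?nd t \<le> Bd * (V t * ?nd t) + suminf b * real (card M) * Y * (indicator {- T0..T0} t * (1 / T1) + 2 * exp (- T'\<^sup>2 / (4 * T1\<^sup>2)) * normal_density 0 (sqrt 2 * T1) t)"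
    proof (cases "T0 \<le> \<bar>t\<bar> \<and> \<bar>t\<bar> \<le> T'")
      case True
      have "D t = D \<bar>t\<bar>" using Deven[of t] by (cases "t \<ge> 0") auto
      then have "D t \<le> Bd" using Bd(2)[of "\<bar>t\<bar>"] True by (simp add: D_def)
      then have "D t * (V t * ?nd t) \<le> Bd * (V t * ?nd t)" using V0 by (intro mult_right_mono) auto
      moreover have "0 \<le> suminf b * real (card M) * Y * (indicator {- T0..T0} t * (1 / T1) + 2 * exp (- T'\<^sup>2 / (4 * T1\<^sup>2)) * normal_density 0 (sqrt 2 * T1) t)"
        by (intro mult_nonneg_nonneg[OF cY] add_nonneg_nonneg nn)
      ultimately show ?thesis by (simp add: mult.assoc)
    next
      case False
      have nd: "?nd t \<le> indicator {- T0..T0} t * (1 / T1) + 2 * exp (- T'\<^sup>2 / (4 * T1\<^sup>2)) * normal_density 0 (sqrt 2 * T1) t"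
      proof (cases "\<bar>t\<bar> < T0")
        case True
        then have "indicator {- T0..T0} t * (1 / T1) = 1 / T1" by (auto simp: indicator_def)
        then show ?thesis using normal_density_le_inverse[OF T1, of t] nn by linarith
      next
        case F: False
        then have "\<bar>t\<bar> \<ge> T'" using False by linarith
        then show ?thesis using normal_density_tail[OF T1 _ T0(2), of t] nn by linarith
      qed
      have "D t * (V t * ?nd t) \<le> suminf b * (V t * ?nd t)" using Dabs V0 by (intro mult_right_mono) auto
      also have "\<dots> \<le> suminf b * ((real (card M) * Y) * ?nd t)" using VM sb by (intro mult_left_mono mult_right_mono) auto
      also have "\<dots> \<le> suminf b * ((real (card M) * Y) * (indicator {- T0..T0} t * (1 / T1) + 2 * exp (- T'\<^sup>2 / (4 * T1\<^sup>2)) * normal_density 0 (sqrt 2 * T1) t))"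
        using nd sb Y0 by (intro mult_left_mono) auto
      finally have "D t * (V t * ?nd t) \<le> suminf b * real (card M) * Y * (indicator {- T0..T0} t * (1 / T1) + 2 * exp (- T'\<^sup>2 / (4 * T1\<^sup>2)) * normal_density 0 (sqrt 2 * T1) t)"
        by (simp add: mult.assoc)
      moreover have "0 \<le> Bd * (V t * ?nd t)" using Bd(1) V0 by simp
      ultimately show ?thesis by (simp add: mult.assoc)
    qed
  qed
  also have "\<dots> = Bd * (\<integral>t. V t * ?nd t \<partial>lborel) + suminf b * real (card M) * Y * (2 * T0 * (1 / T1) + 2 * exp (- T'\<^sup>2 / (4 * T1\<^sup>2)))"
  proof -
    have i1: "integrable lborel (\<lambda>t. indicator {- T0..T0} t * (1 / T1))" using ind by (rule integrable_mult_left)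
    have i2: "integrable lborel (\<lambda>t. 2 * exp (- T'\<^sup>2 / (4 * T1\<^sup>2)) * normal_density 0 (sqrt 2 * T1) t)"
      using T1 by (intro integrable_mult_right) auto
    have e1: "(\<integral>t. indicator {- T0..T0} t * (1 / T1) \<partial>lborel) = 2 * T0 * (1 / T1)"
      using T0 by simp
    have e2: "(\<integral>t. 2 * exp (- T'\<^sup>2 / (4 * T1\<^sup>2)) * normal_density 0 (sqrt 2 * T1) t \<partial>lborel) = 2 * exp (- T'\<^sup>2 / (4 * T1\<^sup>2))"
      using T1 by simp
    have i3: "integrable lborel (\<lambda>t. Bd * (V t * ?nd t))" using Vi by (rule integrable_mult_right)
    have i4: "integrable lborel (\<lambda>t. suminf b * real (card M) * Y * (indicator {- T0..T0} t * (1 / T1) + 2 * exp (- T'\<^sup>2 / (4 * T1\<^sup>2)) * normal_density 0 (sqrt 2 * T1) t))"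
      by (intro integrable_mult_right Bochner_Integration.integrable_add i1 i2)
    show ?thesis
      unfolding Bochner_Integration.integral_add[OF i3 i4] integral_mult_right_zero Bochner_Integration.integral_add[OF i1 i2]
        e1 e2[unfolded integral_mult_right_zero] by (rule refl)
  qed
  also have "\<dots> \<le> Bd * (gauss_mass * Y) + suminf b * real (card M) * Y * (2 * T0 * (1 / T1) + 2 * exp (- T'\<^sup>2 / (4 * T1\<^sup>2)))"
    using mult_left_mono[OF I1 Bd(1)] by (rule add_right_mono)
  also have "\<dots> = Y * (gauss_mass * Bd + suminf b * real (card M) * (2 * T0 / T1 + 2 * exp (- T'\<^sup>2 / (4 * T1\<^sup>2))))"
    by (simp add: algebra_simps)
  finally show ?thesis unfolding Y_def .
qed

text \<open>Choosing \<open>n k\<close> elements in each block shows that the support is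
  nonempty.\<close>

lemma (in resonator) Y_pos: "Y > 0"
proof -
  have "\<forall>k\<in>I. \<exists>B. B \<subseteq> P k \<and> card B = n k"
    using n obtain_subset_with_card_n by metis
  then obtain B where B: "\<And>k. k \<in> I \<Longrightarrow> B k \<subseteq> P k" "\<And>k. k \<in> I \<Longrightarrow> card (B k) = n k" by metis
  have "(\<Union>k\<in>I. B k) \<inter> P j = B j" if j: "j \<in> I" for j
  proof (intro equalityI subsetI)
    fix x assume "x \<in> (\<Union>k\<in>I. B k) \<inter> P j"
    then obtain k where k: "k \<in> I" "x \<in> B k" "x \<in> P j" by auto
    then have "k = j" using disj[OF k(1) j] B(1)[OF k(1)] by auto
    then show "x \<in> B j" using k by simp
  qed (use B j in auto)
  then have "(\<Union>k\<in>I. B k) \<in> M" using B by (auto simp: M_def)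
  then show ?thesis unfolding Y_def using finite_M f_pos by (intro sum_pos) (auto simp: less_imp_neq[THEN not_sym])
qed

section \<open>Resonance for the smoothed series\<close>

text \<open>The resonance inequality is used with T1 = T / ln T, T0 = \<open>T powr \<beta>'\<close>
  and T' = T / 2. The quantifiers over \<sigma>, m, m0 and Bd stand inside \<open>eventually\<close>
  because \<sigma> is only chosen after T. The multiplier m is 1 for S_1 and
  \<open>2 * (1 - cos (\<delta> * ln (real n)))\<close> for S, hence the range [0, 4].\<close>

lemma resonance_large:
  assumes \<beta>: "0 \<le> \<beta>'" "\<beta>' < 1"
  obtains c where "c > 0"
    "eventually (\<lambda>T. \<forall>\<sigma> m m0 Bd. 1/2 \<le> \<sigma> \<longrightarrow> \<sigma> \<le> 1/2 + 1 / ln (ln T) \<longrightarrow> (\<forall>n. 0 \<le> m n \<and> m n \<le> 4) \<longrightarrow> 0 \<le> m0 \<longrightarrow>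
       (\<forall>p. prime p \<longrightarrow> ln T \<le> real p \<longrightarrow> ln (real p) \<le> 2 * ln (ln T) \<longrightarrow> m0 \<le> m p) \<longrightarrow> 0 \<le> Bd \<longrightarrow>
       (\<forall>t. T powr \<beta>' \<le> t \<longrightarrow> t \<le> T / 2 \<longrightarrow> (\<Sum>n. gcoef \<sigma> (1 / ln (ln T)) n * m n * cos (t * ln (real n))) \<le> Bd) \<longrightarrow>
       c * m0 * sqrt (ln T * ln (ln (ln T)) / ln (ln T) ^ 3) \<le> Bd + 1) at_top"
proof -
  \<comment> \<open>\<kappa> + \<beta>' < 1 makes the contribution of small |t| negligible: it has
    size \<open>T powr (\<kappa> + \<beta>' - 1)\<close> up to factors smaller than any power of
    T.\<close>
  define \<kappa> where "\<kappa> = (1 - \<beta>') / 2"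
  have \<kappa>: "\<kappa> > 0" "\<kappa> + \<beta>' < 1" using \<beta> by (auto simp: \<kappa>_def field_simps)
  obtain c where c: "c > 0" and ev: "eventually (\<lambda>X. \<exists>I P n \<beta>. resonator I P n \<and> real (card (resonator.M I P n)) \<le> exp (\<kappa> * X) \<and>
       (\<forall>k\<in>I. \<forall>p\<in>P k. prime p \<and> X \<le> real p \<and> ln (real p) \<le> 2 * ln X \<and> \<beta> k \<le> 1 / sqrt (real p)) \<and>
       c * sqrt (X * ln (ln X) / ln X) \<le> (\<Sum>k\<in>I. \<beta> k * (sqrt (real (n k) * real (card (P k) - n k + 1)) / 2))) at_top"
    using resonator_exists[OF \<kappa>(1)] by blast
  have evT: "eventually (\<lambda>T. \<exists>I P n \<beta>. resonator I P n \<and> real (card (resonator.M I P n)) \<le> exp (\<kappa> * ln T) \<and>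
       (\<forall>k\<in>I. \<forall>p\<in>P k. prime p \<and> ln T \<le> real p \<and> ln (real p) \<le> 2 * ln (ln T) \<and> \<beta> k \<le> 1 / sqrt (real p)) \<and>
       c * sqrt (ln T * ln (ln (ln T)) / ln (ln T)) \<le> (\<Sum>k\<in>I. \<beta> k * (sqrt (real (n k) * real (card (P k) - n k + 1)) / 2))) at_top"
    using eventually_compose_filterlim[OF ev ln_at_top] .
  define A where "A = 8 * (\<Sum>n. real n powr (-2))"
  have A: "A \<ge> 0" unfolding A_def using summable_real_powr_iff[of "-2"] by (intro mult_nonneg_nonneg suminf_nonneg) auto
  define \<gamma> where "\<gamma> = 1 - \<kappa> - \<beta>'"
  have \<gamma>: "\<gamma> > 0" using \<kappa> by (simp add: \<gamma>_def)
  have lim: "((\<lambda>T. A * exp (9/8 * (ln (ln T))\<^sup>2) * (2 * ln T * exp (- \<gamma> * ln T) + 2 * exp (\<kappa> * ln T - (ln T)\<^sup>2 / 16))) \<longlongrightarrow> 0) at_top"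
  proof -
    have l1: "((\<lambda>T. exp (9/8 * (ln (ln T))\<^sup>2) * (ln T * exp (- \<gamma> * ln T))) \<longlongrightarrow> 0) at_top" using \<gamma> by real_asymp
    have l2: "((\<lambda>T. exp (9/8 * (ln (ln T))\<^sup>2) * exp (\<kappa> * ln T - (ln T)\<^sup>2 / 16)) \<longlongrightarrow> 0) at_top" using \<kappa>(1) by real_asymp
    have "((\<lambda>T. A * (2 * (exp (9/8 * (ln (ln T))\<^sup>2) * (ln T * exp (- \<gamma> * ln T))) + 2 * (exp (9/8 * (ln (ln T))\<^sup>2) * exp (\<kappa> * ln T - (ln T)\<^sup>2 / 16)))) \<longlongrightarrow> A * (2 * 0 + 2 * 0)) at_top"
      by (intro tendsto_intros l1 l2)
    then show ?thesis by (simp add: algebra_simps)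
  qed
  have gm: "0 < gauss_mass" by (rule gauss_mass_pos)
  have ev1: "eventually (\<lambda>T. A * exp (9/8 * (ln (ln T))\<^sup>2) * (2 * ln T * exp (- \<gamma> * ln T) + 2 * exp (\<kappa> * ln T - (ln T)\<^sup>2 / 16)) < gauss_mass) at_top"
    by (rule order_tendstoD(2)[OF lim gm])
  have ev2: "eventually (\<lambda>T::real. T > 1 \<and> ln T > 1 \<and> ln (ln T) \<ge> 1) at_top"
    by (intro eventually_conj; real_asymp)
  define c' where "c' = (1/2) * exp (-1/2) * (exp (-4) / 2) * c / gauss_mass"
  show ?thesis
  proof (rule that[of c'])
    show "c' > 0" using c gm by (simp add: c'_def)
    show "eventually (\<lambda>T. \<forall>\<sigma> m m0 Bd. 1/2 \<le> \<sigma> \<longrightarrow> \<sigma> \<le> 1/2 + 1 / ln (ln T) \<longrightarrow> (\<forall>n. 0 \<le> m n \<and> m n \<le> 4) \<longrightarrow> 0 \<le> m0 \<longrightarrow>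
       (\<forall>p. prime p \<longrightarrow> ln T \<le> real p \<longrightarrow> ln (real p) \<le> 2 * ln (ln T) \<longrightarrow> m0 \<le> m p) \<longrightarrow> 0 \<le> Bd \<longrightarrow>
       (\<forall>t. T powr \<beta>' \<le> t \<longrightarrow> t \<le> T / 2 \<longrightarrow> (\<Sum>n. gcoef \<sigma> (1 / ln (ln T)) n * m n * cos (t * ln (real n))) \<le> Bd) \<longrightarrow>
       c' * m0 * sqrt (ln T * ln (ln (ln T)) / ln (ln T) ^ 3) \<le> Bd + 1) at_top"
      using evT ev1 ev2
    proof eventually_elim
      case (elim T)
      define X where "X = ln T"
      define l2 where "l2 = ln X"
      define \<delta> where "\<delta> = 1 / l2"
      have T: "T > 1" "X > 1" "l2 \<ge> 1" using elim(3) by (auto simp: X_def l2_def)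
      have TX: "T = exp X" using T by (simp add: X_def)
      have \<delta>: "\<delta> > 0" using T by (simp add: \<delta>_def)
      obtain I P n \<beta> where "resonator I P n" and cardM: "real (card (resonator.M I P n)) \<le> exp (\<kappa> * X)"
        and pr: "\<And>k p. k \<in> I \<Longrightarrow> p \<in> P k \<Longrightarrow> prime p \<and> X \<le> real p \<and> ln (real p) \<le> 2 * l2 \<and> \<beta> k \<le> 1 / sqrt (real p)"
        and main: "c * sqrt (X * ln l2 / l2) \<le> (\<Sum>k\<in>I. \<beta> k * (sqrt (real (n k) * real (card (P k) - n k + 1)) / 2))"
        using elim(1) unfolding X_def[symmetric] l2_def[symmetric] by blast
      interpret resonator I P n by fact
      show ?case
      proof (intro allI impI)
        fix \<sigma> m0 Bd :: real and m :: "nat \<Rightarrow> real"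
        assume \<sigma>: "1/2 \<le> \<sigma>" "\<sigma> \<le> 1/2 + 1 / ln (ln T)" and m: "\<forall>n. 0 \<le> m n \<and> m n \<le> 4" and m0: "0 \<le> m0"
          and mp: "\<forall>p. prime p \<longrightarrow> ln T \<le> real p \<longrightarrow> ln (real p) \<le> 2 * ln (ln T) \<longrightarrow> m0 \<le> m p" and Bd: "0 \<le> Bd"
          and D: "\<forall>t. T powr \<beta>' \<le> t \<longrightarrow> t \<le> T / 2 \<longrightarrow> (\<Sum>n. gcoef \<sigma> (1 / ln (ln T)) n * m n * cos (t * ln (real n))) \<le> Bd"
        define b where "b n = gcoef \<sigma> \<delta> n * m n" for n
        have b0: "b n \<ge> 0" for n using gcoef_nonneg m by (simp add: b_def)
        have bs: "summable b" and bS: "suminf b \<le> A * exp (9/8 * l2\<^sup>2)"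
        proof -
          have le: "b n \<le> gcoef \<sigma> \<delta> n * 4" for n unfolding b_def using gcoef_nonneg m by (intro mult_left_mono) auto
          have sm: "summable (\<lambda>n. gcoef \<sigma> \<delta> n * 4)" by (intro summable_mult2 gcoef_summable \<sigma> \<delta>)
          show bs: "summable b" by (rule summable_comparison_test'[OF sm, of 0]) (use le b0 in auto)
          have "suminf b \<le> suminf (\<lambda>n. gcoef \<sigma> \<delta> n * 4)" by (rule suminf_le[OF le bs sm])
          also have "\<dots> = suminf (gcoef \<sigma> \<delta>) * 4" by (rule suminf_mult2[symmetric]) (intro gcoef_summable \<sigma> \<delta>)
          also have "\<dots> \<le> (2 * (\<Sum>n. real n powr (-2)) * exp (9 / (8 * \<delta>\<^sup>2))) * 4"
            by (intro mult_right_mono gcoef_suminf_le \<sigma> \<delta>) auto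
          also have "\<dots> = A * exp (9/8 * l2\<^sup>2)" by (simp add: A_def \<delta>_def power_divide)
          finally show "suminf b \<le> A * exp (9/8 * l2\<^sup>2)" .
        qed
        \<comment> \<open>The three factors of \<open>gcoef\<close> at a resonator prime: 1 / ln p
          is at least 1 / (2 l2), p^(-\<sigma>) is at least exp (-2) / sqrt p as (\<sigma> - 1/2) ln
          p \<le> 2, and the cutoff is at least exp (-2) as \<delta> ln p \<le> 2.\<close>
        have bp: "m0 * (exp (-4) / (2 * l2)) * \<beta> k \<le> b p" if k: "k \<in> I" and p: "p \<in> P k" for k p
        proof -
          have p': "prime p" "X \<le> real p" "ln (real p) \<le> 2 * l2" "\<beta> k \<le> 1 / sqrt (real p)" using pr[OF k p] by auto
          have p1: "real p > 1" using p'(2) T(2) by linarith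
          then have lp: "ln (real p) > 0" by simp
          have e1: "exp (-2) \<le> exp (- (\<delta> * ln (real p))\<^sup>2 / 2)"
          proof -
            have "\<delta> * ln (real p) \<le> 2" using p'(3) T by (simp add: \<delta>_def field_simps)
            then have "(\<delta> * ln (real p))\<^sup>2 \<le> 2\<^sup>2" using \<delta> lp by (intro power_mono) auto
            then show ?thesis by simp
          qed
          have e2: "exp (-2) * (1 / sqrt (real p)) \<le> real p powr (- \<sigma>)"
          proof -
            have "(\<sigma> - 1/2) * ln (real p) \<le> (1 / l2) * (2 * l2)"
              using \<sigma> p'(3) lp T by (intro mult_mono) (auto simp: l2_def X_def)
            then have "(\<sigma> - 1/2) * ln (real p) \<le> 2" using T by simp
            then have "exp (-2) * exp (- (1/2) * ln (real p)) \<le> exp (- \<sigma> * ln (real p))"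
              unfolding mult_exp_exp by (simp add: algebra_simps)
            moreover have "exp (- (1/2) * ln (real p)) = 1 / sqrt (real p)"
              using p1 by (simp add: powr_half_sqrt[symmetric] powr_def exp_minus field_simps)
            ultimately show ?thesis using p1 by (simp add: powr_def)
          qed
          have e3: "1 / (2 * l2) \<le> vm2 p"
            using p'(1,3) lp T by (simp add: vm2_def vm_prime frac_le)
          have a1: "(1 / (2 * l2)) * (exp (-2) * (1 / sqrt (real p))) * exp (-2) \<le> vm2 p * real p powr (- \<sigma>) * exp (- (\<delta> * ln (real p))\<^sup>2 / 2)"
            using e1 e2 e3 T by (intro mult_mono mult_nonneg_nonneg) (auto simp: vm2_nonneg)
          have a2: "(1 / (2 * l2)) * (exp (-2) * (1 / sqrt (real p))) * exp (-2) = exp (-4) / (2 * l2) * (1 / sqrt (real p))"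
          proof -
            have "exp (-2) * exp (-2::real) = exp (-4)" by (simp add: mult_exp_exp)
            then show ?thesis by (simp add: field_simps)
          qed
          have g: "exp (-4) / (2 * l2) * (1 / sqrt (real p)) \<le> gcoef \<sigma> \<delta> p" using a1 unfolding a2 gcoef_def .
          have "m0 * (exp (-4) / (2 * l2)) * \<beta> k \<le> m0 * (exp (-4) / (2 * l2)) * (1 / sqrt (real p))"
            using m0 T p'(4) by (intro mult_left_mono) auto
          also have "\<dots> = m0 * (exp (-4) / (2 * l2) * (1 / sqrt (real p)))" by (rule mult.assoc)
          also have "\<dots> \<le> m p * gcoef \<sigma> \<delta> p"
            using g mp p' m0 m T by (intro mult_mono) (auto simp: l2_def X_def)
          finally show ?thesis by (simp add: b_def mult.commute)
        qed
        have PU: "finite (\<Union>k\<in>I. P k)" using I P by auto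
        have finA: "finite A'" if "A' \<in> M" for A' using that PU by (auto simp: M_def intro: finite_subset)
        have T1: "T / X > 0" using T by simp
        have res: "(1/2) * exp (-1/2) * (\<Sum>p\<in>(\<Union>k\<in>I. P k). b p * (\<Sum>x\<in>ext_dom p. f x * f (insert p x)))
          \<le> (\<Sum>x\<in>M. (f x)\<^sup>2) * (gauss_mass * Bd + suminf b * real (card M) * (2 * T powr \<beta>' / (T / X) + 2 * exp (- (T / 2)\<^sup>2 / (4 * (T / X)\<^sup>2))))"
        \<comment> \<open>The frequency of a set is the logarithm of the product of its
          primes.\<close>
        proof (rule resonance_bound[where lam = "\<lambda>A. \<Sum>p\<in>A. ln (real p)"])
          show "f x \<ge> 0" for x using f_pos[of x] by simp
          show "ext_dom p \<subseteq> M" "inj_on (insert p) (ext_dom p)" for p by (auto simp: ext_dom_def inj_on_def)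
          show "insert p x \<in> M" if "x \<in> ext_dom p" for p x using that by (simp add: ext_dom_def)
          show "(\<Sum>q\<in>insert p x. ln (real q)) = (\<Sum>q\<in>x. ln (real q)) + ln (real p)" if "x \<in> ext_dom p" for p x
            using that finA[of x] by (simp add: ext_dom_def)
          show "(\<Sum>n. b n * cos (t * ln (real n))) \<le> Bd" if "T powr \<beta>' \<le> t" "t \<le> T / 2" for t
            using D that by (simp add: b_def \<delta>_def l2_def X_def)
        qed (use finite_M b0 bs T1 PU Bd T in auto)
        have lower: "m0 * (exp (-4) / (2 * l2)) * (c * sqrt (X * ln l2 / l2)) * Y \<le> (\<Sum>p\<in>(\<Union>k\<in>I. P k). b p * (\<Sum>x\<in>ext_dom p. f x * f (insert p x)))"
        proof -
          have "m0 * (exp (-4) / (2 * l2)) * (c * sqrt (X * ln l2 / l2)) \<le> m0 * (exp (-4) / (2 * l2)) * (\<Sum>k\<in>I. \<beta> k * (sqrt (real (n k) * real (card (P k) - n k + 1)) / 2))"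
            using main m0 T by (intro mult_left_mono) auto
          also have "\<dots> = (\<Sum>k\<in>I. (m0 * (exp (-4) / (2 * l2)) * \<beta> k) * (sqrt (real (n k) * real (card (P k) - n k + 1)) / 2))"
            unfolding sum_distrib_left by (simp only: mult.assoc)
          finally have "m0 * (exp (-4) / (2 * l2)) * (c * sqrt (X * ln l2 / l2)) * Y \<le> (\<Sum>k\<in>I. (m0 * (exp (-4) / (2 * l2)) * \<beta> k) * (sqrt (real (n k) * real (card (P k) - n k + 1)) / 2)) * Y"
            using Y_pos by (intro mult_right_mono) auto
          also have "\<dots> \<le> (\<Sum>p\<in>(\<Union>k\<in>I. P k). b p * (\<Sum>x\<in>ext_dom p. f x * f (insert p x)))"
            by (rule resonator_sum[OF bp])
          finally show ?thesis .
        qed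
        define Err where "Err = suminf b * real (card M) * (2 * T powr \<beta>' / (T / X) + 2 * exp (- (T / 2)\<^sup>2 / (4 * (T / X)\<^sup>2)))"
        have Err: "Err \<le> gauss_mass"
        proof -
          have e1: "2 * T powr \<beta>' / (T / X) = 2 * X * exp (\<beta>' * X - X)"
          proof -
            have "T powr \<beta>' = exp (\<beta>' * X)" using T by (simp add: powr_def X_def)
            then show ?thesis using T unfolding exp_diff TX[symmetric] by (simp add: field_simps)
          qed
          have e2: "- (T / 2)\<^sup>2 / (4 * (T / X)\<^sup>2) = - X\<^sup>2 / 16" using T by (simp add: power_divide field_simps)
          have "Err \<le> (A * exp (9/8 * l2\<^sup>2)) * exp (\<kappa> * X) * (2 * X * exp (\<beta>' * X - X) + 2 * exp (- X\<^sup>2 / 16))"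
            unfolding Err_def e1 e2 using bS cardM A T suminf_nonneg[OF bs b0]
            by (intro mult_mono add_nonneg_nonneg mult_nonneg_nonneg) auto
          also have "\<dots> = A * exp (9/8 * l2\<^sup>2) * (2 * X * (exp (\<kappa> * X) * exp (\<beta>' * X - X)) + 2 * (exp (\<kappa> * X) * exp (- X\<^sup>2 / 16)))"
            by (simp add: algebra_simps)
          also have "exp (\<kappa> * X) * exp (\<beta>' * X - X) = exp (- \<gamma> * X)" unfolding mult_exp_exp \<gamma>_def by (simp add: algebra_simps)
          also have "exp (\<kappa> * X) * exp (- X\<^sup>2 / 16) = exp (\<kappa> * X - X\<^sup>2 / 16)" unfolding mult_exp_exp by simp
          also have "A * exp (9/8 * l2\<^sup>2) * (2 * X * exp (- \<gamma> * X) + 2 * exp (\<kappa> * X - X\<^sup>2 / 16)) < gauss_mass"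
            using elim(2) unfolding X_def[symmetric] l2_def[symmetric] .
          finally show ?thesis by simp
        qed
        have "(1/2) * exp (-1/2) * (m0 * (exp (-4) / (2 * l2)) * (c * sqrt (X * ln l2 / l2))) * Y
           = (1/2) * exp (-1/2) * (m0 * (exp (-4) / (2 * l2)) * (c * sqrt (X * ln l2 / l2)) * Y)" by (rule mult.assoc)
        also have "\<dots> \<le> (1/2) * exp (-1/2) * (\<Sum>p\<in>(\<Union>k\<in>I. P k). b p * (\<Sum>x\<in>ext_dom p. f x * f (insert p x)))"
          by (intro mult_left_mono lower) auto
        also have "\<dots> \<le> Y * (gauss_mass * Bd + Err)" using res unfolding Err_def Y_def .
        also have "\<dots> \<le> Y * (gauss_mass * Bd + gauss_mass)" using Err Y_pos by (intro mult_left_mono) auto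
        also have "\<dots> = (gauss_mass * (Bd + 1)) * Y" by (simp add: algebra_simps)
        finally have "(1/2) * exp (-1/2) * (m0 * (exp (-4) / (2 * l2)) * (c * sqrt (X * ln l2 / l2))) \<le> gauss_mass * (Bd + 1)"
          using Y_pos by (simp only: mult_le_cancel_right_pos)
        then have "(1/2) * exp (-1/2) * (m0 * (exp (-4) / (2 * l2)) * (c * sqrt (X * ln l2 / l2))) / gauss_mass \<le> Bd + 1"
          by (simp only: pos_divide_le_eq[OF gm] mult.commute[of _ gauss_mass])
        moreover have "(1/2) * exp (-1/2) * (m0 * (exp (-4) / (2 * l2)) * (c * sqrt (X * ln l2 / l2))) / gauss_mass = c' * m0 * sqrt (X * ln l2 / l2 ^ 3)"
        proof -
          \<comment> \<open>The factor 1 / l2, which comes from \<open>vm2\<close>, moves under the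
            root and turns l2 into its cube.\<close>
          have "sqrt (X * ln l2 / l2) / l2 = sqrt (X * ln l2 / l2 ^ 3)"
          proof -
            have "X * ln l2 / l2 ^ 3 = (X * ln l2 / l2) / l2\<^sup>2" by (simp add: power2_eq_square power3_eq_cube)
            then have "sqrt (X * ln l2 / l2 ^ 3) = sqrt (X * ln l2 / l2) / sqrt (l2\<^sup>2)" by (simp only: real_sqrt_divide[of "X * ln l2 / l2"])
            then show ?thesis using T by simp
          qed
          note q = this
          show ?thesis unfolding c'_def q[symmetric] by (simp add: field_simps)
        qed
        ultimately show "c' * m0 * sqrt (ln T * ln (ln (ln T)) / ln (ln T) ^ 3) \<le> Bd + 1"
          unfolding X_def[symmetric] l2_def[symmetric] by simp
      qed
    qed
  qed
qed

section \<open>Large values\<close>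

lemma normal_conv_upper:
  assumes \<delta>: "\<delta> > 0" and q: "integrable lborel (\<lambda>u. q u * normal_density 0 \<delta> u)"
    and w: "integrable lborel (\<lambda>u. indicator {u. b0 < \<bar>u\<bar>} u * (w u * normal_density 0 \<delta> u))"
    and wle: "(\<integral>u. indicator {u. b0 < \<bar>u\<bar>} u * (w u * normal_density 0 \<delta> u) \<partial>lborel) \<le> \<tau>"
    and B: "0 \<le> B" "\<And>u. \<bar>u\<bar> \<le> b0 \<Longrightarrow> q u \<le> B" and qw: "\<And>u. q u \<le> w u"
  shows "(\<integral>u. q u * normal_density 0 \<delta> u \<partial>lborel) \<le> B + \<tau>"
proof -
  have i: "integrable lborel (\<lambda>u. B * normal_density 0 \<delta> u)" using \<delta> by (intro integrable_mult_right) auto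
  have "(\<integral>u. q u * normal_density 0 \<delta> u \<partial>lborel) \<le> (\<integral>u. B * normal_density 0 \<delta> u + indicator {u. b0 < \<bar>u\<bar>} u * (w u * normal_density 0 \<delta> u) \<partial>lborel)"
  proof (rule integral_mono[OF q Bochner_Integration.integrable_add[OF i w]])
    fix u
    show "q u * normal_density 0 \<delta> u \<le> B * normal_density 0 \<delta> u + indicator {u. b0 < \<bar>u\<bar>} u * (w u * normal_density 0 \<delta> u)"
    proof (cases "\<bar>u\<bar> \<le> b0")
      case True
      then show ?thesis using mult_right_mono[OF B(2)[OF True] normal_density_nonneg[of 0 \<delta> u]] by (simp add: indicator_def)
    next
      case False
      have "0 \<le> B * normal_density 0 \<delta> u" using B(1) by simp
      then show ?thesis using mult_right_mono[OF qw[of u] normal_density_nonneg[of 0 \<delta> u]] False by (simp add: indicator_def)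
    qed
  qed
  also have "\<dots> = B + (\<integral>u. indicator {u. b0 < \<bar>u\<bar>} u * (w u * normal_density 0 \<delta> u) \<partial>lborel)"
    unfolding Bochner_Integration.integral_add[OF i w] using \<delta> by simp
  finally show ?thesis using wle by linarith
qed

section \<open>Upper bounds for Gaussian means near the critical line\<close>

context zeta_log
begin

text \<open>By \<open>sm_s1\<close> this differs from pi times \<open>s1 \<sigma>\<close> by at most
  50, uniformly in \<sigma>.\<close>

definition sm :: "real \<Rightarrow> real \<Rightarrow> real" where "sm \<sigma> t = - Re (LL (Complex \<sigma> t))"

definition conv :: "real \<Rightarrow> real \<Rightarrow> real \<Rightarrow> real" where
  "conv \<sigma> \<delta> t = (\<integral>u. sm \<sigma> (t + u) * normal_density 0 \<delta> u \<partial>lborel)"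

definition C0 :: real where "C0 = 2 * (\<Sum>n. real n powr (-2)) + 32"

lemma C0_pos: "C0 > 0"
  unfolding C0_def using summable_real_powr_iff[of "-2"] by (intro add_nonneg_pos mult_nonneg_nonneg suminf_nonneg) auto

lemma sm_integrable:
  assumes "1/2 < \<sigma>" "\<sigma> \<le> 2" "\<delta> > 0"
  shows "integrable lborel (\<lambda>u. sm \<sigma> (t + u) * normal_density 0 \<delta> u)"
proof -
  have "integrable lborel (\<lambda>u. Re (LL (Complex \<sigma> (t + u)) * of_real (normal_density 0 \<delta> u)))"
    by (rule integrable_Re[OF LL_conv_integrable[OF assms]])
  then have "integrable lborel (\<lambda>u. - (Re (LL (Complex \<sigma> (t + u)) * of_real (normal_density 0 \<delta> u))))"
    by (rule Bochner_Integration.integrable_minus)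
  then show ?thesis by (simp add: sm_def)
qed

lemma conv_series:
  assumes "1/2 < \<sigma>" "\<sigma> \<le> 2" "0 < \<delta>" "\<delta> \<le> 1"
  shows "\<bar>conv \<sigma> \<delta> t - (\<Sum>n. gcoef \<sigma> \<delta> n * cos (t * ln (real n)))\<bar> \<le> 32 * exp (9 / (8 * \<delta>\<^sup>2)) / (1 + \<bar>t\<bar>)"
  using LL_conv_formula[OF assms, of t] by (simp add: conv_def sm_def)

lemma gcoef_cos_summable:
  assumes "\<sigma> \<ge> 1/2" "\<delta> > 0"
  shows "summable (\<lambda>n. gcoef \<sigma> \<delta> n * cos (t * ln (real n)))"
  by (rule summable_comparison_test'[OF gcoef_summable[OF assms], of 0])
     (use gcoef_nonneg in \<open>auto simp: abs_mult mult_left_le\<close>)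

lemma conv_bound:
  assumes "1/2 < \<sigma>" "\<sigma> \<le> 2" "0 < \<delta>" "\<delta> \<le> 1"
  shows "\<bar>conv \<sigma> \<delta> t\<bar> \<le> C0 * exp (9 / (8 * \<delta>\<^sup>2))"
proof -
  have gs: "summable (gcoef \<sigma> \<delta>)" using assms by (intro gcoef_summable) auto
  have an: "summable (\<lambda>n. norm (gcoef \<sigma> \<delta> n * cos (t * ln (real n))))"
    by (rule summable_comparison_test'[OF gs, of 0]) (use gcoef_nonneg in \<open>auto simp: abs_mult mult_left_le\<close>)
  have "\<bar>\<Sum>n. gcoef \<sigma> \<delta> n * cos (t * ln (real n))\<bar> \<le> (\<Sum>n. norm (gcoef \<sigma> \<delta> n * cos (t * ln (real n))))"
    using summable_norm[OF an] by simp
  also have "\<dots> \<le> suminf (gcoef \<sigma> \<delta>)"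
    by (rule suminf_le[OF _ an gs]) (use gcoef_nonneg in \<open>auto simp: abs_mult mult_left_le\<close>)
  also have "\<dots> \<le> 2 * (\<Sum>n. real n powr (-2)) * exp (9 / (8 * \<delta>\<^sup>2))" using assms by (intro gcoef_suminf_le) auto
  finally have "\<bar>\<Sum>n. gcoef \<sigma> \<delta> n * cos (t * ln (real n))\<bar> \<le> 2 * (\<Sum>n. real n powr (-2)) * exp (9 / (8 * \<delta>\<^sup>2))" .
  moreover have "32 * exp (9 / (8 * \<delta>\<^sup>2)) / (1 + \<bar>t\<bar>) \<le> 32 * exp (9 / (8 * \<delta>\<^sup>2)) / 1" by (intro divide_left_mono) auto
  ultimately show ?thesis using conv_series[OF assms, of t] by (simp add: C0_def distrib_right)
qed

text \<open>Only an upper bound for \<open>sm\<close> is available, but \<open>\<bar>sm\<bar> \<le> 2 K (1 + \<bar>\<cdot>\<bar>) - sm\<close>, and the mean of \<open>sm\<close> against the wider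
  Gaussian is known from the explicit formula.\<close>
lemma sm_tail:
  assumes K: "\<And>s. 1/2 < Re s \<Longrightarrow> Re s \<le> 2 \<Longrightarrow> - Re (LL s) \<le> K * (1 + \<bar>Im s\<bar>)" "K > 0"
    and \<sigma>: "1/2 < \<sigma>" "\<sigma> \<le> 2" and \<delta>: "0 < \<delta>" "\<delta> \<le> 1/2" and b0: "b0 \<ge> 0"
  shows "integrable lborel (\<lambda>u. indicator {u. b0 < \<bar>u\<bar>} u * (\<bar>sm \<sigma> (t + u)\<bar> * normal_density 0 \<delta> u))"
    and "(\<integral>u. indicator {u. b0 < \<bar>u\<bar>} u * (\<bar>sm \<sigma> (t + u)\<bar> * normal_density 0 \<delta> u) \<partial>lborel)
      \<le> 2 * exp (- b0\<^sup>2 / (4 * \<delta>\<^sup>2)) * (2 * K * (2 + \<bar>t\<bar>) + C0 * exp (9 / (8 * \<delta>\<^sup>2)))"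
proof -
  have i: "integrable lborel (\<lambda>u. \<bar>sm \<sigma> (t + u)\<bar> * normal_density 0 d u)" if "d > 0" for d
    using integrable_abs[OF sm_integrable[OF \<sigma> that, of t]] by (simp add: abs_mult)
  show i1: "integrable lborel (\<lambda>u. indicator {u. b0 < \<bar>u\<bar>} u * (\<bar>sm \<sigma> (t + u)\<bar> * normal_density 0 \<delta> u))"
    using integrable_mult_indicator[OF _ i[OF \<delta>(1)], of "{u. b0 < \<bar>u\<bar>}"] by simp
  \<comment> \<open>The standard deviation of the wider Gaussian produced by
    \<open>normal_density_tail\<close>; \<delta> \<le> 1/2 ensures d \<le> 1, as
    \<open>conv_bound\<close> requires.\<close>
  define d where "d = sqrt 2 * \<delta>"
  have s2: "sqrt 2 \<le> (2::real)" by (rule real_le_lsqrt) auto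
  have d: "0 < d" "d \<le> 1" "\<delta> \<le> d"
  proof -
    show "0 < d" using \<delta> by (simp add: d_def)
    show "d \<le> 1" using mult_mono[OF s2 \<delta>(2)] \<delta> by (simp add: d_def)
    show "\<delta> \<le> d" using \<delta> by (simp add: d_def)
  qed
  define e where "e = 2 * exp (- b0\<^sup>2 / (4 * \<delta>\<^sup>2))"
  have iK: "integrable lborel (\<lambda>u. 2 * K * ((1 + \<bar>t\<bar>) * normal_density 0 d u + normal_density 0 d u * \<bar>u\<bar>))"
    using d normal_density_integrable_abs(1)[OF d(1)] by (intro integrable_mult_right Bochner_Integration.integrable_add) auto
  have "(\<integral>u. indicator {u. b0 < \<bar>u\<bar>} u * (\<bar>sm \<sigma> (t + u)\<bar> * normal_density 0 \<delta> u) \<partial>lborel) \<le> (\<integral>u. e * (\<bar>sm \<sigma> (t + u)\<bar> * normal_density 0 d u) \<partial>lborel)"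
  proof (rule integral_mono[OF i1])
    show "integrable lborel (\<lambda>u. e * (\<bar>sm \<sigma> (t + u)\<bar> * normal_density 0 d u))" by (intro integrable_mult_right i d)
    fix u
    show "indicator {u. b0 < \<bar>u\<bar>} u * (\<bar>sm \<sigma> (t + u)\<bar> * normal_density 0 \<delta> u) \<le> e * (\<bar>sm \<sigma> (t + u)\<bar> * normal_density 0 d u)"
    proof (cases "b0 < \<bar>u\<bar>")
      case True
      have "normal_density 0 \<delta> u \<le> e * normal_density 0 d u"
        unfolding e_def d_def by (rule normal_density_tail) (use \<delta> True b0 in auto)
      then have "\<bar>sm \<sigma> (t + u)\<bar> * normal_density 0 \<delta> u \<le> \<bar>sm \<sigma> (t + u)\<bar> * (e * normal_density 0 d u)" by (intro mult_left_mono) auto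
      then show ?thesis using True by (simp add: indicator_def mult_ac)
    next
      case False
      have "0 \<le> e * (\<bar>sm \<sigma> (t + u)\<bar> * normal_density 0 d u)" by (simp add: e_def)
      then show ?thesis using False by (simp add: indicator_def)
    qed
  qed
  also have "\<dots> = e * (\<integral>u. \<bar>sm \<sigma> (t + u)\<bar> * normal_density 0 d u \<partial>lborel)" by simp
  also have "\<dots> \<le> e * (2 * K * (2 + \<bar>t\<bar>) + C0 * exp (9 / (8 * \<delta>\<^sup>2)))"
  proof (rule mult_left_mono)
    have "(\<integral>u. \<bar>sm \<sigma> (t + u)\<bar> * normal_density 0 d u \<partial>lborel) \<le> (\<integral>u. 2 * K * ((1 + \<bar>t\<bar>) * normal_density 0 d u + normal_density 0 d u * \<bar>u\<bar>) - sm \<sigma> (t + u) * normal_density 0 d u \<partial>lborel)"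
    proof (rule integral_mono[OF i[OF d(1)]])
      show "integrable lborel (\<lambda>u. 2 * K * ((1 + \<bar>t\<bar>) * normal_density 0 d u + normal_density 0 d u * \<bar>u\<bar>) - sm \<sigma> (t + u) * normal_density 0 d u)"
        by (intro Bochner_Integration.integrable_diff iK sm_integrable \<sigma> d)
      fix u
      have "sm \<sigma> (t + u) \<le> K * (1 + \<bar>t + u\<bar>)" using K(1)[of "Complex \<sigma> (t + u)"] \<sigma> by (simp add: sm_def)
      moreover have "K * (1 + \<bar>t + u\<bar>) \<le> K * (1 + \<bar>t\<bar> + \<bar>u\<bar>)" using K(2) by (intro mult_left_mono) auto
      moreover have "0 \<le> K * (1 + \<bar>t\<bar> + \<bar>u\<bar>)" using K(2) by simp
      ultimately have "\<bar>sm \<sigma> (t + u)\<bar> \<le> 2 * (K * (1 + \<bar>t\<bar> + \<bar>u\<bar>)) - sm \<sigma> (t + u)" by linarith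
      then have "\<bar>sm \<sigma> (t + u)\<bar> * normal_density 0 d u \<le> (2 * (K * (1 + \<bar>t\<bar> + \<bar>u\<bar>)) - sm \<sigma> (t + u)) * normal_density 0 d u"
        by (intro mult_right_mono) auto
      then show "\<bar>sm \<sigma> (t + u)\<bar> * normal_density 0 d u \<le> 2 * K * ((1 + \<bar>t\<bar>) * normal_density 0 d u + normal_density 0 d u * \<bar>u\<bar>) - sm \<sigma> (t + u) * normal_density 0 d u"
        by (simp add: algebra_simps)
    qed
    also have "\<dots> = 2 * K * ((1 + \<bar>t\<bar>) + (\<integral>u. normal_density 0 d u * \<bar>u\<bar> \<partial>lborel)) - conv \<sigma> d t"
    proof -
      have "(\<integral>u. (1 + \<bar>t\<bar>) * normal_density 0 d u + normal_density 0 d u * \<bar>u\<bar> \<partial>lborel) = (1 + \<bar>t\<bar>) + (\<integral>u. normal_density 0 d u * \<bar>u\<bar> \<partial>lborel)"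
        using d normal_density_integrable_abs(1)[OF d(1)] by (subst Bochner_Integration.integral_add) auto
      then show ?thesis unfolding Bochner_Integration.integral_diff[OF iK sm_integrable[OF \<sigma> d(1)]] conv_def integral_mult_right_zero by simp
    qed
    also have "\<dots> \<le> 2 * K * (2 + \<bar>t\<bar>) + C0 * exp (9 / (8 * \<delta>\<^sup>2))"
    proof -
      have "2 * K * ((1 + \<bar>t\<bar>) + (\<integral>u. normal_density 0 d u * \<bar>u\<bar> \<partial>lborel)) \<le> 2 * K * (2 + \<bar>t\<bar>)"
        using normal_density_integrable_abs(2)[OF d(1)] d K(2) by (intro mult_left_mono) auto
      moreover have "- conv \<sigma> d t \<le> C0 * exp (9 / (8 * d\<^sup>2))" using conv_bound[OF \<sigma> d(1,2), of t] by simp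
      moreover have "C0 * exp (9 / (8 * d\<^sup>2)) \<le> C0 * exp (9 / (8 * \<delta>\<^sup>2))"
      proof -
        have "\<delta>\<^sup>2 \<le> d\<^sup>2" using d \<delta> by (intro power_mono) auto
        then have "9 / (8 * d\<^sup>2) \<le> 9 / (8 * \<delta>\<^sup>2)" using \<delta> d by (intro divide_left_mono) auto
        then show ?thesis using C0_pos by (intro mult_left_mono) auto
      qed
      ultimately show ?thesis by linarith
    qed
    finally show "(\<integral>u. \<bar>sm \<sigma> (t + u)\<bar> * normal_density 0 d u \<partial>lborel) \<le> 2 * K * (2 + \<bar>t\<bar>) + C0 * exp (9 / (8 * \<delta>\<^sup>2))" .
  qed (simp add: e_def)
  finally show "(\<integral>u. indicator {u. b0 < \<bar>u\<bar>} u * (\<bar>sm \<sigma> (t + u)\<bar> * normal_density 0 \<delta> u) \<partial>lborel)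
      \<le> 2 * exp (- b0\<^sup>2 / (4 * \<delta>\<^sup>2)) * (2 * K * (2 + \<bar>t\<bar>) + C0 * exp (9 / (8 * \<delta>\<^sup>2)))" unfolding e_def .
qed

text \<open>The demands on a large T. The Gaussian is truncated at |u| = ln T; raising \<beta> to
  \<beta>' and halving T leave room for this window inside [\<open>T powr \<beta>\<close>, T]. The
  first exponential is the tail factor for \<delta> = 1 / ln (ln T). Since \<beta>' \<ge> 1/2, the
  last condition holds even for \<beta> = 0.\<close>

lemma large_value_setup:
  assumes \<beta>: "0 \<le> \<beta>" "\<beta> < 1" and K: "K > 0"
  defines "\<beta>' \<equiv> (1 + \<beta>) / 2"
  shows "eventually (\<lambda>T. T > 1 \<and> ln T > 1 \<and> ln (ln T) \<ge> 2 \<and> 1 \<le> T powr \<beta> \<and>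
      T powr \<beta> + ln T + 1 \<le> T powr \<beta>' \<and> T / 2 + ln T + 1 \<le> T \<and>
      2 * exp (- (ln T)\<^sup>2 * (ln (ln T))\<^sup>2 / 4) * (2 * K * (2 + T) + C0 * exp (9/8 * (ln (ln T))\<^sup>2)) \<le> 1 \<and>
      32 * exp (9/8 * (ln (ln T))\<^sup>2) \<le> T powr \<beta>') at_top"
proof -
  have \<gamma>: "(1 - \<beta>) / 2 > 0" "\<beta>' \<ge> 1/2" using \<beta> by (auto simp: \<beta>'_def)
  define \<gamma> where "\<gamma> = (1 - \<beta>) / 2"
  have \<gamma>0: "\<gamma> > 0" using \<gamma> by (simp add: \<gamma>_def)
  have e1: "eventually (\<lambda>T::real. T > 1 \<and> ln T > 1 \<and> ln (ln T) \<ge> 2 \<and> T / 2 + ln T + 1 \<le> T \<and> 3 * (ln T + 1) \<le> T powr (1/2) \<and> 3 \<le> T powr \<gamma> \<and>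
      32 * exp (9/8 * (ln (ln T))\<^sup>2) \<le> T powr (1/2)) at_top"
    using \<gamma>0 by (intro eventually_conj; real_asymp)
  have l1: "((\<lambda>T::real. exp (- (ln T)\<^sup>2 * (ln (ln T))\<^sup>2 / 4) * (2 + T)) \<longlongrightarrow> 0) at_top" by real_asymp
  have l2: "((\<lambda>T::real. exp (- (ln T)\<^sup>2 * (ln (ln T))\<^sup>2 / 4) * exp (9/8 * (ln (ln T))\<^sup>2)) \<longlongrightarrow> 0) at_top" by real_asymp
  have "((\<lambda>T::real. 4 * K * (exp (- (ln T)\<^sup>2 * (ln (ln T))\<^sup>2 / 4) * (2 + T)) + 2 * C0 * (exp (- (ln T)\<^sup>2 * (ln (ln T))\<^sup>2 / 4) * exp (9/8 * (ln (ln T))\<^sup>2)))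
      \<longlongrightarrow> 4 * K * 0 + 2 * C0 * 0) at_top"
    by (intro tendsto_intros l1 l2)
  then have "((\<lambda>T::real. 4 * K * (exp (- (ln T)\<^sup>2 * (ln (ln T))\<^sup>2 / 4) * (2 + T)) + 2 * C0 * (exp (- (ln T)\<^sup>2 * (ln (ln T))\<^sup>2 / 4) * exp (9/8 * (ln (ln T))\<^sup>2))) \<longlongrightarrow> 0) at_top"
    by simp
  then have e2: "eventually (\<lambda>T::real. 4 * K * (exp (- (ln T)\<^sup>2 * (ln (ln T))\<^sup>2 / 4) * (2 + T)) + 2 * C0 * (exp (- (ln T)\<^sup>2 * (ln (ln T))\<^sup>2 / 4) * exp (9/8 * (ln (ln T))\<^sup>2)) < 1) at_top"
    by (rule order_tendstoD(2)) simp
  show ?thesis using e1 e2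
  proof eventually_elim
    case (elim T)
    have T: "T > 1" using elim(1) by simp
    have half: "T powr (1/2) \<le> T powr \<beta>'" using T \<gamma> by (intro powr_mono) auto
    have one: "1 \<le> T powr \<beta>" using T \<beta> by (simp add: ge_one_powr_ge_zero)
    have "T powr \<beta> * 3 \<le> T powr \<beta> * T powr \<gamma>" using elim(1) by (intro mult_left_mono) auto
    also have "\<dots> = T powr \<beta>'" using \<beta> by (simp add: powr_add[symmetric] \<beta>'_def \<gamma>_def field_simps)
    finally have "T powr \<beta> * 3 \<le> T powr \<beta>'" .
    moreover have "3 * (ln T + 1) \<le> T powr \<beta>'" using elim(1) half by (meson order_trans)
    ultimately have "T powr \<beta> + ln T + 1 \<le> T powr \<beta>'" using one by argo
    moreover have "2 * exp (- (ln T)\<^sup>2 * (ln (ln T))\<^sup>2 / 4) * (2 * K * (2 + T) + C0 * exp (9/8 * (ln (ln T))\<^sup>2)) \<le> 1"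
    proof -
      have "2 * E * (2 * K * (2 + T) + C0 * F) = 4 * K * (E * (2 + T)) + 2 * C0 * (E * F)" for E F :: real
        by (simp add: algebra_simps)
      then show ?thesis using elim(2) by simp
    qed
    ultimately show ?case using elim(1) half one by linarith
  qed
qed

text \<open>Because the lower bound tends to infinity, additive constants cost only a factor 2 in
  the end.\<close>

lemma growth_at_top:
  assumes "a > (0::real)"
  shows "eventually (\<lambda>T. C \<le> a * sqrt (ln T * ln (ln (ln T)) / ln (ln T) ^ 3)) at_top"
proof -
  have "filterlim (\<lambda>T. a * sqrt (ln T * ln (ln (ln T)) / ln (ln T) ^ 3)) at_top at_top" using assms by real_asymp
  then show ?thesis by (simp add: filterlim_at_top)
qed

lemma sm_s1:
  assumes "1/2 < \<sigma>" "\<sigma> \<le> 2" "t \<ge> 1"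
  shows "\<bar>sm \<sigma> t - pi * s1 \<sigma> t\<bar> \<le> 50"
proof -
  have "sm \<sigma> t - pi * s1 \<sigma> t = - Re (plog_prim (Complex \<sigma> t))" by (simp add: sm_def s1_def)
  then show ?thesis using norm_plog_prim_upper_strip[of "Complex \<sigma> t"] abs_Re_le_cmod[of "plog_prim (Complex \<sigma> t)"] assms by simp
qed

text \<open>A real supremum is only meaningful for a set bounded above; this fact and
  \<open>S_bdd\<close> make the suprema of the theorem usable.\<close>

lemma S1_bdd:
  assumes "T \<ge> 1" "a \<ge> 0"
  shows "bdd_above (S1 ` {a..T})"
proof -
  obtain B where B: "B > 0" "\<And>t. t \<in> {0..T} \<Longrightarrow> \<bar>S t\<bar> \<le> B" using S_bounded[of T] by blast
  have "S1 t \<le> B * T" if t: "t \<in> {a..T}" for t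
  proof -
    have t': "0 \<le> t" "t \<le> T" using t assms by auto
    have si: "S integrable_on {0..t}" by (rule integrable_on_subinterval[OF S_integrable_and_approx(1)[OF assms(1)]]) (use t' in auto)
    have "integral {0..t} S \<le> integral {0..t} (\<lambda>_. B)"
      by (rule integral_le[OF si]) (use B(2) t' in \<open>auto simp: abs_le_iff\<close>)
    also have "\<dots> = B * t" using t' by simp
    also have "\<dots> \<le> B * T" using B(1) t' by simp
    finally show ?thesis by (simp add: S1_def)
  qed
  then show ?thesis by (rule bdd_aboveI2[of _ _ "B * T"])
qed

lemma S_bdd:
  assumes "a \<ge> 0"
  shows "bdd_above ((\<lambda>t. \<bar>S t\<bar>) ` {a..T})"
proof -
  obtain B where B: "B > 0" "\<And>t. t \<in> {0..T} \<Longrightarrow> \<bar>S t\<bar> \<le> B" using S_bounded[of T] by blast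
  show ?thesis by (rule bdd_aboveI2[of _ _ B]) (use B(2) assms in auto)
qed

section \<open>Large values of S_1\<close>

text \<open>An upper bound B1 for S_1 passes through \<open>s1 \<sigma>\<close>,
  \<open>sm \<sigma>\<close> and the Gaussian mean to the smoothed series, losing only bounded
  constants; \<open>resonance_large\<close> with m = 1 then bounds B1 from below.\<close>

lemma S1_large:
  assumes \<beta>: "0 \<le> \<beta>" "\<beta> < 1"
  obtains c where "c > 0"
    "eventually (\<lambda>T. c * sqrt (ln T * ln (ln (ln T)) / ln (ln T) ^ 3) \<le> (SUP t\<in>{T powr \<beta>..T}. S1 t)) at_top"
proof -
  define \<beta>' where "\<beta>' = (1 + \<beta>) / 2"
  have \<beta>': "0 \<le> \<beta>'" "\<beta>' < 1" using \<beta> by (auto simp: \<beta>'_def)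
  obtain K where K: "K > 0" "\<And>s. 1/2 < Re s \<Longrightarrow> Re s \<le> 2 \<Longrightarrow> - Re (LL s) \<le> K * (1 + \<bar>Im s\<bar>)"
    using minus_Re_LL_upper by blast
  obtain c where c: "c > 0" and evr: "eventually (\<lambda>T. \<forall>\<sigma> m m0 Bd. 1/2 \<le> \<sigma> \<longrightarrow> \<sigma> \<le> 1/2 + 1 / ln (ln T) \<longrightarrow> (\<forall>n. 0 \<le> m n \<and> m n \<le> 4) \<longrightarrow> 0 \<le> m0 \<longrightarrow>
       (\<forall>p. prime p \<longrightarrow> ln T \<le> real p \<longrightarrow> ln (real p) \<le> 2 * ln (ln T) \<longrightarrow> m0 \<le> m p) \<longrightarrow> 0 \<le> Bd \<longrightarrow>
       (\<forall>t. T powr \<beta>' \<le> t \<longrightarrow> t \<le> T / 2 \<longrightarrow> (\<Sum>n. gcoef \<sigma> (1 / ln (ln T)) n * m n * cos (t * ln (real n))) \<le> Bd) \<longrightarrow>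
       c * m0 * sqrt (ln T * ln (ln (ln T)) / ln (ln T) ^ 3) \<le> Bd + 1) at_top"
    using resonance_large[OF \<beta>'] by blast
  \<comment> \<open>S_1 and \<open>s1 \<sigma>\<close> are compared through their increments from 1.
    This leaves S_1(1), an upper bound for \<open>s1 \<sigma> 1\<close> uniform in \<sigma>, and the
    approximation error 1.\<close>
  define C3 where "C3 = \<bar>S1 1\<bar> + (2 * K + 50) + 1"
  show ?thesis
  proof (rule that[of "c / (2 * pi)"])
    show "c / (2 * pi) > 0" using c by simp
    show "eventually (\<lambda>T. c / (2 * pi) * sqrt (ln T * ln (ln (ln T)) / ln (ln T) ^ 3) \<le> (SUP t\<in>{T powr \<beta>..T}. S1 t)) at_top"
      using evr large_value_setup[OF \<beta> K(1), folded \<beta>'_def] growth_at_top[OF c, of "2 * (pi * C3 + 54)"]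
    proof eventually_elim
      case (elim T)
      define G where "G = sqrt (ln T * ln (ln (ln T)) / ln (ln T) ^ 3)"
      define X where "X = ln T"
      define l2 where "l2 = ln X"
      define \<delta> where "\<delta> = 1 / l2"
      have T: "T > 1" "X > 1" "l2 \<ge> 2" "1 \<le> T powr \<beta>" "T powr \<beta> + X + 1 \<le> T powr \<beta>'" "T / 2 + X + 1 \<le> T"
        and small: "2 * exp (- X\<^sup>2 * l2\<^sup>2 / 4) * (2 * K * (2 + T) + C0 * exp (9/8 * l2\<^sup>2)) \<le> 1" "32 * exp (9/8 * l2\<^sup>2) \<le> T powr \<beta>'"
        using elim(2) by (auto simp: X_def l2_def)
      have \<delta>: "0 < \<delta>" "\<delta> \<le> 1/2" "\<delta> \<le> 1" using T by (auto simp: \<delta>_def field_simps)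
      have dd: "9 / (8 * \<delta>\<^sup>2) = 9/8 * l2\<^sup>2" "- X\<^sup>2 / (4 * \<delta>\<^sup>2) = - X\<^sup>2 * l2\<^sup>2 / 4" using T by (auto simp: \<delta>_def power_divide)
      define B1 where "B1 = (SUP t\<in>{T powr \<beta>..T}. S1 t)"
      have S1B: "S1 t \<le> B1" if "t \<in> {T powr \<beta>..T}" for t
        unfolding B1_def by (rule cSUP_upper[OF that S1_bdd]) (use T in auto)
      obtain \<sigma> where \<sigma>: "1/2 < \<sigma>" "\<sigma> < 1/2 + \<delta>" "\<sigma> \<le> 2" "\<And>t. t \<in> {1..T} \<Longrightarrow> \<bar>S1 t - S1 1 - (s1 \<sigma> t - s1 \<sigma> 1)\<bar> \<le> 1"
        using S_integrable_and_approx(2)[of T 1 \<delta>] T \<delta> by auto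
      have "sm \<sigma> 1 \<le> 2 * K" using K(2)[of "Complex \<sigma> 1"] \<sigma> by (simp add: sm_def)
      then have "pi * s1 \<sigma> 1 \<le> 2 * K + 50" using sm_s1[OF \<sigma>(1,3), of 1] by linarith
      moreover have "s1 \<sigma> 1 \<le> 2 * K + 50"
      proof (cases "s1 \<sigma> 1 \<le> 0")
        case False
        then have "1 * s1 \<sigma> 1 \<le> pi * s1 \<sigma> 1" using pi_gt3 by (intro mult_right_mono) auto
        then show ?thesis using \<open>pi * s1 \<sigma> 1 \<le> 2 * K + 50\<close> by linarith
      qed (use K(1) in linarith)
      ultimately have s1b: "s1 \<sigma> t \<le> B1 + C3" if t: "t \<in> {T powr \<beta>..T}" for t
        using \<sigma>(4)[of t] S1B[OF t] t T(4) unfolding C3_def by auto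
      \<comment> \<open>\<open>resonance_large\<close> asks for a nonnegative bound. That the
        maximum is not the value 0 follows at the end from the growth of G.\<close>
      define B' where "B' = max 0 (pi * (B1 + C3) + 50)"
      have smB: "sm \<sigma> t \<le> B'" if t: "t \<in> {T powr \<beta>..T}" for t
      proof -
        have "pi * s1 \<sigma> t \<le> pi * (B1 + C3)" using s1b[OF t] by (intro mult_left_mono) auto
        moreover have "pi * (B1 + C3) + 50 \<le> B'" by (simp add: B'_def)
        moreover have "1 \<le> t" using t T(4) by simp
        ultimately show ?thesis using sm_s1[OF \<sigma>(1,3), of t] by linarith
      qed
      have D: "(\<Sum>n. gcoef \<sigma> (1 / ln (ln T)) n * 1 * cos (t * ln (real n))) \<le> B' + 2" if t: "T powr \<beta>' \<le> t" "t \<le> T / 2" for t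
      proof -
        have t0: "t > 0" using t T by linarith
        have "(\<integral>u. sm \<sigma> (t + u) * normal_density 0 \<delta> u \<partial>lborel) \<le> B' + 1"
        proof (rule normal_conv_upper[where ?b0.0 = X and w = "\<lambda>u. \<bar>sm \<sigma> (t + u)\<bar>"])
          show "integrable lborel (\<lambda>u. indicator {u. X < \<bar>u\<bar>} u * (\<bar>sm \<sigma> (t + u)\<bar> * normal_density 0 \<delta> u))"
            by (rule sm_tail(1)[OF K(2,1) \<sigma>(1,3) \<delta>(1,2)]) (use T in auto)
          have "(\<integral>u. indicator {u. X < \<bar>u\<bar>} u * (\<bar>sm \<sigma> (t + u)\<bar> * normal_density 0 \<delta> u) \<partial>lborel)
            \<le> 2 * exp (- X\<^sup>2 / (4 * \<delta>\<^sup>2)) * (2 * K * (2 + \<bar>t\<bar>) + C0 * exp (9 / (8 * \<delta>\<^sup>2)))"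
            by (rule sm_tail(2)[OF K(2,1) \<sigma>(1,3) \<delta>(1,2)]) (use T in auto)
          also have "\<dots> \<le> 2 * exp (- X\<^sup>2 / (4 * \<delta>\<^sup>2)) * (2 * K * (2 + T) + C0 * exp (9 / (8 * \<delta>\<^sup>2)))"
            using t t0 T K(1) C0_pos by (intro mult_left_mono add_mono) auto
          also have "\<dots> \<le> 1" using small(1) unfolding dd .
          finally show "(\<integral>u. indicator {u. X < \<bar>u\<bar>} u * (\<bar>sm \<sigma> (t + u)\<bar> * normal_density 0 \<delta> u) \<partial>lborel) \<le> 1" .
          show "sm \<sigma> (t + u) \<le> B'" if "\<bar>u\<bar> \<le> X" for u by (rule smB) (use that t T in auto)
        qed (use \<delta> \<sigma> sm_integrable in \<open>auto simp: B'_def\<close>)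
        then have F: "conv \<sigma> \<delta> t \<le> B' + 1" by (simp add: conv_def)
        have "32 * exp (9 / (8 * \<delta>\<^sup>2)) / (1 + \<bar>t\<bar>) \<le> 1"
          using small(2) t(1) t0 unfolding dd by (subst pos_divide_le_eq) auto
        then have "(\<Sum>n. gcoef \<sigma> \<delta> n * cos (t * ln (real n))) \<le> B' + 2"
          using conv_series[OF \<sigma>(1,3) \<delta>(1,3), of t] F by linarith
        then show ?thesis by (simp add: \<delta>_def l2_def X_def)
      qed
      have "c * 1 * G \<le> (B' + 2) + 1" unfolding G_def
        using elim(1)[rule_format, of \<sigma> "\<lambda>_. 1" 1 "B' + 2"] \<sigma>(1,2) D by (simp add: B'_def \<delta>_def l2_def X_def)
      then have cG: "c * G \<le> B' + 3" by simp
      have big: "2 * (pi * C3 + 54) \<le> c * G" using elim(3) by (simp add: G_def)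
      have C3: "0 \<le> pi * C3" using K(1) by (simp add: C3_def)
      have "B' = pi * (B1 + C3) + 50" using cG big C3 unfolding B'_def max_def by (auto split: if_splits)
      then have "c * G / 2 \<le> pi * B1" using cG big by (simp add: distrib_left)
      then have "c / (2 * pi) * G \<le> B1" by (simp add: field_simps)
      then show ?case by (simp add: G_def B1_def)
    qed
  qed
qed

section \<open>Large values of S\<close>

text \<open>The constants S_1(1) and \<open>s1 \<sigma> 1\<close> cancel in the second difference.
  Dividing by \<delta> = 1 / ln (ln T) at the end gains the factor that turns the cube of ln (ln T)
  under the root into its first power.\<close>

lemma S_large:
  assumes \<beta>: "0 \<le> \<beta>" "\<beta> < 1"
  obtains c where "c > 0"
    "eventually (\<lambda>T. c * sqrt (ln T * ln (ln (ln T)) / ln (ln T)) \<le> (SUP t\<in>{T powr \<beta>..T}. \<bar>S t\<bar>)) at_top"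
proof -
  define \<beta>' where "\<beta>' = (1 + \<beta>) / 2"
  have \<beta>': "0 \<le> \<beta>'" "\<beta>' < 1" using \<beta> by (auto simp: \<beta>'_def)
  obtain K where K: "K > 0" "\<And>s. 1/2 < Re s \<Longrightarrow> Re s \<le> 2 \<Longrightarrow> - Re (LL s) \<le> K * (1 + \<bar>Im s\<bar>)"
    using minus_Re_LL_upper by blast
  obtain c where c: "c > 0" and evr: "eventually (\<lambda>T. \<forall>\<sigma> m m0 Bd. 1/2 \<le> \<sigma> \<longrightarrow> \<sigma> \<le> 1/2 + 1 / ln (ln T) \<longrightarrow> (\<forall>n. 0 \<le> m n \<and> m n \<le> 4) \<longrightarrow> 0 \<le> m0 \<longrightarrow>
       (\<forall>p. prime p \<longrightarrow> ln T \<le> real p \<longrightarrow> ln (real p) \<le> 2 * ln (ln T) \<longrightarrow> m0 \<le> m p) \<longrightarrow> 0 \<le> Bd \<longrightarrow>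
       (\<forall>t. T powr \<beta>' \<le> t \<longrightarrow> t \<le> T / 2 \<longrightarrow> (\<Sum>n. gcoef \<sigma> (1 / ln (ln T)) n * m n * cos (t * ln (real n))) \<le> Bd) \<longrightarrow>
       c * m0 * sqrt (ln T * ln (ln (ln T)) / ln (ln T) ^ 3) \<le> Bd + 1) at_top"
    using resonance_large[OF \<beta>'] by blast
  \<comment> \<open>On the primes of the resonator \<delta> ln p lies between 1 and 2, where cos is
    at most cos 1.\<close>
  define m0 where "m0 = 2 * (1 - cos (1::real))"
  have m0: "m0 > 0" unfolding m0_def using cos_monotone_0_pi[of 0 1] pi_gt3 by simp
  have cm: "c * m0 > 0" using c m0 by simp
  show ?thesis
  proof (rule that[of "c * m0 / (4 * pi)"])
    show "c * m0 / (4 * pi) > 0" using cm by simp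
    show "eventually (\<lambda>T. c * m0 / (4 * pi) * sqrt (ln T * ln (ln (ln T)) / ln (ln T)) \<le> (SUP t\<in>{T powr \<beta>..T}. \<bar>S t\<bar>)) at_top"
      using evr large_value_setup[OF \<beta> K(1), folded \<beta>'_def] growth_at_top[OF cm, of "2 * (4 * pi + 209)"]
    proof eventually_elim
      case (elim T)
      define G where "G = sqrt (ln T * ln (ln (ln T)) / ln (ln T) ^ 3)"
      define X where "X = ln T"
      define l2 where "l2 = ln X"
      define \<delta> where "\<delta> = 1 / l2"
      have T: "T > 1" "X > 1" "l2 \<ge> 2" "1 \<le> T powr \<beta>" "T powr \<beta> + X + 1 \<le> T powr \<beta>'" "T / 2 + X + 1 \<le> T"
        and small: "2 * exp (- X\<^sup>2 * l2\<^sup>2 / 4) * (2 * K * (2 + T) + C0 * exp (9/8 * l2\<^sup>2)) \<le> 1" "32 * exp (9/8 * l2\<^sup>2) \<le> T powr \<beta>'"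
        using elim(2) by (auto simp: X_def l2_def)
      have \<delta>: "0 < \<delta>" "\<delta> \<le> 1/2" "\<delta> \<le> 1" using T by (auto simp: \<delta>_def field_simps)
      have dd: "9 / (8 * \<delta>\<^sup>2) = 9/8 * l2\<^sup>2" "- X\<^sup>2 / (4 * \<delta>\<^sup>2) = - X\<^sup>2 * l2\<^sup>2 / 4" using T by (auto simp: \<delta>_def power_divide)
      define B0 where "B0 = (SUP t\<in>{T powr \<beta>..T}. \<bar>S t\<bar>)"
      have SB: "\<bar>S t\<bar> \<le> B0" if "t \<in> {T powr \<beta>..T}" for t
        unfolding B0_def by (rule cSUP_upper[OF that S_bdd]) (use T in auto)
      have B00: "B0 \<ge> 0" using SB[of T] T \<beta> powr_mono[of \<beta> 1 T] abs_ge_zero[of "S T"] by (simp add: order_trans[OF abs_ge_zero])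
      have SI: "S integrable_on {0..T}" using T by (intro S_integrable_and_approx(1)) auto
      have inc: "\<bar>S1 b - S1 a\<bar> \<le> B0 * (b - a)" if ab: "T powr \<beta> \<le> a" "a \<le> b" "b \<le> T" for a b
      proof -
        have i0b: "S integrable_on {0..b}" by (rule integrable_on_subinterval[OF SI]) (use ab T in auto)
        have iab: "S integrable_on {a..b}" by (rule integrable_on_subinterval[OF SI]) (use ab T in auto)
        have "S1 b = S1 a + integral {a..b} S"
          unfolding S1_def using Henstock_Kurzweil_Integration.integral_combine[of 0 a b S] i0b ab T by simp
        then have e: "S1 b - S1 a = integral {a..b} S" by simp
        have "norm (integral {a..b} S) \<le> integral {a..b} (\<lambda>_. B0)"
          by (rule integral_norm_bound_integral[OF iab]) (use SB ab in auto)
        then show ?thesis unfolding e using ab by (simp add: mult.commute)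
      qed
      obtain \<sigma> where \<sigma>: "1/2 < \<sigma>" "\<sigma> < 1/2 + \<delta>" "\<sigma> \<le> 2" "\<And>t. t \<in> {1..T} \<Longrightarrow> \<bar>S1 t - S1 1 - (s1 \<sigma> t - s1 \<sigma> 1)\<bar> \<le> 1"
        using S_integrable_and_approx(2)[of T 1 \<delta>] T \<delta> by auto
      \<comment> \<open>The second difference has total weight 2 + 1 + 1 = 4: four approximation
        errors 1, and four errors 50 from \<open>sm_s1\<close>.\<close>
      define B' where "B' = pi * (2 * \<delta> * B0 + 4) + 200"
      have B'0: "B' \<ge> 0" using B00 \<delta> by (simp add: B'_def)
      have smB: "2 * sm \<sigma> t - sm \<sigma> (t + \<delta>) - sm \<sigma> (t - \<delta>) \<le> B'" if t: "T powr \<beta> + \<delta> \<le> t" "t + \<delta> \<le> T" for t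
      proof -
        have "2 * S1 t - S1 (t + \<delta>) - S1 (t - \<delta>) \<le> 2 * \<delta> * B0"
          using inc[of t "t + \<delta>"] inc[of "t - \<delta>" t] t \<delta> by (simp add: algebra_simps)
        then have "2 * s1 \<sigma> t - s1 \<sigma> (t + \<delta>) - s1 \<sigma> (t - \<delta>) \<le> 2 * \<delta> * B0 + 4"
          using \<sigma>(4)[of t] \<sigma>(4)[of "t + \<delta>"] \<sigma>(4)[of "t - \<delta>"] t T(4) \<delta> by auto
        then have "pi * (2 * s1 \<sigma> t - s1 \<sigma> (t + \<delta>) - s1 \<sigma> (t - \<delta>)) \<le> pi * (2 * \<delta> * B0 + 4)" by (intro mult_left_mono) auto
        then have "2 * (pi * s1 \<sigma> t) - pi * s1 \<sigma> (t + \<delta>) - pi * s1 \<sigma> (t - \<delta>) \<le> pi * (2 * \<delta> * B0 + 4)" by (simp add: algebra_simps)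
        then show ?thesis unfolding B'_def
          using sm_s1[OF \<sigma>(1,3), of t] sm_s1[OF \<sigma>(1,3), of "t + \<delta>"] sm_s1[OF \<sigma>(1,3), of "t - \<delta>"] t T(4) \<delta> by linarith
      qed
      have tail: "integrable lborel (\<lambda>u. indicator {u. X < \<bar>u\<bar>} u * (\<bar>sm \<sigma> (t + u)\<bar> * normal_density 0 \<delta> u))"
          "(\<integral>u. indicator {u. X < \<bar>u\<bar>} u * (\<bar>sm \<sigma> (t + u)\<bar> * normal_density 0 \<delta> u) \<partial>lborel) \<le> 1" if t: "0 \<le> t" "t \<le> T" for t
      proof -
        show "integrable lborel (\<lambda>u. indicator {u. X < \<bar>u\<bar>} u * (\<bar>sm \<sigma> (t + u)\<bar> * normal_density 0 \<delta> u))"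
          by (rule sm_tail(1)[OF K(2,1) \<sigma>(1,3) \<delta>(1,2)]) (use T in auto)
        have "(\<integral>u. indicator {u. X < \<bar>u\<bar>} u * (\<bar>sm \<sigma> (t + u)\<bar> * normal_density 0 \<delta> u) \<partial>lborel)
          \<le> 2 * exp (- X\<^sup>2 / (4 * \<delta>\<^sup>2)) * (2 * K * (2 + \<bar>t\<bar>) + C0 * exp (9 / (8 * \<delta>\<^sup>2)))"
          by (rule sm_tail(2)[OF K(2,1) \<sigma>(1,3) \<delta>(1,2)]) (use T in auto)
        also have "\<dots> \<le> 2 * exp (- X\<^sup>2 / (4 * \<delta>\<^sup>2)) * (2 * K * (2 + T) + C0 * exp (9 / (8 * \<delta>\<^sup>2)))"
          using t T K(1) C0_pos by (intro mult_left_mono add_mono) auto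
        also have "\<dots> \<le> 1" using small(1) unfolding dd .
        finally show "(\<integral>u. indicator {u. X < \<bar>u\<bar>} u * (\<bar>sm \<sigma> (t + u)\<bar> * normal_density 0 \<delta> u) \<partial>lborel) \<le> 1" .
      qed
      define Ds where "Ds t = (\<Sum>n. gcoef \<sigma> \<delta> n * cos (t * ln (real n)))" for t
      \<comment> \<open>At t - \<delta> the argument may fall below \<open>T powr \<beta>'\<close>;
        the 1 in the denominator 1 + |t| absorbs this.\<close>
      have cD: "\<bar>conv \<sigma> \<delta> t - Ds t\<bar> \<le> 1" if t: "T powr \<beta>' - 1 \<le> t" for t
      proof -
        have "32 * exp (9 / (8 * \<delta>\<^sup>2)) / (1 + \<bar>t\<bar>) \<le> 1"
          using small(2) t unfolding dd by (subst pos_divide_le_eq) auto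
        then show ?thesis unfolding Ds_def using conv_series[OF \<sigma>(1,3) \<delta>(1,3), of t] by linarith
      qed
      define m where "m n = 2 * (1 - cos (\<delta> * ln (real n)))" for n :: nat
      \<comment> \<open>The 8 consists of 4 for the tails and 4 for the remainders of the explicit
        formula, again by the weights 2, 1, 1.\<close>
      have D: "(\<Sum>n. gcoef \<sigma> (1 / ln (ln T)) n * m n * cos (t * ln (real n))) \<le> B' + 8" if t: "T powr \<beta>' \<le> t" "t \<le> T / 2" for t
      proof -
        have t0: "t > 1" using t T by linarith
        let ?q = "\<lambda>u. 2 * sm \<sigma> (t + u) - sm \<sigma> ((t + \<delta>) + u) - sm \<sigma> ((t - \<delta>) + u)"
        let ?I = "\<lambda>s u. indicator {u. X < \<bar>u\<bar>} u * (\<bar>sm \<sigma> (s + u)\<bar> * normal_density 0 \<delta> u)"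
        have qe: "?q u * normal_density 0 \<delta> u = 2 * (sm \<sigma> (t + u) * normal_density 0 \<delta> u) - sm \<sigma> ((t + \<delta>) + u) * normal_density 0 \<delta> u - sm \<sigma> ((t - \<delta>) + u) * normal_density 0 \<delta> u" for u
          by (simp add: algebra_simps)
        note si = sm_integrable[OF \<sigma>(1,3) \<delta>(1)]
        have we: "indicator {u. X < \<bar>u\<bar>} u * ((2 * \<bar>sm \<sigma> (t + u)\<bar> + \<bar>sm \<sigma> ((t + \<delta>) + u)\<bar> + \<bar>sm \<sigma> ((t - \<delta>) + u)\<bar>) * normal_density 0 \<delta> u)
            = 2 * ?I t u + ?I (t + \<delta>) u + ?I (t - \<delta>) u" for u
          by (simp add: algebra_simps)
        have tt: "0 \<le> t" "t \<le> T" "0 \<le> t + \<delta>" "t + \<delta> \<le> T" "0 \<le> t - \<delta>" "t - \<delta> \<le> T" using t t0 T \<delta> by linarith+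
        note i1 = tail(1)[OF tt(1,2)] and i2 = tail(1)[OF tt(3,4)] and i3 = tail(1)[OF tt(5,6)]
        have i12: "integrable lborel (\<lambda>u. 2 * ?I t u + ?I (t + \<delta>) u)" by (intro Bochner_Integration.integrable_add integrable_mult_right i1 i2)
        have "(\<integral>u. ?q u * normal_density 0 \<delta> u \<partial>lborel) \<le> B' + 4"
        proof (rule normal_conv_upper[where ?b0.0 = X and w = "\<lambda>u. 2 * \<bar>sm \<sigma> (t + u)\<bar> + \<bar>sm \<sigma> ((t + \<delta>) + u)\<bar> + \<bar>sm \<sigma> ((t - \<delta>) + u)\<bar>", OF \<delta>(1)])
          show "integrable lborel (\<lambda>u. ?q u * normal_density 0 \<delta> u)"
            unfolding qe by (intro Bochner_Integration.integrable_diff integrable_mult_right si)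
          show "integrable lborel (\<lambda>u. indicator {u. X < \<bar>u\<bar>} u * ((2 * \<bar>sm \<sigma> (t + u)\<bar> + \<bar>sm \<sigma> ((t + \<delta>) + u)\<bar> + \<bar>sm \<sigma> ((t - \<delta>) + u)\<bar>) * normal_density 0 \<delta> u))"
            unfolding we by (intro Bochner_Integration.integrable_add i12 i3)
          have "(\<integral>u. 2 * ?I t u + ?I (t + \<delta>) u + ?I (t - \<delta>) u \<partial>lborel) = 2 * (\<integral>u. ?I t u \<partial>lborel) + (\<integral>u. ?I (t + \<delta>) u \<partial>lborel) + (\<integral>u. ?I (t - \<delta>) u \<partial>lborel)"
            unfolding Bochner_Integration.integral_add[OF i12 i3] Bochner_Integration.integral_add[OF integrable_mult_right[OF i1] i2] integral_mult_right_zero by (rule refl)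
          also have "\<dots> \<le> 4" using tail(2)[OF tt(1,2)] tail(2)[OF tt(3,4)] tail(2)[OF tt(5,6)] by linarith
          finally show "(\<integral>u. indicator {u. X < \<bar>u\<bar>} u * ((2 * \<bar>sm \<sigma> (t + u)\<bar> + \<bar>sm \<sigma> ((t + \<delta>) + u)\<bar> + \<bar>sm \<sigma> ((t - \<delta>) + u)\<bar>) * normal_density 0 \<delta> u) \<partial>lborel) \<le> 4"
            unfolding we .
          show "?q u \<le> B'" if "\<bar>u\<bar> \<le> X" for u
          proof -
            have "2 * sm \<sigma> (t + u) - sm \<sigma> (t + u + \<delta>) - sm \<sigma> (t + u - \<delta>) \<le> B'"
              by (rule smB) (use that t T \<delta> in linarith)+
            then show ?thesis by (simp add: algebra_simps)
          qed
          show "?q u \<le> 2 * \<bar>sm \<sigma> (t + u)\<bar> + \<bar>sm \<sigma> ((t + \<delta>) + u)\<bar> + \<bar>sm \<sigma> ((t - \<delta>) + u)\<bar>" for u by linarith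
        qed (rule B'0)
        moreover have "(\<integral>u. ?q u * normal_density 0 \<delta> u \<partial>lborel) = 2 * conv \<sigma> \<delta> t - conv \<sigma> \<delta> (t + \<delta>) - conv \<sigma> \<delta> (t - \<delta>)"
        proof -
          have j: "integrable lborel (\<lambda>u. 2 * (sm \<sigma> (t + u) * normal_density 0 \<delta> u) - sm \<sigma> ((t + \<delta>) + u) * normal_density 0 \<delta> u)"
            by (intro Bochner_Integration.integrable_diff integrable_mult_right si)
          show ?thesis unfolding qe conv_def Bochner_Integration.integral_diff[OF j si]
              Bochner_Integration.integral_diff[OF integrable_mult_right[OF si] si] integral_mult_right_zero by (rule refl)
        qed
        moreover have "\<bar>conv \<sigma> \<delta> t - Ds t\<bar> \<le> 1" "\<bar>conv \<sigma> \<delta> (t + \<delta>) - Ds (t + \<delta>)\<bar> \<le> 1" "\<bar>conv \<sigma> \<delta> (t - \<delta>) - Ds (t - \<delta>)\<bar> \<le> 1"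
          by (rule cD, use t \<delta> in linarith)+
        ultimately have "2 * Ds t - Ds (t + \<delta>) - Ds (t - \<delta>) \<le> B' + 8" by linarith
        moreover have "(\<lambda>n. 2 * (gcoef \<sigma> \<delta> n * cos (t * ln (real n))) - gcoef \<sigma> \<delta> n * cos ((t + \<delta>) * ln (real n)) - gcoef \<sigma> \<delta> n * cos ((t - \<delta>) * ln (real n))) sums (2 * Ds t - Ds (t + \<delta>) - Ds (t - \<delta>))"
          unfolding Ds_def by (intro sums_diff sums_mult summable_sums gcoef_cos_summable) (use \<sigma> \<delta> in auto)
        \<comment> \<open>2 cos a - cos (a + b) - cos (a - b) = 2 (1 - cos b) cos a.\<close>
        moreover have "2 * (gcoef \<sigma> \<delta> n * cos (t * ln (real n))) - gcoef \<sigma> \<delta> n * cos ((t + \<delta>) * ln (real n)) - gcoef \<sigma> \<delta> n * cos ((t - \<delta>) * ln (real n)) = gcoef \<sigma> \<delta> n * m n * cos (t * ln (real n))" for n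
          by (simp add: m_def distrib_right left_diff_distrib cos_add cos_diff) (simp add: algebra_simps)
        ultimately show ?thesis by (simp add: sums_iff \<delta>_def l2_def X_def)
      qed
      have mb: "0 \<le> m n \<and> m n \<le> 4" for n
        using cos_le_one[of "\<delta> * ln (real n)"] cos_ge_minus_one[of "\<delta> * ln (real n)"] unfolding m_def by argo
      have mp: "m0 \<le> m p" if p: "ln T \<le> real p" "ln (real p) \<le> 2 * ln (ln T)" for p
      proof -
        have "l2 \<le> ln (real p)" unfolding l2_def X_def[symmetric] using p(1) T(2) by (subst ln_le_cancel_iff) (auto simp: X_def)
        then have "1 \<le> \<delta> * ln (real p)" "\<delta> * ln (real p) \<le> 2" using p(2) T(3) by (auto simp: \<delta>_def field_simps l2_def X_def)
        then have "cos (\<delta> * ln (real p)) \<le> cos 1" using pi_gt3 by (intro cos_monotone_0_pi_le) auto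
        then show ?thesis by (simp add: m_def m0_def)
      qed
      have "c * m0 * G \<le> (B' + 8) + 1" unfolding G_def
        using elim(1)[rule_format, of \<sigma> m m0 "B' + 8"] \<sigma>(1,2) D mb mp m0 B'0 by (simp add: \<delta>_def l2_def X_def)
      moreover have "2 * (4 * pi + 209) \<le> c * m0 * G" using elim(3) by (simp add: G_def)
      ultimately have "c * m0 * G / 2 \<le> 2 * pi * \<delta> * B0" by (simp add: B'_def algebra_simps)
      then have "c * m0 / (4 * pi) * (l2 * G) \<le> B0" using T(3) by (simp add: \<delta>_def field_simps)
      moreover have "l2 * G = sqrt (ln T * ln (ln (ln T)) / ln (ln T))"
      proof -
        have "l2 * G = sqrt (l2\<^sup>2) * sqrt (X * ln l2 / l2 ^ 3)" using T(3) by (simp add: G_def l2_def X_def)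
        also have "\<dots> = sqrt (l2\<^sup>2 * (X * ln l2 / l2 ^ 3))" by (rule real_sqrt_mult[symmetric])
        also have "l2\<^sup>2 * (X * ln l2 / l2 ^ 3) = X * ln l2 / l2" using T(3) by (simp add: power2_eq_square power3_eq_cube)
        finally show ?thesis by (simp add: l2_def X_def)
      qed
      ultimately show ?case by (simp add: B0_def)
    qed
  qed
qed

end

theorem theorem2:
  fixes \<beta> :: real
  assumes "RH" and "0 \<le> \<beta>" and "\<beta> < 1"
  shows "\<exists>c>0. \<exists>c1>0. eventually (\<lambda>T.
      (SUP t\<in>{T powr \<beta>..T}. \<bar>S t\<bar>)
        \<ge> c * sqrt (ln T * ln (ln (ln T)) / ln (ln T)) \<and>
      (SUP t\<in>{T powr \<beta>..T}. S1 t)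
        \<ge> c1 * sqrt (ln T * ln (ln (ln T)) / (ln (ln T)) ^ 3)) at_top"
proof -
  obtain Lt LL where "zeta_log Lt LL" using RH_imp_zeta_log[OF assms(1)] by blast
  then interpret zeta_log Lt LL .
  obtain c where c: "c > 0" "eventually (\<lambda>T. c * sqrt (ln T * ln (ln (ln T)) / ln (ln T)) \<le> (SUP t\<in>{T powr \<beta>..T}. \<bar>S t\<bar>)) at_top"
    using S_large[OF assms(2,3)] by blast
  obtain c1 where c1: "c1 > 0" "eventually (\<lambda>T. c1 * sqrt (ln T * ln (ln (ln T)) / ln (ln T) ^ 3) \<le> (SUP t\<in>{T powr \<beta>..T}. S1 t)) at_top"
    using S1_large[OF assms(2,3)] by blast
  show ?thesis
    using c(1) c1(1) eventually_conj[OF c(2) c1(2)] by (intro exI[of _ c] exI[of _ c1] conjI) auto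
qed

end
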